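(* Let $E:[0,\infty)\times\mathbb R^2\to\mathbb R^2$ be a given electric field. The second-order scheme described in the context possesses, for all $\varepsilon>0$, $\Delta t>0$ and initial data $(x_\varepsilon^0,v_\varepsilon^0)\in\mathbb R^2\times\mathbb R^2$ (with $y_\varepsilon^0=x_\varepsilon^0-\varepsilon(v_\varepsilon^0)^\perp$), a unique solution $(y_\varepsilon^n,v_\varepsilon^n)_{n\ge0}$. Moreover, set $x_\varepsilon^n=y_\varepsilon^n+\varepsilon(v_\varepsilon^n)^\perp$, let $(x_\varepsilon(t),v_\varepsilon(t))$ be the exact solution of the characteristic system (see context) with initial data $(x_\varepsilon^0,v_\varepsilon^0)$ at $t=0$, and set $y_\varepsilon(t)=x_\varepsilon(t)-\varepsilon v_\varepsilon^\perp(t)$. Then: (i) there exists a universal constant $C_0$ such that, when $E\in W^{2,\infty}$, there is a constant $C$ depending only on $E$ such that for all $n\ge0$, $\Delta t>0$, $\varepsilon>0$ and all initial data, $$\|x_\varepsilon^n-x_\varepsilon(t_n)\|\le C\,e^{C_0K_xt_n}\,(1+t_n)^3\,(1+\varepsilon^2+\|v_\varepsilon^0\|^2)\,\min\left(\frac{\Delta t^2}{\varepsilon^5}(1+\varepsilon^3),\ \varepsilon+\Delta t^2\right);$$ (ii) there exists a universal constant $C_0$ such that, when $E\in W^{2,\infty}$, there is a constant $C$ depending only on $E$ such that for all $n\ge0$, $\Delta t>0$, $\varepsilon>0$ and all initial data, $$\|y_\varepsilon^n-y_\varepsilon(t_n)\|\le C\,e^{C_0K_xt_n}\,(1+t_n)^4\,(1+\varepsilon^2+\|v_\varepsilon^0\|^2)\,\min\left(\frac{\Delta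 t^2}{\varepsilon^5}(1+\varepsilon^3),\ \varepsilon^2+\Delta t^2\right).$$
   Context: For $a=(a_1,a_2)\in\mathbb R^2$, $a^\perp:=(-a_2,a_1)$, and $E^\perp(t,x):=(E(t,x))^\perp$. $\|\cdot\|$ is the Euclidean norm on vectors and the corresponding operator norm on linear maps. $E\in W^{k,\infty}$ means that $E$ and its derivatives in $(t,x)\in[0,\infty)\times\mathbb R^2$ up to order $k$ are globally bounded. $K_x:=\|\mathrm d_xE\|_{L^\infty}$, where $\mathrm d_x$ is the differential in $x$. The characteristic system is, for $t\ge0$, $$\varepsilon x_\varepsilon'(t)=v_\varepsilon(t),\qquad \varepsilon v_\varepsilon'(t)=E(t,x_\varepsilon(t))-\frac{v_\varepsilon^\perp(t)}{\varepsilon},\qquad x_\varepsilon(0)=x_\varepsilon^0,\ v_\varepsilon(0)=v_\varepsilon^0.$$ Second-order scheme: let $\gamma=1-\frac1{\sqrt2}$ (the smallest root of $\gamma^2-2\gamma+\frac12=0$), $t_n=n\Delta t$, and $$F_y(t,\hat y,w):=-E^\perp(t,\hat y+w^\perp),\qquad F_v^\varepsilon(t,\hat y,\hat w,w):=E(t,\hat y+\hat w^\perp)-\frac{w^\perp}{\varepsilon^2}.$$ Given $(y_\varepsilon^n,v_\varepsilon^n)$, $n\ge 0$, the scheme defines, with $\hat t_{n+1}:=t_n+\frac{\Delta t}{2\gamma}$: first stage $$\varepsilon\frac{\tilde v_\varepsilon^{n+1}-v_\varepsilon^n}{\gamma\Delta t}=F_v^\varepsilon(t_n,y_\varepsilon^n,\varepsilon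 v_\varepsilon^n,\varepsilon\tilde v_\varepsilon^{n+1});$$ second stage $$\frac{\hat y_\varepsilon^{n+1}-y_\varepsilon^n}{\Delta t/(2\gamma)}=F_y(t_n,y_\varepsilon^n,\varepsilon\tilde v_\varepsilon^{n+1}),\qquad \varepsilon\frac{\hat v_\varepsilon^{n+1}-v_\varepsilon^n}{\Delta t/(2\gamma)}=F_v^\varepsilon(t_n,y_\varepsilon^n,\varepsilon v_\varepsilon^n,\varepsilon\tilde v_\varepsilon^{n+1});$$ final stage $$\frac{y_\varepsilon^{n+1}-y_\varepsilon^n}{\Delta t}=(1-\gamma)F_y(t_n,y_\varepsilon^n,\varepsilon\tilde v_\varepsilon^{n+1})+\gamma F_y(\hat t_{n+1},\hat y_\varepsilon^{n+1},\varepsilon v_\varepsilon^{n+1}),$$ $$\varepsilon\frac{v_\varepsilon^{n+1}-v_\varepsilon^n}{\Delta t}=(1-\gamma)F_v^\varepsilon(t_n,y_\varepsilon^n,\varepsilon v_\varepsilon^n,\varepsilon\tilde v_\varepsilon^{n+1})+\gamma F_v^\varepsilon(\hat t_{n+1},\hat y_\varepsilon^{n+1},\varepsilon\hat v_\varepsilon^{n+1},\varepsilon v_\varepsilon^{n+1}).$$ *)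

theory Defs
  imports "HOL-Analysis.Analysis"
begin

type_synonym plane = "real ^ 2"

definition perp :: "plane \<Rightarrow> plane" where
  "perp a = vector [- (a $ 2), a $ 1]"


subsection \<open>Sobolev spaces \<open>W\<^sup>k\<^sup>,\<^sup>\<infinity>\<close>\<close>

definition ess_bounded :: "'a::euclidean_space set \<Rightarrow> ('a \<Rightarrow> 'b::real_normed_vector) \<Rightarrow> bool" where
  "ess_bounded \<Omega> f \<longleftrightarrow> (\<exists>B. AE z in lebesgue_on \<Omega>. norm (f z) \<le> B)"

definition Linf_norm :: "'a::euclidean_space set \<Rightarrow> ('a \<Rightarrow> 'b::real_normed_vector) \<Rightarrow> real" where
  "Linf_norm \<Omega> f = Inf {B. 0 \<le> B \<and> (AE z in lebesgue_on \<Omega>. norm (f z) \<le> B)}"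

definition locally_integrable ::
  "'a::euclidean_space set \<Rightarrow> ('a \<Rightarrow> 'b::euclidean_space) \<Rightarrow> bool" where
  "locally_integrable \<Omega> f \<longleftrightarrow> (\<forall>K. compact K \<and> K \<subseteq> \<Omega> \<longrightarrow> integrable (lebesgue_on K) f)"

definition test_function ::
  "'a::euclidean_space set \<Rightarrow> ('a \<Rightarrow> real) \<Rightarrow> ('a \<Rightarrow> 'a \<Rightarrow>\<^sub>L real) \<Rightarrow> bool" where
  "test_function \<Omega> \<phi> d\<phi> \<longleftrightarrow>
     (\<forall>z. (\<phi> has_derivative blinfun_apply (d\<phi> z)) (at z)) \<and> continuous_on UNIV d\<phi> \<and>
     (\<exists>K. compact K \<and> K \<subseteq> \<Omega> \<and> (\<forall>z. z \<notin> K \<longrightarrow> \<phi> z = 0))"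

(* g is the weak derivative of f on the open set \<Omega> in the direction b.  As only one derivative is
   taken at a time, the test functions are compactly supported C^1 functions (the convention of
   Gilbarg and Trudinger, Sect. 7.3); testing with smooth functions gives the same notion. *)
definition weak_derivative ::
  "'a::euclidean_space set \<Rightarrow> 'a \<Rightarrow> ('a \<Rightarrow> 'b::euclidean_space) \<Rightarrow> ('a \<Rightarrow> 'b) \<Rightarrow> bool" where
  "weak_derivative \<Omega> b f g \<longleftrightarrow>
     locally_integrable \<Omega> f \<and> locally_integrable \<Omega> g \<and>
     (\<forall>\<phi> d\<phi>. test_function \<Omega> \<phi> d\<phi> \<longrightarrow>
        integral\<^sup>L (lebesgue_on \<Omega>) (\<lambda>z. blinfun_apply (d\<phi> z) b *\<^sub>R f z)
          = - integral\<^sup>L (lebesgue_on \<Omega>) (\<lambda>z. \<phi> z *\<^sub>R g z))"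

primrec W_infinity ::
  "nat \<Rightarrow> 'a::euclidean_space set \<Rightarrow> ('a \<Rightarrow> 'b::euclidean_space) \<Rightarrow> bool" where
  "W_infinity 0 \<Omega> f \<longleftrightarrow> f \<in> borel_measurable (lebesgue_on \<Omega>) \<and> ess_bounded \<Omega> f"
| "W_infinity (Suc k) \<Omega> f \<longleftrightarrow> f \<in> borel_measurable (lebesgue_on \<Omega>) \<and> ess_bounded \<Omega> f \<and>
     (\<forall>b\<in>Basis. \<exists>g. weak_derivative \<Omega> b f g \<and> W_infinity k \<Omega> g)"


subsection \<open>The electric field\<close>

(* Fields are total functions of (t,x); nothing below uses their values at t < 0. *)
type_synonym field = "real \<Rightarrow> plane \<Rightarrow> plane"

abbreviation spacetime :: "(real \<times> plane) set" where
  "spacetime \<equiv> {0<..} \<times> UNIV"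

(* An element of W^{k,\<infinity>} (k >= 1) is a class of functions modulo null sets.  Since the
   characteristics and the scheme use point values of E, E denotes the continuous representative,
   on the closed half space. *)
definition field_W_infinity :: "nat \<Rightarrow> field \<Rightarrow> bool" where
  "field_W_infinity k E \<longleftrightarrow>
     continuous_on ({0..} \<times> UNIV) (\<lambda>(t, x). E t x) \<and> W_infinity k spacetime (\<lambda>(t, x). E t x)"

(* D is the differential of E in x, as an essentially bounded function of (t,x).  It takes values
   in the bounded linear maps, whose norm is the operator norm; measurability is part of
   weak_derivative, for each fixed h. *)
definition x_differential :: "field \<Rightarrow> (real \<times> plane \<Rightarrow> plane \<Rightarrow>\<^sub>L plane) \<Rightarrow> bool" where
  "x_differential E D \<longleftrightarrow> ess_bounded spacetime D \<and>
     (\<forall>h. weak_derivative spacetime (0, h) (\<lambda>(t, x). E t x) (\<lambda>z. blinfun_apply (D z) h))"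

(* The differential is unique up to null sets, so the choice is immaterial. *)
definition K_x :: "field \<Rightarrow> real" where
  "K_x E = Linf_norm spacetime (SOME D. x_differential E D)"


subsection \<open>The characteristic system\<close>

definition characteristic_solution ::
  "field \<Rightarrow> real \<Rightarrow> plane \<Rightarrow> plane \<Rightarrow> (real \<Rightarrow> plane) \<Rightarrow> (real \<Rightarrow> plane) \<Rightarrow> bool" where
  "characteristic_solution E \<epsilon> x0 v0 x v \<longleftrightarrow>
     x 0 = x0 \<and> v 0 = v0 \<and>
     (\<forall>t\<ge>0. \<exists>x' v'.
        (x has_vector_derivative x') (at t within {0..}) \<and>
        (v has_vector_derivative v') (at t within {0..}) \<and>
        \<epsilon> *\<^sub>R x' = v t \<and>
        \<epsilon> *\<^sub>R v' = E t (x t) - perp (v t) /\<^sub>R \<epsilon>)"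


subsection \<open>The second-order scheme\<close>

definition \<gamma> :: real where
  "\<gamma> = 1 - 1 / sqrt 2"

definition F_y :: "field \<Rightarrow> real \<Rightarrow> plane \<Rightarrow> plane \<Rightarrow> plane" where
  "F_y E t y w = - perp (E t (y + perp w))"

definition F_v :: "field \<Rightarrow> real \<Rightarrow> real \<Rightarrow> plane \<Rightarrow> plane \<Rightarrow> plane \<Rightarrow> plane" where
  "F_v E \<epsilon> t y w' w = E t (y + perp w') - perp w /\<^sub>R \<epsilon>\<^sup>2"

(* Relates (y, v) at time t to (y', v') one step later; vt, yh and vh are the stage values. *)
definition scheme_step ::
  "field \<Rightarrow> real \<Rightarrow> real \<Rightarrow> real \<Rightarrow> plane \<times> plane \<Rightarrow> plane \<times> plane \<Rightarrow> bool" where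
  "scheme_step E \<epsilon> \<Delta>t t = (\<lambda>(y, v) (y', v').
     \<exists>vt yh vh.
       (let th = t + \<Delta>t / (2 * \<gamma>) in
        \<epsilon> *\<^sub>R ((vt - v) /\<^sub>R (\<gamma> * \<Delta>t)) = F_v E \<epsilon> t y (\<epsilon> *\<^sub>R v) (\<epsilon> *\<^sub>R vt) \<and>
        (yh - y) /\<^sub>R (\<Delta>t / (2 * \<gamma>)) = F_y E t y (\<epsilon> *\<^sub>R vt) \<and>
        \<epsilon> *\<^sub>R ((vh - v) /\<^sub>R (\<Delta>t / (2 * \<gamma>))) = F_v E \<epsilon> t y (\<epsilon> *\<^sub>R v) (\<epsilon> *\<^sub>R vt) \<and>
        (y' - y) /\<^sub>R \<Delta>t =
          (1 - \<gamma>) *\<^sub>R F_y E t y (\<epsilon> *\<^sub>R vt) + \<gamma> *\<^sub>R F_y E th yh (\<epsilon> *\<^sub>R v') \<and>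
        \<epsilon> *\<^sub>R ((v' - v) /\<^sub>R \<Delta>t) =
          (1 - \<gamma>) *\<^sub>R F_v E \<epsilon> t y (\<epsilon> *\<^sub>R v) (\<epsilon> *\<^sub>R vt) + \<gamma> *\<^sub>R F_v E \<epsilon> th yh (\<epsilon> *\<^sub>R vh) (\<epsilon> *\<^sub>R v')))"

definition scheme_solution ::
  "field \<Rightarrow> real \<Rightarrow> real \<Rightarrow> plane \<Rightarrow> plane \<Rightarrow> (nat \<Rightarrow> plane \<times> plane) \<Rightarrow> bool" where
  "scheme_solution E \<epsilon> \<Delta>t x0 v0 u \<longleftrightarrow>
     u 0 = (x0 - \<epsilon> *\<^sub>R perp v0, v0) \<and>
     (\<forall>n. scheme_step E \<epsilon> \<Delta>t (real n * \<Delta>t) (u n) (u (Suc n)))"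

end

theory Submission
  imports Defs
begin

text \<open>Identify the plane with the complex numbers, so that \<open>perp\<close> becomes multiplication by \<open>\<i>\<close>, and put
\<open>w = \<epsilon> v\<close>, \<open>y = x - \<i> w\<close>. The characteristic system turns into
\<open>y' = - \<i> E t (y + \<i> w)\<close>, \<open>w' = E t (y + \<i> w) - \<i> w / \<epsilon>\<^sup>2\<close>: only the linear rotation of \<open>w\<close> is stiff, and
it is an isometry. The scheme treats this rotation implicitly, with an amplification factor of modulus at
most 1 (\<open>norm_stability_factor\<close>). Hence one step is Lipschitz in \<open>(y, w)\<close> with constant
\<open>exp (C K h)\<close>, uniformly in \<open>\<epsilon>\<close> (\<open>step_stability\<close>), where \<open>h\<close> is the time step and \<open>K\<close> is the Lipschitz
constant of the field in space. This is what keeps every exponential rate proportional to \<open>K_x\<close>.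

Exact and discrete \<open>w\<close> both stay of size \<open>\<epsilon> A\<close>, with
\<open>A = C exp (3 K T) (1 + T) (norm v0 + \<epsilon>)\<close> on \<open>[0, T]\<close> (\<open>exact_w_bound\<close>, \<open>scheme_w_bound\<close>). The distance of \<open>w\<close> to the
equilibrium \<open>- \<i> \<epsilon>\<^sup>2 E\<close> of the fast rotation is the quantity that satisfies a Gronwall inequality whose
source is of order \<open>\<epsilon>\<^sup>2\<close> rather than 1.

The minimum in the error bound comes from two independent estimates. In the first, both the solution and one
step are expanded to second order in \<open>h\<close>; the remainders have size \<open>h\<^sup>3\<close> times a bound on the third derivative of \<open>w\<close>, which
is of order \<open>1 / \<epsilon>^5\<close>, and stability propagates them (\<open>classical_convergence\<close>).

The second estimate concerns \<open>\<epsilon> \<le> 1\<close> and compares both evolutions with the scheme \<open>limit_step\<close> for the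
limit equation \<open>y' = - \<i> E t y\<close>. Expanding \<open>E t (y + \<i> w)\<close> around \<open>y\<close> leaves the linear term
\<open>D t y (\<i> w)\<close>, of size \<open>\<epsilon>\<close>. However \<open>\<i> w = \<epsilon>\<^sup>2 (E - w')\<close>, and the scheme satisfies the exact discrete
analogue of this identity (\<open>implicit_average\<close>), so that the term is of order \<open>\<epsilon>\<^sup>2\<close> up to the increment of
\<open>\<i> \<epsilon>\<^sup>2 D t y w\<close>. Subtracting this corrector from \<open>y\<close>, in the exact solution and in the scheme alike, gives two
quantities which follow \<open>limit_step\<close> up to \<open>h (\<epsilon>\<^sup>2 + h\<^sup>2)\<close> per step (\<open>corrected_step\<close>); mixed terms \<open>h w\<close>
are absorbed by \<open>h\<^sup>2 + w\<^sup>2\<close>. Stability of \<open>limit_step\<close> concludes (\<open>asymptotic_convergence\<close>). For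
\<open>\<epsilon> \<ge> 1\<close> the first estimate already implies the second.

All that these arguments use of the field are pointwise bounds: the field and its slopes are bounded and Lipschitz,
and its first-order Taylor remainder is quadratic. For a field in \<open>W\<^sup>2\<^sup>,\<^sup>\<infinity>\<close> they are obtained by mollification,
with kernels supported strictly on the side of later times so that they remain in the domain
up to the time 0 (\<open>field_regularity\<close>).\<close>

section \<open>Mollification and weak derivatives\<close>

lemma norm_add3_le:
  fixes a b c :: "'a::real_normed_vector"
  assumes "norm a \<le> p" "norm b \<le> q" "norm c \<le> r"
  shows "norm (a + b + c) \<le> p + q + r"
  using norm_triangle_ineq[of "a + b" c] norm_triangle_ineq[of a b] assms by linarith

lemma norm_add_le:
  fixes a b :: "'a::real_normed_vector"
  assumes "norm a \<le> p" "norm b \<le> q"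
  shows "norm (a + b) \<le> p + q"
  using norm_triangle_ineq[of a b] assms by linarith

text \<open>Cubes of positive parts are smooth enough for the kernel below: their second derivative is still
Lipschitz, so one may differentiate twice with uniform bounds.\<close>
lemma pos_part_power_derivative:
  "((\<lambda>s::real. (max 0 s) ^ (k + 2)) has_real_derivative (real k + 2) * (max 0 s) ^ (k + 1)) (at s)"
proof -
  consider "s < 0" | "s = 0" | "0 < s" by linarith
  then show ?thesis
  proof cases
    case 1
    have "((\<lambda>s::real. 0) has_real_derivative 0) (at s)" by simp
    then have "((\<lambda>s::real. (max 0 s) ^ (k + 2)) has_real_derivative 0) (at s)"
      by (rule DERIV_cong_ev[THEN iffD1, OF refl _ refl, rotated])
         (use 1 in \<open>auto intro!: eventually_mono[OF eventually_nhds_in_open[of "{..<0}" s]] simp: max_def\<close>)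
    then show ?thesis using 1 by (simp add: max_def)
  next
    case 3
    have "((\<lambda>s::real. s ^ (k + 2)) has_real_derivative (real k + 2) * s ^ (k + 1)) (at s)"
      using DERIV_pow[of "k + 2" s] by (simp add: add.commute)
    then have "((\<lambda>s::real. (max 0 s) ^ (k + 2)) has_real_derivative (real k + 2) * s ^ (k + 1)) (at s)"
      by (rule DERIV_cong_ev[THEN iffD1, OF refl _ refl, rotated])
         (use 3 in \<open>auto intro!: eventually_mono[OF eventually_nhds_in_open[of "{0<..}" s]] simp: max_def\<close>)
    then show ?thesis using 3 by (simp add: max_def)
  next
    case 2
    have "((\<lambda>h. ((max 0 (0 + h)) ^ (k + 2) - (max 0 0) ^ (k + 2)) / h) \<longlongrightarrow> 0) (at (0::real))"
    proof (rule Lim_null_comparison)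
      show "\<forall>\<^sub>F h in at (0::real). norm (((max 0 (0 + h)) ^ (k + 2) - (max 0 0) ^ (k + 2)) / h) \<le> \<bar>h\<bar> ^ (k + 1)"
      proof (rule always_eventually, rule allI)
        fix h :: real
        have "\<bar>max 0 h\<bar> ^ (k + 2) \<le> \<bar>h\<bar> ^ (k + 2)" by (intro power_mono) auto
        then show "norm (((max 0 (0 + h)) ^ (k + 2) - (max 0 0) ^ (k + 2)) / h) \<le> \<bar>h\<bar> ^ (k + 1)"
          by (cases "h = 0") (auto simp: divide_le_eq power_abs mult_ac)
      qed
      show "((\<lambda>h::real. \<bar>h\<bar> ^ (k + 1)) \<longlongrightarrow> 0) (at 0)"
        by (rule tendsto_eq_intros | simp)+
    qed
    then show ?thesis using 2 by (simp add: DERIV_def)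
  qed
qed

text \<open>An unnormalised mollifying kernel around \<open>a\<close>. The third power is the lowest one that makes it \<open>C\<^sup>2\<close>, and
being polynomial inside its support it allows explicit bounds.\<close>
definition bump :: "real \<Rightarrow> 'a::euclidean_space \<Rightarrow> 'a \<Rightarrow> real" where
  "bump \<delta> a w = (max 0 (\<delta>\<^sup>2 - (norm (w - a))\<^sup>2)) ^ 3"

text \<open>The derivative of \<open>bump \<delta> a w\<close> with respect to the centre \<open>a\<close> in the direction \<open>v\<close>, which is minus its
derivative with respect to \<open>w\<close>.\<close>
definition bump_slope :: "real \<Rightarrow> 'a::euclidean_space \<Rightarrow> 'a \<Rightarrow> 'a \<Rightarrow> real" where
  "bump_slope \<delta> a v w = 6 * (max 0 (\<delta>\<^sup>2 - (norm (w - a))\<^sup>2))\<^sup>2 * inner (w - a) v"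

lemma pos_part_cube_derivative:
  "((\<lambda>s::real. (max 0 s) ^ 3) has_real_derivative 3 * (max 0 s)\<^sup>2) (at s)"
  using pos_part_power_derivative[of 1 s] by (simp add: eval_nat_numeral)

lemma pos_part_square_derivative:
  "((\<lambda>s::real. (max 0 s)\<^sup>2) has_real_derivative 2 * max 0 s) (at s)"
  using pos_part_power_derivative[of 0 s] by (simp add: eval_nat_numeral)

lemma bump_nonneg: "0 \<le> bump \<delta> a w" by (simp add: bump_def)

lemma bump_zero: "\<delta> \<le> norm (w - a) \<Longrightarrow> 0 \<le> \<delta> \<Longrightarrow> bump \<delta> a w = 0"
  and bump_slope_zero: "\<delta> \<le> norm (w - a) \<Longrightarrow> 0 \<le> \<delta> \<Longrightarrow> bump_slope \<delta> a v w = 0"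
  using power_mono[of \<delta> "norm (w - a)" 2] by (auto simp: bump_def bump_slope_def max_def)

lemma continuous_bump: "continuous_on UNIV (bump \<delta> a)"
  unfolding bump_def[abs_def] by (intro continuous_intros)

lemma continuous_bump_slope: "continuous_on UNIV (bump_slope \<delta> a v)"
  unfolding bump_slope_def[abs_def] by (intro continuous_intros)

lemma bump_has_derivative:
  "(bump \<delta> a has_derivative (\<lambda>v. - bump_slope \<delta> a v w)) (at w)"
proof -
  have n: "((\<lambda>w. \<delta>\<^sup>2 - inner (w - a) (w - a)) has_derivative (\<lambda>v. - (2 * inner (w - a) v))) (at w)"
    by (auto intro!: derivative_eq_intros simp: inner_commute)
  have c: "((\<lambda>s::real. (max 0 s) ^ 3) has_derivative (\<lambda>h. 3 * (max 0 s)\<^sup>2 * h)) (at s)" for s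
    using pos_part_cube_derivative[of s] by (simp add: has_field_derivative_def)
  have "((\<lambda>w. (max 0 (\<delta>\<^sup>2 - inner (w - a) (w - a))) ^ 3) has_derivative
      (\<lambda>v. 3 * (max 0 (\<delta>\<^sup>2 - inner (w - a) (w - a)))\<^sup>2 * (- (2 * inner (w - a) v)))) (at w)"
    by (rule has_derivative_compose[OF n c])
  then show ?thesis
    by (simp add: bump_def[abs_def] bump_slope_def power2_norm_eq_inner algebra_simps)
qed

lemma test_function_bump:
  assumes "cball a \<delta> \<subseteq> \<Omega>" "0 \<le> \<delta>"
  shows "\<exists>d. test_function \<Omega> (bump \<delta> a) d \<and> (\<forall>w v. blinfun_apply (d w) v = - bump_slope \<delta> a v w)"
proof -
  define d where "d w = (- 6 * (max 0 (\<delta>\<^sup>2 - (norm (w - a))\<^sup>2))\<^sup>2) *\<^sub>R blinfun_inner_right (w - a)" for w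
  have ap: "blinfun_apply (d w) v = - bump_slope \<delta> a v w" for w v
    by (simp add: d_def bump_slope_def blinfun.minus_left blinfun.scaleR_left)
  have "test_function \<Omega> (bump \<delta> a) d"
    unfolding test_function_def
  proof (intro conjI allI exI[of _ "cball a \<delta>"] impI)
    show "(bump \<delta> a has_derivative blinfun_apply (d z)) (at z)" for z
      using bump_has_derivative[of \<delta> a z] by (simp add: ap[abs_def] fun_eq_iff[symmetric] ext)
    show "continuous_on UNIV d"
      unfolding d_def[abs_def] by (intro continuous_intros bounded_linear.continuous_on[OF bounded_linear_blinfun_inner_right])
    show "bump \<delta> a z = 0" if "z \<notin> cball a \<delta>" for z
      using that assms by (intro bump_zero) (auto simp: dist_norm norm_minus_commute)
  qed (use assms in auto)
  then show ?thesis using ap by blast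
qed

text \<open>Along a line the kernel is the cube of the positive part of a quadratic polynomial \<open>P\<close>. Where \<open>P\<close> is
positive the point lies within \<open>\<delta>\<close> of the moving centre, which bounds \<open>P'\<close> and hence the second derivative.\<close>
lemma bump_taylor:
  assumes d: "0 \<le> \<delta>"
  shows "\<bar>bump \<delta> (a + u) w - bump \<delta> a w - bump_slope \<delta> a u w\<bar> \<le> 30 * \<delta>^4 * (norm u)\<^sup>2"
proof -
  define q where "q s = inner (w - a - s *\<^sub>R u) u" for s
  define P where "P s = \<delta>\<^sup>2 - (norm (w - a - s *\<^sub>R u))\<^sup>2" for s
  have dP: "(P has_real_derivative 2 * q s) (at s)" for s
  proof -
    have "((\<lambda>s. \<delta>\<^sup>2 - inner (w - a - s *\<^sub>R u) (w - a - s *\<^sub>R u)) has_derivative (\<lambda>h. h * (2 * q s))) (at s)"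
      by (auto intro!: derivative_eq_intros simp: q_def inner_commute algebra_simps)
    then show ?thesis
      by (simp add: P_def[abs_def] power2_norm_eq_inner has_field_derivative_def mult_commute_abs)
  qed
  have dq: "(q has_real_derivative - (norm u)\<^sup>2) (at s)" for s
  proof -
    have "((\<lambda>s. inner (w - a - s *\<^sub>R u) u) has_derivative (*) (- (norm u)\<^sup>2)) (at s)"
      by (auto intro!: derivative_eq_intros simp: power2_norm_eq_inner)
    then show ?thesis by (simp only: q_def[abs_def] has_field_derivative_def)
  qed
  define g where "g s = (max 0 (P s)) ^ 3" for s
  define g' where "g' s = 6 * (max 0 (P s))\<^sup>2 * q s" for s
  define g'' where "g'' s = 6 * (2 * max 0 (P s) * (2 * q s)) * q s + 6 * (max 0 (P s))\<^sup>2 * (- (norm u)\<^sup>2)" for s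
  have dg: "(g has_real_derivative g' s) (at s)" for s
    using DERIV_chain2[OF pos_part_cube_derivative dP, of s] by (simp add: g_def[abs_def] g'_def mult_ac)
  have dg': "(g' has_real_derivative g'' s) (at s)" for s
    unfolding g'_def[abs_def] g''_def
    by (rule derivative_eq_intros DERIV_chain2[OF pos_part_square_derivative dP] dq refl | simp)+
  have b: "\<bar>g'' s\<bar> \<le> 30 * \<delta>^4 * (norm u)\<^sup>2" for s
  proof (cases "P s \<le> 0")
    case True
    then show ?thesis using d by (simp add: g''_def max_def)
  next
    case False
    then have "(norm (w - a - s *\<^sub>R u))\<^sup>2 \<le> \<delta>\<^sup>2" by (simp add: P_def)
    then have n: "norm (w - a - s *\<^sub>R u) \<le> \<delta>" using d by (rule power2_le_imp_le)
    have "\<bar>q s\<bar> \<le> norm (w - a - s *\<^sub>R u) * norm u" unfolding q_def by (rule Cauchy_Schwarz_ineq2)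
    also have "\<dots> \<le> \<delta> * norm u" using n by (intro mult_right_mono) auto
    finally have q: "\<bar>q s\<bar> \<le> \<delta> * norm u" .
    have q2: "(q s)\<^sup>2 \<le> (\<delta> * norm u)\<^sup>2" using power_mono[OF q, of 2] by simp
    have m: "max 0 (P s) \<le> \<delta>\<^sup>2" by (simp add: P_def)
    have m2: "(max 0 (P s))\<^sup>2 \<le> (\<delta>\<^sup>2)\<^sup>2" using m by (intro power_mono) auto
    have "\<bar>g'' s\<bar> \<le> 24 * (max 0 (P s) * (q s)\<^sup>2) + 6 * ((max 0 (P s))\<^sup>2 * (norm u)\<^sup>2)"
    proof -
      have "g'' s = 24 * (max 0 (P s) * (q s)\<^sup>2) - 6 * ((max 0 (P s))\<^sup>2 * (norm u)\<^sup>2)"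
        by (simp add: g''_def power2_eq_square)
      moreover have "0 \<le> max 0 (P s) * (q s)\<^sup>2" "0 \<le> (max 0 (P s))\<^sup>2 * (norm u)\<^sup>2" by auto
      ultimately show ?thesis by linarith
    qed
    also have "\<dots> \<le> 24 * (\<delta>\<^sup>2 * (\<delta> * norm u)\<^sup>2) + 6 * ((\<delta>\<^sup>2)\<^sup>2 * (norm u)\<^sup>2)"
      using m m2 q2 by (intro add_mono mult_left_mono mult_mono) auto
    also have "\<dots> = 30 * \<delta>^4 * (norm u)\<^sup>2" by (simp add: power_mult_distrib)
    finally show ?thesis .
  qed
  have mv: "\<bar>f s - f 0\<bar> \<le> s * B" if "\<And>x. (f has_real_derivative f' x) (at x)"
    "\<And>x. 0 \<le> x \<Longrightarrow> x \<le> s \<Longrightarrow> \<bar>f' x\<bar> \<le> B" "0 \<le> s" for f f' :: "real \<Rightarrow> real" and s B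
  proof -
    have "norm (f s - f 0) \<le> B * norm (s - 0)"
      by (rule field_differentiable_bound[where S = "{0..s}" and f' = f'])
         (use that in \<open>auto intro: has_field_derivative_at_within\<close>)
    then show ?thesis using that by (simp add: mult.commute)
  qed
  have 1: "\<bar>g' s - g' 0\<bar> \<le> 30 * \<delta>^4 * (norm u)\<^sup>2" if "0 \<le> s" "s \<le> 1" for s
  proof -
    have "\<bar>g' s - g' 0\<bar> \<le> s * (30 * \<delta>^4 * (norm u)\<^sup>2)" by (rule mv[OF dg' b that(1)])
    also have "\<dots> \<le> 1 * (30 * \<delta>^4 * (norm u)\<^sup>2)" using that d by (intro mult_right_mono) auto
    finally show ?thesis by simp
  qed
  have "\<bar>(g 1 - 1 * g' 0) - (g 0 - 0 * g' 0)\<bar> \<le> 1 * (30 * \<delta>^4 * (norm u)\<^sup>2)"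
    by (rule mv[where f = "\<lambda>s. g s - s * g' 0" and f' = "\<lambda>s. g' s - g' 0"])
       (auto intro!: derivative_eq_intros dg 1)
  then show ?thesis by (simp add: g_def g'_def P_def q_def bump_def bump_slope_def algebra_simps)
qed

lemma integrable_compactly_supported:
  fixes k :: "'a::euclidean_space \<Rightarrow> real"
  assumes k: "continuous_on UNIV k" and supp: "\<And>w. r < norm (w - a) \<Longrightarrow> k w = 0" and \<Omega>: "\<Omega> \<in> sets lebesgue"
  shows "integrable (lebesgue_on \<Omega>) k"
proof -
  have "integrable lborel (\<lambda>x. indicator (cball a r) x *\<^sub>R k x)"
    by (rule borel_integrable_compact) (auto intro: continuous_on_subset[OF k])
  also have "(\<lambda>x. indicator (cball a r) x *\<^sub>R k x) = k"
    using supp by (auto simp: fun_eq_iff indicator_def dist_norm norm_minus_commute not_le)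
  finally have "integrable lborel k" .
  then have "integrable lebesgue k" using integrable_completion[of k lborel] by simp
  then have "integrable lebesgue (\<lambda>x. indicator \<Omega> x *\<^sub>R k x)" by (rule integrable_mult_indicator[OF \<Omega>])
  then show ?thesis using \<Omega> by (simp add: integrable_restrict_space)
qed

text \<open>The norm bound covers non-measurable functions too, whose integral is 0 by convention; this is convenient
for the differential in \<open>x_differential\<close>, which is measurable only in the sense of \<open>weak_derivative\<close>.\<close>
lemma integrable_scaled_bounded:
  fixes k :: "'a::euclidean_space \<Rightarrow> real" and f :: "'a \<Rightarrow> 'b::euclidean_space"
  assumes k: "integrable M k" and B: "AE z in M. norm (f z) \<le> B"
  shows "f \<in> borel_measurable M \<Longrightarrow> integrable M (\<lambda>w. k w *\<^sub>R f w)"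
    and "0 \<le> B \<Longrightarrow> norm (\<integral>w. k w *\<^sub>R f w \<partial>M) \<le> B * (\<integral>w. \<bar>k w\<bar> \<partial>M)"
proof -
  have b: "AE w in M. norm (k w *\<^sub>R f w) \<le> B * \<bar>k w\<bar>"
    using B by eventually_elim (simp add: mult.commute[of B] mult_left_mono)
  have i: "integrable M (\<lambda>w. B * \<bar>k w\<bar>)" using k by auto
  show "integrable M (\<lambda>w. k w *\<^sub>R f w)" if "f \<in> borel_measurable M"
    by (rule Bochner_Integration.integrable_bound[OF i]) (use b k that in \<open>auto elim: AE_mp\<close>)
  show "norm (\<integral>w. k w *\<^sub>R f w \<partial>M) \<le> B * (\<integral>w. \<bar>k w\<bar> \<partial>M)" if B0: "0 \<le> B"
  proof (cases "integrable M (\<lambda>w. k w *\<^sub>R f w)")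
    case True
    have "norm (\<integral>w. k w *\<^sub>R f w \<partial>M) \<le> (\<integral>w. norm (k w *\<^sub>R f w) \<partial>M)" by (rule integral_norm_bound)
    also have "\<dots> \<le> (\<integral>w. B * \<bar>k w\<bar> \<partial>M)" by (rule integral_mono_AE[OF integrable_norm[OF True] i b])
    finally show ?thesis by simp
  next
    case False
    then show ?thesis using B0 by (simp add: not_integrable_integral_eq Bochner_Integration.integral_nonneg)
  qed
qed

definition bump_mass :: "'a::euclidean_space itself \<Rightarrow> real \<Rightarrow> real" where
  "bump_mass _ \<delta> = (\<integral>w. bump \<delta> (0::'a) w \<partial>lborel)"

lemma bump_mass_pos:
  assumes d: "0 < \<delta>" shows "0 < bump_mass TYPE('a::euclidean_space) \<delta>"
proof -
  let ?c = "(3 / 4 * \<delta>\<^sup>2) ^ 3"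
  let ?B = "cball (0::'a) (\<delta> / 2)"
  have i: "integrable lborel (bump \<delta> (0::'a))"
  proof -
    have "integrable lborel (\<lambda>x. indicator (cball 0 \<delta>) x *\<^sub>R bump \<delta> (0::'a) x)"
      by (rule borel_integrable_compact) (auto intro: continuous_on_subset[OF continuous_bump])
    also have "(\<lambda>x. indicator (cball 0 \<delta>) x *\<^sub>R bump \<delta> (0::'a) x) = bump \<delta> 0"
      using d by (auto simp: fun_eq_iff indicator_def bump_zero not_le)
    finally show ?thesis .
  qed
  have "0 < ?c * measure lborel ?B" using d content_cball_pos[of "\<delta> / 2" "0::'a"] by simp
  also have "\<dots> = (\<integral>w. ?c * indicator ?B w \<partial>lborel)" by simp
  also have "\<dots> \<le> (\<integral>w. bump \<delta> (0::'a) w \<partial>lborel)"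
  proof (rule integral_mono)
    show "integrable lborel (\<lambda>w. ?c * indicator ?B w)" by (auto intro!: integrable_real_indicator emeasure_compact_finite)
    show "?c * indicator ?B w \<le> bump \<delta> 0 w" for w
    proof (cases "w \<in> ?B")
      case True
      then have "(norm w)\<^sup>2 \<le> (\<delta> / 2)\<^sup>2" by (intro power_mono) auto
      then have "3 / 4 * \<delta>\<^sup>2 \<le> \<delta>\<^sup>2 - (norm w)\<^sup>2" by (simp add: power_divide)
      then have "3 / 4 * \<delta>\<^sup>2 \<le> max 0 (\<delta>\<^sup>2 - (norm w)\<^sup>2)" by linarith
      then have "?c \<le> (max 0 (\<delta>\<^sup>2 - (norm w)\<^sup>2)) ^ 3" by (intro power_mono) auto
      then show ?thesis using True by (simp add: bump_def)
    qed (simp add: bump_nonneg)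
  qed (rule i)
  finally show ?thesis by (simp add: bump_mass_def)
qed

lemma bump_integral:
  fixes a :: "'a::euclidean_space"
  assumes d: "0 \<le> \<delta>" and \<Omega>: "\<Omega> \<in> sets lebesgue" and sub: "cball a \<delta> \<subseteq> \<Omega>"
  shows "(\<integral>w. bump \<delta> a w \<partial>lebesgue_on \<Omega>) = bump_mass TYPE('a) \<delta>"
proof -
  have m: "bump \<delta> a \<in> borel_measurable lborel" "bump \<delta> a \<in> borel_measurable borel" for a :: 'a
    using borel_measurable_continuous_onI[OF continuous_bump] by auto
  have z: "indicator \<Omega> w *\<^sub>R bump \<delta> a w = bump \<delta> a w" for w
  proof (cases "w \<in> \<Omega>")
    case False
    then have "\<not> dist a w \<le> \<delta>" using sub by auto
    then show ?thesis using False d by (simp add: bump_zero dist_norm norm_minus_commute)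
  qed simp
  have "(\<integral>w. bump \<delta> a w \<partial>lebesgue_on \<Omega>) = (\<integral>w. indicator \<Omega> w *\<^sub>R bump \<delta> a w \<partial>lebesgue)"
    using \<Omega> by (simp add: integral_restrict_space)
  also have "\<dots> = (\<integral>w. bump \<delta> a w \<partial>lborel)" unfolding z by (rule integral_completion[OF m(1)])
  also have "\<dots> = (\<integral>w. bump \<delta> a w \<partial>distr lborel borel ((+) a))" by (simp add: lborel_distr_plus)
  also have "\<dots> = (\<integral>w. bump \<delta> a (a + w) \<partial>lborel)" by (rule integral_distr) (auto simp: m)
  finally show ?thesis by (simp add: bump_mass_def bump_def)
qed

definition mollify :: "'a::euclidean_space set \<Rightarrow> real \<Rightarrow> ('a \<Rightarrow> 'b::euclidean_space) \<Rightarrow> 'a \<Rightarrow> 'b" where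
  "mollify \<Omega> \<delta> f a = (\<integral>w. bump \<delta> a w *\<^sub>R f w \<partial>lebesgue_on \<Omega>) /\<^sub>R bump_mass TYPE('a) \<delta>"

text \<open>The derivative of \<open>mollify \<Omega> \<delta> f\<close> at \<open>a\<close>, with the derivative falling on the kernel.\<close>
definition mollify_slope :: "'a::euclidean_space set \<Rightarrow> real \<Rightarrow> ('a \<Rightarrow> 'b::euclidean_space) \<Rightarrow> 'a \<Rightarrow> 'a \<Rightarrow> 'b" where
  "mollify_slope \<Omega> \<delta> f a v = (\<integral>w. bump_slope \<delta> a v w *\<^sub>R f w \<partial>lebesgue_on \<Omega>) /\<^sub>R bump_mass TYPE('a) \<delta>"

context
  fixes \<Omega> :: "'a::euclidean_space set" and \<delta> :: real
  assumes \<Omega>: "\<Omega> \<in> sets lebesgue" and d: "0 < \<delta>"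
begin

lemma integrable_bump: "integrable (lebesgue_on \<Omega>) (bump \<delta> a)"
  by (rule integrable_compactly_supported[OF continuous_bump _ \<Omega>, where r = \<delta> and a = a])
     (use d in \<open>auto intro: bump_zero\<close>)

lemma integrable_bump_slope: "integrable (lebesgue_on \<Omega>) (bump_slope \<delta> a v)"
  by (rule integrable_compactly_supported[OF continuous_bump_slope _ \<Omega>, where r = \<delta> and a = a])
     (use d in \<open>auto intro: bump_slope_zero\<close>)

lemma mollify_bound:
  fixes f :: "'a \<Rightarrow> 'b::euclidean_space"
  assumes B: "AE z in lebesgue_on \<Omega>. norm (f z) \<le> B" and B0: "0 \<le> B"
    and sub: "cball a \<delta> \<subseteq> \<Omega>"
  shows "norm (mollify \<Omega> \<delta> f a) \<le> B"
proof -
  have m: "0 < bump_mass TYPE('a) \<delta>" by (rule bump_mass_pos[OF d])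
  have "norm (\<integral>w. bump \<delta> a w *\<^sub>R f w \<partial>lebesgue_on \<Omega>) \<le> B * (\<integral>w. \<bar>bump \<delta> a w\<bar> \<partial>lebesgue_on \<Omega>)"
    by (rule integrable_scaled_bounded(2)[OF integrable_bump B B0])
  also have "\<dots> = B * bump_mass TYPE('a) \<delta>"
    using bump_integral[OF less_imp_le[OF d] \<Omega> sub] by (simp add: bump_nonneg)
  finally show ?thesis using m by (simp add: mollify_def field_simps)
qed

text \<open>The kernel is a test function once its support lies in \<open>\<Omega>\<close>, so the derivative can be moved from the
kernel to the function: mollification commutes with weak differentiation.\<close>
lemma mollify_slope_weak_derivative:
  fixes f g :: "'a \<Rightarrow> 'b::euclidean_space"
  assumes w: "weak_derivative \<Omega> v f g" and sub: "cball a \<delta> \<subseteq> \<Omega>"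
  shows "mollify_slope \<Omega> \<delta> f a v = mollify \<Omega> \<delta> g a"
proof -
  obtain D where D: "test_function \<Omega> (bump \<delta> a) D" "\<And>w v. blinfun_apply (D w) v = - bump_slope \<delta> a v w"
    using test_function_bump[OF sub less_imp_le[OF d]] by blast
  have "(\<integral>w. blinfun_apply (D w) v *\<^sub>R f w \<partial>lebesgue_on \<Omega>) = - (\<integral>w. bump \<delta> a w *\<^sub>R g w \<partial>lebesgue_on \<Omega>)"
    using w D(1) by (simp add: weak_derivative_def)
  then show ?thesis unfolding D(2) mollify_def mollify_slope_def by simp
qed

text \<open>Differentiation under the integral sign, from the uniform second-order bound \<open>bump_taylor\<close>.\<close>
lemma mollify_has_derivative:
  fixes f :: "'a \<Rightarrow> 'b::euclidean_space"
  assumes f: "f \<in> borel_measurable (lebesgue_on \<Omega>)" and B: "AE z in lebesgue_on \<Omega>. norm (f z) \<le> B"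
  shows "(mollify \<Omega> \<delta> f has_derivative mollify_slope \<Omega> \<delta> f a) (at a)"
proof -
  let ?M = "lebesgue_on \<Omega>" and ?N = "bump_mass TYPE('a) \<delta>"
  have m: "0 < ?N" by (rule bump_mass_pos[OF d])
  note ib = integrable_scaled_bounded(1)[OF integrable_bump B f]
  note isl = integrable_scaled_bounded(1)[OF integrable_bump_slope B f]
  have lin: "linear (mollify_slope \<Omega> \<delta> f a)"
  proof
    fix u v :: 'a and r :: real
    have "mollify_slope \<Omega> \<delta> f a (u + v) = (\<integral>w. bump_slope \<delta> a u w *\<^sub>R f w + bump_slope \<delta> a v w *\<^sub>R f w \<partial>?M) /\<^sub>R ?N"
      by (simp add: mollify_slope_def bump_slope_def inner_add_right distrib_left scaleR_add_left)
    then show "mollify_slope \<Omega> \<delta> f a (u + v) = mollify_slope \<Omega> \<delta> f a u + mollify_slope \<Omega> \<delta> f a v"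
      using isl by (simp add: mollify_slope_def scaleR_add_right)
    have "bump_slope \<delta> a (r *\<^sub>R v) w *\<^sub>R f w = r *\<^sub>R (bump_slope \<delta> a v w *\<^sub>R f w)" for w
      by (simp add: bump_slope_def)
    then show "mollify_slope \<Omega> \<delta> f a (r *\<^sub>R v) = r *\<^sub>R mollify_slope \<Omega> \<delta> f a v"
      by (simp add: mollify_slope_def del: scaleR_scaleR) (simp add: mult.commute)
  qed
  obtain C where C: "0 \<le> C" "\<And>u. norm u \<le> 1 \<Longrightarrow>
     norm (mollify \<Omega> \<delta> f (a + u) - mollify \<Omega> \<delta> f a - mollify_slope \<Omega> \<delta> f a u) \<le> C * (norm u)\<^sup>2"
  proof
    let ?I = "\<integral>w. (indicator (cball a (\<delta> + 1)) w :: real) \<partial>?M"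
    define C where "C = \<bar>B\<bar> * (30 * \<delta>^4 * ?I) / ?N"
    have I0: "0 \<le> ?I" by (rule Bochner_Integration.integral_nonneg) simp
    show "0 \<le> C" using m I0 by (simp add: C_def)
    fix u :: 'a assume u: "norm u \<le> 1"
    define k where "k w = bump \<delta> (a + u) w - bump \<delta> a w - bump_slope \<delta> a u w" for w
    have ki: "integrable ?M k" unfolding k_def by (intro Bochner_Integration.integrable_diff integrable_bump integrable_bump_slope)
    have B': "AE z in ?M. norm (f z) \<le> \<bar>B\<bar>" using B by eventually_elim auto
    have ii: "integrable ?M (\<lambda>w. indicator (cball a (\<delta> + 1)) w :: real)"
    proof -
      have "integrable lebesgue (\<lambda>w. indicator (cball a (\<delta> + 1)) w :: real)"
        using emeasure_bounded_finite[OF bounded_cball, of a "\<delta> + 1"]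
        by (intro integrable_real_indicator) auto
      then have "integrable lebesgue (\<lambda>x. indicator \<Omega> x *\<^sub>R (indicator (cball a (\<delta> + 1)) x :: real))"
        by (rule integrable_mult_indicator[OF \<Omega>])
      then show ?thesis using \<Omega> by (simp add: integrable_restrict_space)
    qed
    have kb: "\<bar>k w\<bar> \<le> 30 * \<delta>^4 * (norm u)\<^sup>2 * indicator (cball a (\<delta> + 1)) w" for w
    proof (cases "w \<in> cball a (\<delta> + 1)")
      case True
      then show ?thesis using bump_taylor[of \<delta> a u w] d by (simp add: k_def)
    next
      case False
      then have "\<delta> + 1 < norm (w - a)" by (simp add: dist_norm norm_minus_commute)
      moreover have "norm (w - a) \<le> norm (w - (a + u)) + norm u" by norm
      ultimately have "\<delta> \<le> norm (w - (a + u))" "\<delta> \<le> norm (w - a)" using u by linarith+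
      then show ?thesis using d False by (simp add: k_def bump_zero bump_slope_zero)
    qed
    have "mollify \<Omega> \<delta> f (a + u) - mollify \<Omega> \<delta> f a - mollify_slope \<Omega> \<delta> f a u = (\<integral>w. k w *\<^sub>R f w \<partial>?M) /\<^sub>R ?N"
    proof -
      have "(\<integral>w. k w *\<^sub>R f w \<partial>?M) = (\<integral>w. bump \<delta> (a + u) w *\<^sub>R f w - bump \<delta> a w *\<^sub>R f w - bump_slope \<delta> a u w *\<^sub>R f w \<partial>?M)"
        by (simp add: k_def scaleR_diff_left)
      also have "\<dots> = (\<integral>w. bump \<delta> (a + u) w *\<^sub>R f w \<partial>?M) - (\<integral>w. bump \<delta> a w *\<^sub>R f w \<partial>?M) - (\<integral>w. bump_slope \<delta> a u w *\<^sub>R f w \<partial>?M)"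
        using ib isl by simp
      finally show ?thesis by (simp add: mollify_def mollify_slope_def scaleR_diff_right)
    qed
    also have "norm \<dots> = norm (\<integral>w. k w *\<^sub>R f w \<partial>?M) / ?N" using m by (simp add: divide_inverse)
    also have "\<dots> \<le> (\<bar>B\<bar> * (\<integral>w. \<bar>k w\<bar> \<partial>?M)) / ?N"
      using m by (intro divide_right_mono integrable_scaled_bounded(2)[OF ki B']) auto
    also have "\<dots> \<le> (\<bar>B\<bar> * (\<integral>w. 30 * \<delta>^4 * (norm u)\<^sup>2 * indicator (cball a (\<delta> + 1)) w \<partial>?M)) / ?N"
      using m ki ii kb by (intro divide_right_mono mult_left_mono integral_mono) auto
    also have "\<dots> = C * (norm u)\<^sup>2" by (simp add: C_def)
    finally show "norm (mollify \<Omega> \<delta> f (a + u) - mollify \<Omega> \<delta> f a - mollify_slope \<Omega> \<delta> f a u) \<le> C * (norm u)\<^sup>2" .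
  qed
  show ?thesis
    unfolding has_derivative_at
  proof
    show "bounded_linear (mollify_slope \<Omega> \<delta> f a)" using lin by (simp add: linear_conv_bounded_linear)
    show "(\<lambda>h. norm (mollify \<Omega> \<delta> f (a + h) - mollify \<Omega> \<delta> f a - mollify_slope \<Omega> \<delta> f a h) / norm h) \<midarrow>0\<rightarrow> 0"
    proof (rule Lim_null_comparison)
      have "\<forall>\<^sub>F h in at (0::'a). h \<in> ball 0 1" by (intro eventually_at_in_open') auto
      then show "\<forall>\<^sub>F h in at (0::'a). norm (norm (mollify \<Omega> \<delta> f (a + h) - mollify \<Omega> \<delta> f a - mollify_slope \<Omega> \<delta> f a h) / norm h) \<le> C * norm h"
      proof eventually_elim
        case (elim h)
        then show ?case using C(2)[of h] by (cases "h = 0") (auto simp: divide_le_eq power2_eq_square mult_ac)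
      qed
      show "((\<lambda>h::'a. C * norm h) \<longlongrightarrow> 0) (at 0)" by (rule tendsto_eq_intros | simp)+
    qed
  qed
qed

lemma mollify_near:
  fixes f :: "'a \<Rightarrow> 'b::euclidean_space"
  assumes f: "f \<in> borel_measurable (lebesgue_on \<Omega>)" and B: "AE z in lebesgue_on \<Omega>. norm (f z) \<le> B"
    and sub: "cball a \<delta> \<subseteq> \<Omega>" and near: "\<And>w. w \<in> cball a \<delta> \<Longrightarrow> norm (f w - c) \<le> e" and e: "0 \<le> e"
  shows "norm (mollify \<Omega> \<delta> f a - c) \<le> e"
proof -
  let ?M = "lebesgue_on \<Omega>" and ?N = "bump_mass TYPE('a) \<delta>"
  have m: "0 < ?N" by (rule bump_mass_pos[OF d])
  note ib = integrable_scaled_bounded(1)[OF integrable_bump B f]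
  note N = bump_integral[OF less_imp_le[OF d] \<Omega> sub]
  have ic: "integrable ?M (\<lambda>w. bump \<delta> a w *\<^sub>R c)" using integrable_bump[of a] by simp
  have "(\<integral>w. bump \<delta> a w *\<^sub>R (f w - c) \<partial>?M) = (\<integral>w. bump \<delta> a w *\<^sub>R f w \<partial>?M) - ?N *\<^sub>R c"
    using ib ic integrable_bump[of a] N by (simp add: scaleR_diff_right)
  then have "mollify \<Omega> \<delta> f a - c = (\<integral>w. bump \<delta> a w *\<^sub>R (f w - c) \<partial>?M) /\<^sub>R ?N"
    using m by (simp add: mollify_def scaleR_diff_right)
  also have "norm \<dots> = norm (\<integral>w. bump \<delta> a w *\<^sub>R (f w - c) \<partial>?M) / ?N" using m by (simp add: divide_inverse)
  also have "\<dots> \<le> (\<integral>w. norm (bump \<delta> a w *\<^sub>R (f w - c)) \<partial>?M) / ?N"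
    using m by (intro divide_right_mono integral_norm_bound) auto
  also have "\<dots> \<le> (\<integral>w. bump \<delta> a w * e \<partial>?M) / ?N"
  proof (intro divide_right_mono integral_mono)
    have "integrable ?M (\<lambda>w. bump \<delta> a w *\<^sub>R f w - bump \<delta> a w *\<^sub>R c)" using ib ic by (rule Bochner_Integration.integrable_diff)
    then show "integrable ?M (\<lambda>w. norm (bump \<delta> a w *\<^sub>R (f w - c)))" by (simp add: scaleR_diff_right)
    show "norm (bump \<delta> a w *\<^sub>R (f w - c)) \<le> bump \<delta> a w * e" for w
      using near[of w] bump_zero[of \<delta> w a] d
      by (cases "w \<in> cball a \<delta>") (auto simp: bump_nonneg dist_norm norm_minus_commute intro!: mult_left_mono)
  qed (use m integrable_bump in auto)
  also have "\<dots> = e" using N m by simp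
  finally show ?thesis .
qed

end

lemma norm_linear_le_Basis_sum:
  fixes f :: "'a::euclidean_space \<Rightarrow> 'b::real_normed_vector"
  assumes f: "linear f" and c: "\<And>b. b \<in> Basis \<Longrightarrow> norm (f b) \<le> c"
  shows "norm (f v) \<le> real DIM('a) * c * norm v"
proof -
  have "f v = f (\<Sum>b\<in>Basis. (v \<bullet> b) *\<^sub>R b)" by (simp add: euclidean_representation)
  also have "\<dots> = (\<Sum>b\<in>Basis. (v \<bullet> b) *\<^sub>R f b)" by (simp add: linear_sum[OF f] linear_cmul[OF f])
  also have "norm \<dots> \<le> (\<Sum>b\<in>(Basis :: 'a set). norm v * c)"
  proof (rule sum_norm_le)
    fix b :: 'a assume b: "b \<in> Basis"
    show "norm ((v \<bullet> b) *\<^sub>R f b) \<le> norm v * c"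
      using Basis_le_norm[OF b, of v] c[OF b] by (simp add: mult_mono)
  qed
  finally show ?thesis by (simp add: mult_ac)
qed

context
  fixes \<Omega> :: "'a::euclidean_space set" and \<delta> :: real
  assumes \<Omega>: "\<Omega> \<in> sets lebesgue" and d: "0 < \<delta>"
begin

lemma mollify_slope_bound:
  fixes f :: "'a \<Rightarrow> 'b::euclidean_space"
  assumes f: "f \<in> borel_measurable (lebesgue_on \<Omega>)" and B: "AE z in lebesgue_on \<Omega>. norm (f z) \<le> B"
    and g: "\<And>b. b \<in> Basis \<Longrightarrow> weak_derivative \<Omega> b f (g b) \<and> (AE z in lebesgue_on \<Omega>. norm (g b z) \<le> c)"
    and c: "0 \<le> c" and sub: "cball a \<delta> \<subseteq> \<Omega>"
  shows "norm (mollify_slope \<Omega> \<delta> f a v) \<le> real DIM('a) * c * norm v"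
proof (rule norm_linear_le_Basis_sum)
  show "linear (mollify_slope \<Omega> \<delta> f a)"
    using mollify_has_derivative[OF \<Omega> d f B, of a] by (rule has_derivative_linear)
  show "norm (mollify_slope \<Omega> \<delta> f a b) \<le> c" if b: "b \<in> Basis" for b
    using mollify_slope_weak_derivative[OF \<Omega> d conjunct1[OF g[OF b]] sub]
      mollify_bound[OF \<Omega> d conjunct2[OF g[OF b]] c sub] by simp
qed

lemma mollify_lipschitz:
  fixes f :: "'a \<Rightarrow> 'b::euclidean_space"
  assumes f: "f \<in> borel_measurable (lebesgue_on \<Omega>)" and B: "AE z in lebesgue_on \<Omega>. norm (f z) \<le> B"
    and g: "\<And>b. b \<in> Basis \<Longrightarrow> weak_derivative \<Omega> b f (g b) \<and> (AE z in lebesgue_on \<Omega>. norm (g b z) \<le> c)"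
    and c: "0 \<le> c" and S: "convex S" "\<And>a. a \<in> S \<Longrightarrow> cball a \<delta> \<subseteq> \<Omega>" and x: "x \<in> S" "y \<in> S"
  shows "norm (mollify \<Omega> \<delta> f x - mollify \<Omega> \<delta> f y) \<le> real DIM('a) * c * norm (x - y)"
proof (rule differentiable_bound[OF S(1) _ _ x])
  fix a assume a: "a \<in> S"
  show "(mollify \<Omega> \<delta> f has_derivative mollify_slope \<Omega> \<delta> f a) (at a within S)"
    by (rule has_derivative_at_withinI[OF mollify_has_derivative[OF \<Omega> d f B]])
  show "onorm (mollify_slope \<Omega> \<delta> f a) \<le> real DIM('a) * c"
    by (rule onorm_le) (rule mollify_slope_bound[OF f B g c S(2)[OF a]])
qed

text \<open>The slope of a mollification has the mollified weak derivatives as components. These are Lipschitz by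
the bounds on the second weak derivatives, uniformly in \<open>\<delta>\<close>.\<close>
lemma mollify_taylor:
  fixes f :: "'a \<Rightarrow> 'b::euclidean_space"
  assumes f: "f \<in> borel_measurable (lebesgue_on \<Omega>)" and B: "AE z in lebesgue_on \<Omega>. norm (f z) \<le> B"
    and g: "\<And>b. b \<in> Basis \<Longrightarrow> weak_derivative \<Omega> b f (g b) \<and> g b \<in> borel_measurable (lebesgue_on \<Omega>)
        \<and> (AE z in lebesgue_on \<Omega>. norm (g b z) \<le> c)"
    and g': "\<And>b b'. b \<in> Basis \<Longrightarrow> b' \<in> Basis \<Longrightarrow>
        weak_derivative \<Omega> b' (g b) (g' b b') \<and> (AE z in lebesgue_on \<Omega>. norm (g' b b' z) \<le> c)"
    and c: "0 \<le> c" and S: "convex S" "\<And>a. a \<in> S \<Longrightarrow> cball a \<delta> \<subseteq> \<Omega>" and x: "x \<in> S" "y \<in> S"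
  shows "norm (mollify \<Omega> \<delta> f y - mollify \<Omega> \<delta> f x - mollify_slope \<Omega> \<delta> f x (y - x))
     \<le> (real DIM('a))\<^sup>2 * c * (norm (y - x))\<^sup>2"
proof -
  let ?S = "closed_segment x y"
  have SS: "?S \<subseteq> S" using S(1) x by (simp add: closed_segment_subset)
  have lin: "linear (mollify_slope \<Omega> \<delta> f a)" for a
    using mollify_has_derivative[OF \<Omega> d f B, of a] by (rule has_derivative_linear)
  have "norm (mollify \<Omega> \<delta> f y - mollify \<Omega> \<delta> f x - mollify_slope \<Omega> \<delta> f x (y - x))
     \<le> norm (y - x) * (real DIM('a) * (real DIM('a) * c * norm (y - x)))"
  proof (rule differentiable_bound_linearization[where S = ?S])
    show "x + t *\<^sub>R (y - x) \<in> ?S" if "t \<in> {0..1}" for t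
      using that by (auto simp: closed_segment_def algebra_simps intro!: exI[of _ t])
    show "(mollify \<Omega> \<delta> f has_derivative mollify_slope \<Omega> \<delta> f a) (at a within ?S)" for a
      by (rule has_derivative_at_withinI[OF mollify_has_derivative[OF \<Omega> d f B]])
    show "onorm (mollify_slope \<Omega> \<delta> f a - mollify_slope \<Omega> \<delta> f x) \<le> real DIM('a) * (real DIM('a) * c * norm (y - x))"
      if a: "a \<in> ?S" for a
    proof (rule onorm_le, rule norm_linear_le_Basis_sum)
      show "linear (mollify_slope \<Omega> \<delta> f a - mollify_slope \<Omega> \<delta> f x)"
        unfolding fun_diff_def by (intro linear_compose_sub lin)
      fix b :: 'a assume b: "b \<in> Basis"
      have aS: "a \<in> S" using a SS by auto
      have "mollify_slope \<Omega> \<delta> f z b = mollify \<Omega> \<delta> (g b) z" if "z \<in> S" for z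
        using mollify_slope_weak_derivative[OF \<Omega> d conjunct1[OF g[OF b]] S(2)[OF that]] .
      then have "norm ((mollify_slope \<Omega> \<delta> f a - mollify_slope \<Omega> \<delta> f x) b) = norm (mollify \<Omega> \<delta> (g b) a - mollify \<Omega> \<delta> (g b) x)"
        using aS x by simp
      also have "\<dots> \<le> real DIM('a) * c * norm (a - x)"
        by (rule mollify_lipschitz[where S = S and g = "g' b"]) (use g[OF b] g'[OF b] c S aS x in auto)
      also have "\<dots> \<le> real DIM('a) * c * norm (y - x)"
        using segment_bound1[OF a] c by (intro mult_left_mono) auto
      finally show "norm ((mollify_slope \<Omega> \<delta> f a - mollify_slope \<Omega> \<delta> f x) b) \<le> real DIM('a) * c * norm (y - x)" .
    qed
  qed simp
  then show ?thesis by (simp add: power2_eq_square mult_ac)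
qed

end

lemma test_function_integrable:
  fixes \<Omega> :: "'a::euclidean_space set"
  assumes \<phi>: "test_function \<Omega> \<phi> d\<phi>" and \<Omega>: "\<Omega> \<in> sets lebesgue"
  shows "integrable (lebesgue_on \<Omega>) \<phi>" "integrable (lebesgue_on \<Omega>) (\<lambda>z. blinfun_apply (d\<phi> z) v)"
proof -
  obtain X where K: "compact X" "\<And>z. z \<notin> X \<Longrightarrow> \<phi> z = 0" using \<phi> by (auto simp: test_function_def)
  have der: "(\<phi> has_derivative blinfun_apply (d\<phi> z)) (at z)" for z using \<phi> by (simp add: test_function_def)
  have dc: "continuous_on UNIV d\<phi>" using \<phi> by (simp add: test_function_def)
  obtain r where r: "\<And>z. z \<in> X \<Longrightarrow> norm z \<le> r" using compact_imp_bounded[OF K(1)] bounded_iff by metis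
  have cont: "continuous_on UNIV \<phi>"
    by (intro continuous_at_imp_continuous_on ballI has_derivative_continuous[OF der])
  have d0: "blinfun_apply (d\<phi> z) v = 0" if z: "z \<notin> X" for z
  proof -
    have "((\<lambda>_. 0) has_derivative blinfun_apply (d\<phi> z)) (at z)"
      by (rule has_derivative_transform_within_open[OF der, of "- X"])
         (use K z compact_imp_closed[OF K(1)] in auto)
    then have "blinfun_apply (d\<phi> z) = (\<lambda>_. 0)"
      using has_derivative_unique has_derivative_const by blast
    then show ?thesis by simp
  qed
  show "integrable (lebesgue_on \<Omega>) \<phi>"
    by (rule integrable_compactly_supported[OF cont _ \<Omega>, where r = r and a = 0]) (use K r in force)
  show "integrable (lebesgue_on \<Omega>) (\<lambda>z. blinfun_apply (d\<phi> z) v)"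
    by (rule integrable_compactly_supported[OF _ _ \<Omega>, where r = r and a = 0])
       (use d0 r in \<open>force intro!: continuous_intros dc\<close>)+
qed

text \<open>Used to pass from the coordinate directions of \<open>W_infinity\<close> to the arbitrary directions of
\<open>x_differential\<close>.\<close>
lemma weak_derivative_linear_combination:
  fixes f g1 g2 :: "'a::euclidean_space \<Rightarrow> 'b::euclidean_space"
  assumes \<Omega>: "\<Omega> \<in> sets lebesgue"
    and f: "f \<in> borel_measurable (lebesgue_on \<Omega>)" "AE z in lebesgue_on \<Omega>. norm (f z) \<le> B"
    and g1: "weak_derivative \<Omega> u1 f g1" "g1 \<in> borel_measurable (lebesgue_on \<Omega>)" "AE z in lebesgue_on \<Omega>. norm (g1 z) \<le> c"
    and g2: "weak_derivative \<Omega> u2 f g2" "g2 \<in> borel_measurable (lebesgue_on \<Omega>)" "AE z in lebesgue_on \<Omega>. norm (g2 z) \<le> c"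
  shows "weak_derivative \<Omega> (r *\<^sub>R u1 + s *\<^sub>R u2) f (\<lambda>z. r *\<^sub>R g1 z + s *\<^sub>R g2 z)"
  unfolding weak_derivative_def
proof (intro conjI allI impI)
  show "locally_integrable \<Omega> f" using g1 by (simp add: weak_derivative_def)
  show "locally_integrable \<Omega> (\<lambda>z. r *\<^sub>R g1 z + s *\<^sub>R g2 z)"
    using g1(1) g2(1) by (auto simp: weak_derivative_def locally_integrable_def)
  fix \<phi> d\<phi> assume \<phi>: "test_function \<Omega> \<phi> d\<phi>"
  let ?M = "lebesgue_on \<Omega>"
  note i = test_function_integrable[OF \<phi> \<Omega>]
  note if' = integrable_scaled_bounded(1)[OF i(2) f(2,1)]
  note ig1 = integrable_scaled_bounded(1)[OF i(1) g1(3,2)]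
  note ig2 = integrable_scaled_bounded(1)[OF i(1) g2(3,2)]
  have "(\<integral>z. blinfun_apply (d\<phi> z) (r *\<^sub>R u1 + s *\<^sub>R u2) *\<^sub>R f z \<partial>?M)
     = (\<integral>z. r *\<^sub>R (blinfun_apply (d\<phi> z) u1 *\<^sub>R f z) + s *\<^sub>R (blinfun_apply (d\<phi> z) u2 *\<^sub>R f z) \<partial>?M)"
    by (simp add: blinfun.add_right blinfun.scaleR_right scaleR_add_left)
  also have "\<dots> = r *\<^sub>R (\<integral>z. blinfun_apply (d\<phi> z) u1 *\<^sub>R f z \<partial>?M) + s *\<^sub>R (\<integral>z. blinfun_apply (d\<phi> z) u2 *\<^sub>R f z \<partial>?M)"
    using if' by (simp del: scaleR_scaleR)
  also have "\<dots> = r *\<^sub>R (- (\<integral>z. \<phi> z *\<^sub>R g1 z \<partial>?M)) + s *\<^sub>R (- (\<integral>z. \<phi> z *\<^sub>R g2 z \<partial>?M))"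
    using g1(1) g2(1) \<phi> by (simp add: weak_derivative_def)
  also have "\<dots> = - (\<integral>z. r *\<^sub>R (\<phi> z *\<^sub>R g1 z) + s *\<^sub>R (\<phi> z *\<^sub>R g2 z) \<partial>?M)"
    using ig1 ig2 by (simp del: scaleR_scaleR)
  also have "\<dots> = - (\<integral>z. \<phi> z *\<^sub>R (r *\<^sub>R g1 z + s *\<^sub>R g2 z) \<partial>?M)"
    by (simp add: scaleR_add_right mult.commute)
  finally show "(\<integral>z. blinfun_apply (d\<phi> z) (r *\<^sub>R u1 + s *\<^sub>R u2) *\<^sub>R f z \<partial>?M) = - (\<integral>z. \<phi> z *\<^sub>R (r *\<^sub>R g1 z + s *\<^sub>R g2 z) \<partial>?M)" .
qed

section \<open>Pointwise bounds for fields in the Sobolev space\<close>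

lemma cball_in_spacetime:
  fixes a :: "real \<times> plane"
  assumes "\<delta> < fst a" shows "cball a \<delta> \<subseteq> spacetime"
proof
  fix w assume "w \<in> cball a \<delta>"
  then have "\<bar>fst a - fst w\<bar> \<le> \<delta>"
    using dist_fst_le[of a w] by (simp add: dist_real_def)
  then show "w \<in> spacetime" using assms by (auto simp: mem_Times_iff)
qed

lemma spacetime_lebesgue: "spacetime \<in> sets lebesgue"
proof -
  have "open spacetime" by (intro open_Times open_greaterThan open_UNIV)
  then have "spacetime \<in> sets lborel" by simp
  then show ?thesis by (rule sets_completionI_sets)
qed

text \<open>So that the choice in the definition of \<open>K_x\<close> does pick a differential of the field.\<close>
lemma x_differential_exists:
  assumes E: "W_infinity 1 spacetime (\<lambda>(t, x). E t x)"
  shows "\<exists>D. x_differential E D"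
proof -
  let ?f = "\<lambda>(t, x). E t x" and ?\<Omega> = "spacetime :: (real \<times> plane) set"
  let ?M = "lebesgue_on ?\<Omega>"
  have E': "?f \<in> borel_measurable ?M" "ess_bounded ?\<Omega> ?f"
    "\<forall>b\<in>Basis. \<exists>g. weak_derivative ?\<Omega> b ?f g \<and> g \<in> borel_measurable ?M \<and> ess_bounded ?\<Omega> g"
    using E by auto
  let ?b1 = "(0, axis 1 1) :: real \<times> plane" and ?b2 = "(0, axis 2 1) :: real \<times> plane"
  have b: "?b1 \<in> Basis" "?b2 \<in> Basis" by (auto simp: Basis_prod_def axis_in_Basis_iff)
  obtain B where B: "AE z in ?M. norm (?f z) \<le> B" using E'(2) by (auto simp: ess_bounded_def)
  obtain g1 where g1: "weak_derivative ?\<Omega> ?b1 ?f g1" "g1 \<in> borel_measurable ?M" "ess_bounded ?\<Omega> g1"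
    using E'(3) b(1) by blast
  obtain g2 where g2: "weak_derivative ?\<Omega> ?b2 ?f g2" "g2 \<in> borel_measurable ?M" "ess_bounded ?\<Omega> g2"
    using E'(3) b(2) by blast
  obtain c1 c2 where c: "AE z in ?M. norm (g1 z) \<le> c1" "AE z in ?M. norm (g2 z) \<le> c2"
    using g1(3) g2(3) by (auto simp: ess_bounded_def)
  have c': "AE z in ?M. norm (g1 z) \<le> max c1 c2" "AE z in ?M. norm (g2 z) \<le> max c1 c2"
    by (use c(1) in eventually_elim, simp) (use c(2) in eventually_elim, simp)
  define D where "D z = Blinfun (\<lambda>h::plane. (h $ 1) *\<^sub>R g1 z + (h $ 2) *\<^sub>R g2 z)" for z
  have bl: "bounded_linear (\<lambda>h::plane. (h $ 1) *\<^sub>R g1 z + (h $ 2) *\<^sub>R g2 z)" for z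
    by (intro bounded_linear_add bounded_linear_compose[OF bounded_linear_scaleR_left] bounded_linear_vec_nth)
  have D: "blinfun_apply (D z) h = (h $ 1) *\<^sub>R g1 z + (h $ 2) *\<^sub>R g2 z" for z h
    unfolding D_def using bounded_linear_Blinfun_apply[OF bl] by simp
  have "x_differential E D"
    unfolding x_differential_def
  proof (intro conjI allI)
    show "ess_bounded ?\<Omega> D"
      unfolding ess_bounded_def
    proof (intro exI)
      show "AE z in ?M. norm (D z) \<le> c1 + c2"
        using c
      proof eventually_elim
        case (elim z)
        show ?case
        proof (rule norm_blinfun_bound)
          show "0 \<le> c1 + c2" using elim norm_ge_zero[of "g1 z"] norm_ge_zero[of "g2 z"] by linarith
          fix h :: plane
          have "norm (blinfun_apply (D z) h) \<le> \<bar>h $ 1\<bar> * norm (g1 z) + \<bar>h $ 2\<bar> * norm (g2 z)"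
            unfolding D by (rule order_trans[OF norm_triangle_ineq]) simp
          also have "\<dots> \<le> norm h * c1 + norm h * c2"
            using elim by (intro add_mono mult_mono component_le_norm_cart) auto
          finally show "norm (blinfun_apply (D z) h) \<le> (c1 + c2) * norm h" by (simp add: algebra_simps)
        qed
      qed
    qed
    fix h :: plane
    have eq: "(0, h) = (h $ 1) *\<^sub>R ?b1 + (h $ 2) *\<^sub>R ?b2"
      by (simp add: vec_eq_iff forall_2 axis_def)
    show "weak_derivative ?\<Omega> (0, h) ?f (\<lambda>z. blinfun_apply (D z) h)"
      unfolding D
      by (subst eq) (rule weak_derivative_linear_combination[OF spacetime_lebesgue E'(1) B g1(1,2) c'(1) g2(1,2) c'(2)])
  qed
  then show ?thesis by blast
qed

text \<open>The bounds hold for the mollified field with constants independent of \<open>\<delta>\<close> and survive the limit. Mollifying around the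
point \<open>z + (2 \<delta>, 0)\<close> keeps the kernel at positive times even if \<open>z\<close> lies on the boundary. The slopes at \<open>z\<close> only
need to converge along a subsequence depending on \<open>z\<close>, which compactness provides: the Taylor bound with
all other points passes to the limit as it stands.\<close>
lemma field_regularity:
  assumes E: "field_W_infinity 2 E"
  obtains C A where "0 \<le> K_x E" "0 \<le> C"
    and "\<And>t x. 0 \<le> t \<Longrightarrow> norm (E t x) \<le> C"
    and "\<And>t x x'. 0 \<le> t \<Longrightarrow> norm (E t x - E t x') \<le> K_x E * norm (x - x')"
    and "\<And>t x s x'. 0 \<le> t \<Longrightarrow> 0 \<le> s \<Longrightarrow> norm (E s x' - E t x) \<le> C * norm ((s, x') - (t, x))"
    and "\<And>t x v. 0 \<le> t \<Longrightarrow> norm (blinfun_apply (A (t, x)) v) \<le> C * norm v"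
    and "\<And>t x u. 0 \<le> t \<Longrightarrow> norm (blinfun_apply (A (t, x)) (0, u)) \<le> K_x E * norm u"
    and "\<And>t x s x'. 0 \<le> t \<Longrightarrow> 0 \<le> s \<Longrightarrow>
       norm (E s x' - E t x - blinfun_apply (A (t, x)) (s - t, x' - x)) \<le> C * (norm ((s, x') - (t, x)))\<^sup>2"
proof -
  let ?\<Omega> = "spacetime :: (real \<times> plane) set"
  let ?M = "lebesgue_on ?\<Omega>"
  define f where "f = (\<lambda>(t, x). E t x)"
  have ft: "f (t, x) = E t x" for t x by (simp add: f_def)
  have cont: "continuous_on ({0..} \<times> UNIV) f" using E by (simp add: field_W_infinity_def f_def)
  have W: "f \<in> borel_measurable ?M" "ess_bounded ?\<Omega> f"
    "\<forall>b\<in>Basis. \<exists>g. weak_derivative ?\<Omega> b f g \<and> W_infinity 1 ?\<Omega> g"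
    using E by (auto simp: field_W_infinity_def numeral_2_eq_2 f_def)
  have E1: "W_infinity 1 spacetime (\<lambda>(t, x). E t x)"
    using W unfolding f_def by (auto simp del: split_paired_All)
  obtain g where g: "\<And>b. b \<in> Basis \<Longrightarrow> weak_derivative ?\<Omega> b f (g b) \<and> W_infinity 1 ?\<Omega> (g b)"
    using bchoice[OF W(3)] by blast
  have g2: "\<forall>b\<in>Basis. \<forall>b'\<in>Basis. \<exists>g'. weak_derivative ?\<Omega> b' (g b) g' \<and> g' \<in> borel_measurable ?M \<and> ess_bounded ?\<Omega> g'"
    using g by auto
  then obtain g' where g': "\<And>b b'. b \<in> Basis \<Longrightarrow> b' \<in> Basis \<Longrightarrow>
      weak_derivative ?\<Omega> b' (g b) (g' b b') \<and> ess_bounded ?\<Omega> (g' b b')"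
    by metis
  obtain B where B: "AE z in ?M. norm (f z) \<le> B" using W(2) by (auto simp: ess_bounded_def)
  have "\<forall>b\<in>Basis. \<exists>c. AE z in ?M. norm (g b z) \<le> c" using g by (auto simp: ess_bounded_def)
  then obtain c1 where c1: "\<And>b. b \<in> Basis \<Longrightarrow> AE z in ?M. norm (g b z) \<le> c1 b" by metis
  have "\<forall>b\<in>Basis. \<forall>b'\<in>Basis. \<exists>c. AE z in ?M. norm (g' b b' z) \<le> c" using g' by (auto simp: ess_bounded_def)
  then obtain c2 where c2: "\<And>b b'. b \<in> Basis \<Longrightarrow> b' \<in> Basis \<Longrightarrow> AE z in ?M. norm (g' b b' z) \<le> c2 b b'" by metis
  define c where "c = \<bar>B\<bar> + (\<Sum>b\<in>Basis. \<bar>c1 b\<bar>) + (\<Sum>b\<in>Basis. \<Sum>b'\<in>Basis. \<bar>c2 b b'\<bar>)"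
  have c0: "0 \<le> c" by (simp add: c_def sum_nonneg)
  have fc: "AE z in ?M. norm (f z) \<le> c"
    using B by eventually_elim (simp add: c_def sum_nonneg add_increasing2)
  have gc: "AE z in ?M. norm (g b z) \<le> c" if b: "b \<in> Basis" for b
    using c1[OF b]
  proof eventually_elim
    case (elim z)
    have "\<bar>c1 b\<bar> \<le> (\<Sum>b\<in>Basis. \<bar>c1 b\<bar>)" using b by (intro member_le_sum) auto
    moreover have "0 \<le> (\<Sum>b\<in>Basis. \<Sum>b'\<in>Basis. \<bar>c2 b b'\<bar>)" by (simp add: sum_nonneg)
    ultimately show ?case using elim unfolding c_def by linarith
  qed
  have g'c: "AE z in ?M. norm (g' b b' z) \<le> c" if b: "b \<in> Basis" "b' \<in> Basis" for b b'
    using c2[OF b]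
  proof eventually_elim
    case (elim z)
    have "\<bar>c2 b b'\<bar> \<le> (\<Sum>b'\<in>Basis. \<bar>c2 b b'\<bar>)"
      using member_le_sum[of b' Basis "\<lambda>b'. \<bar>c2 b b'\<bar>"] b by simp
    also have "\<dots> \<le> (\<Sum>b\<in>Basis. \<Sum>b'\<in>Basis. \<bar>c2 b b'\<bar>)"
      using member_le_sum[of b Basis "\<lambda>b. \<Sum>b'\<in>Basis. \<bar>c2 b b'\<bar>"] b by (simp add: sum_nonneg)
    moreover have "0 \<le> (\<Sum>b\<in>Basis. \<bar>c1 b\<bar>)" by (simp add: sum_nonneg)
    ultimately show ?case using elim unfolding c_def by linarith
  qed
  have gw: "weak_derivative ?\<Omega> b f (g b) \<and> (AE z in ?M. norm (g b z) \<le> c)" if "b \<in> Basis" for b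
    using g[OF that] gc[OF that] by simp
  have gw2: "weak_derivative ?\<Omega> b f (g b) \<and> g b \<in> borel_measurable ?M \<and> (AE z in ?M. norm (g b z) \<le> c)" if "b \<in> Basis" for b
    using g[OF that] gc[OF that] by simp
  have gw3: "weak_derivative ?\<Omega> b' (g b) (g' b b') \<and> (AE z in ?M. norm (g' b b' z) \<le> c)" if "b \<in> Basis" "b' \<in> Basis" for b b'
    using g'[OF that] g'c[OF that] by simp
  define dl where "dl n = inverse (real (Suc n))" for n
  have dl: "0 < dl n" for n by (simp add: dl_def)
  have dl0: "dl \<longlonglongrightarrow> 0" unfolding dl_def by (rule LIMSEQ_inverse_real_of_nat)
  \<comment> \<open>The centre of the kernel used at \<open>z\<close>.\<close>
  define sh where "sh n z = z + (2 * dl n, 0 :: plane)" for n and z :: "real \<times> plane"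
  have sh_diff: "sh n z - sh n z' = z - z'" for n z z' by (simp add: sh_def)
  define H where "H n = {z :: real \<times> plane. dl n < fst z}" for n
  have Hconv: "convex (H n)" for n
  proof -
    have "H n = {dl n<..} \<times> UNIV" by (auto simp: H_def mem_Times_iff)
    then show ?thesis by (simp add: convex_Times)
  qed
  have Hball: "cball a (dl n) \<subseteq> ?\<Omega>" if "a \<in> H n" for a n
    using cball_in_spacetime that by (simp add: H_def)
  have shH: "sh n z \<in> H n" if "0 \<le> fst z" for n z
    using that dl[of n] by (simp add: sh_def H_def)
  define m where "m n = mollify ?\<Omega> (dl n) f" for n
  define S where "S n = mollify_slope ?\<Omega> (dl n) f" for n
  have lim: "(\<lambda>n. m n (sh n z)) \<longlonglongrightarrow> f z" if z: "0 \<le> fst z" for z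
  proof (rule LIMSEQ_I)
    fix e :: real assume e: "0 < e"
    have zin: "z \<in> {0..} \<times> UNIV" using z by (auto simp: mem_Times_iff)
    obtain r where r: "0 < r" "\<And>w. w \<in> {0..} \<times> UNIV \<Longrightarrow> dist w z < r \<Longrightarrow> dist (f w) (f z) < e / 2"
      using cont zin e unfolding continuous_on_iff by (metis half_gt_zero)
    obtain N where N: "\<And>n. n \<ge> N \<Longrightarrow> dl n < r / 3"
      using LIMSEQ_D[OF dl0, of "r / 3"] r dl by (auto simp: abs_of_pos)
    show "\<exists>N. \<forall>n\<ge>N. norm (m n (sh n z) - f z) < e"
    proof (intro exI allI impI)
      fix n assume n: "N \<le> n"
      have "norm (m n (sh n z) - f z) \<le> e / 2"
        unfolding m_def
      proof (rule mollify_near[OF spacetime_lebesgue dl W(1) B Hball[OF shH[OF z]]])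
        fix w assume w: "w \<in> cball (sh n z) (dl n)"
        have "dist w z \<le> dist w (sh n z) + dist (sh n z) z" by (rule dist_triangle)
        also have "dist (sh n z) z = 2 * dl n" using dl[of n] by (simp add: sh_def dist_norm norm_Pair real_sqrt_mult)
        finally have "dist w z < r" using w N[OF n] by (simp add: dist_commute)
        moreover have "w \<in> ?\<Omega>" using w Hball[OF shH[OF z]] by blast
        then have "w \<in> {0..} \<times> UNIV" by (auto simp: mem_Times_iff)
        ultimately show "norm (f w - f z) \<le> e / 2" using r(2)[of w] by (simp add: dist_norm less_imp_le)
      qed (use e in auto)
      then show "norm (m n (sh n z) - f z) < e" using e by simp
    qed
  qed
  define C where "C = 9 * c"
  have C0: "0 \<le> C" "c \<le> C" "3 * c \<le> C" using c0 by (auto simp: C_def)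
  have dim: "DIM(real \<times> plane) = 3" by simp
  have fb: "norm (f z) \<le> C" if z: "0 \<le> fst z" for z
  proof (rule LIMSEQ_le_const2[OF tendsto_norm[OF lim[OF z]]])
    show "\<exists>N. \<forall>n\<ge>N. norm (m n (sh n z)) \<le> C"
      unfolding m_def using mollify_bound[OF spacetime_lebesgue dl fc c0 Hball[OF shH[OF z]]] C0(2) order_trans by blast
  qed
  have flip: "norm (f z - f z') \<le> C * norm (z - z')" if z: "0 \<le> fst z" "0 \<le> fst z'" for z z'
  proof (rule LIMSEQ_le_const2[OF tendsto_norm[OF tendsto_diff[OF lim[OF z(1)] lim[OF z(2)]]]])
    have "norm (m n (sh n z) - m n (sh n z')) \<le> C * norm (z - z')" for n
    proof -
      have "norm (m n (sh n z) - m n (sh n z')) \<le> real DIM(real \<times> plane) * c * norm (sh n z - sh n z')"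
        unfolding m_def
        by (rule mollify_lipschitz[OF spacetime_lebesgue dl W(1) B gw c0 Hconv Hball shH[OF z(1)] shH[OF z(2)]])
      also have "\<dots> \<le> C * norm (z - z')" unfolding sh_diff dim using C0 by (intro mult_right_mono) auto
      finally show ?thesis .
    qed
    then show "\<exists>N. \<forall>n\<ge>N. norm (m n (sh n z) - m n (sh n z')) \<le> C * norm (z - z')" by blast
  qed
  have Sbl: "bounded_linear (S n a)" for n a
    unfolding S_def using mollify_has_derivative[OF spacetime_lebesgue dl W(1) B] by (rule has_derivative_bounded_linear)
  have Sb: "norm (S n (sh n z) v) \<le> C * norm v" if z: "0 \<le> fst z" for n z v
  proof -
    have "norm (S n (sh n z) v) \<le> real DIM(real \<times> plane) * c * norm v"
      unfolding S_def by (rule mollify_slope_bound[OF spacetime_lebesgue dl W(1) B gw c0 Hball[OF shH[OF z]]])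
    also have "\<dots> \<le> C * norm v" unfolding dim using C0 by (intro mult_right_mono) auto
    finally show ?thesis .
  qed
  have St: "norm (m n (sh n z') - m n (sh n z) - S n (sh n z) (z' - z)) \<le> C * (norm (z' - z))\<^sup>2"
    if z: "0 \<le> fst z" "0 \<le> fst z'" for n z z'
  proof -
    have "norm (m n (sh n z') - m n (sh n z) - S n (sh n z) (sh n z' - sh n z))
       \<le> (real DIM(real \<times> plane))\<^sup>2 * c * (norm (sh n z' - sh n z))\<^sup>2"
      unfolding m_def S_def
      by (rule mollify_taylor[OF spacetime_lebesgue dl W(1) B gw2 gw3 c0 Hconv Hball shH[OF z(1)] shH[OF z(2)]])
    then show ?thesis unfolding sh_diff dim by (simp add: C_def)
  qed
  define D where "D = (SOME D. x_differential E D)"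
  have D: "x_differential E D" unfolding D_def using x_differential_exists[OF E1] by (rule someI_ex)
  define Bs where "Bs = {B. 0 \<le> B \<and> (AE z in ?M. norm (D z) \<le> B)}"
  have KB: "K_x E = Inf Bs" by (simp add: K_x_def D_def[symmetric] Linf_norm_def Bs_def)
  obtain b0 where b0: "AE z in ?M. norm (D z) \<le> b0" using D by (auto simp: x_differential_def ess_bounded_def)
  have "AE z in ?M. norm (D z) \<le> max 0 b0" using b0 by (auto elim!: eventually_mono)
  then have Bne: "Bs \<noteq> {}" by (auto simp: Bs_def intro!: exI[of _ "max 0 b0"])
  have K0: "0 \<le> K_x E" unfolding KB by (rule cInf_greatest[OF Bne]) (simp add: Bs_def)
  have Sx: "norm (S n (sh n z) (0, u)) \<le> k * norm u" if k: "K_x E < k" and z: "0 \<le> fst z" for n z u k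
  proof -
    obtain k' where k': "k' \<in> Bs" "k' < k" using cInf_lessD[OF Bne] k unfolding KB by blast
    have "S n (sh n z) (0, u) = mollify ?\<Omega> (dl n) (\<lambda>z. blinfun_apply (D z) u) (sh n z)"
      unfolding S_def
      by (rule mollify_slope_weak_derivative[OF spacetime_lebesgue dl _ Hball[OF shH[OF z]]])
         (use D in \<open>simp add: x_differential_def f_def\<close>)
    also have "norm \<dots> \<le> k' * norm u"
    proof (rule mollify_bound[OF spacetime_lebesgue dl _ _ Hball[OF shH[OF z]]])
      have "AE z in ?M. norm (D z) \<le> k'" using k' by (simp add: Bs_def)
      then show "AE z in ?M. norm (blinfun_apply (D z) u) \<le> k' * norm u"
      proof eventually_elim
        case (elim z)
        then show ?case using norm_blinfun[of "D z" u] mult_right_mono[OF elim, of "norm u"] by simp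
      qed
    qed (use k' in \<open>auto simp: Bs_def\<close>)
    also have "\<dots> \<le> k * norm u" using k' by (intro mult_right_mono) auto
    finally show ?thesis .
  qed
  \<comment> \<open>Bounds with every constant above an infimum hold with the infimum itself.\<close>
  have Kle: "X \<le> K_x E * r" if r: "0 \<le> r" and X: "\<And>k. K_x E < k \<Longrightarrow> X \<le> k * r" for X r
  proof (cases "r = 0")
    case True
    then show ?thesis using X[of "K_x E + 1"] by simp
  next
    case False
    have "X / r \<le> K_x E"
    proof (rule dense_ge)
      fix k assume "K_x E < k"
      from X[OF this] show "X / r \<le> k" using r False by (simp add: divide_le_eq)
    qed
    then show ?thesis using r False by (simp add: divide_le_eq)
  qed
  have fx: "norm (f (t, x) - f (t, x')) \<le> K_x E * norm (x - x')" if t: "0 \<le> t" for t x x'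
  proof (rule Kle)
    fix k assume k: "K_x E < k"
    have t': "0 \<le> fst (t, x)" for x :: plane using t by simp
    show "norm (f (t, x) - f (t, x')) \<le> k * norm (x - x')"
    proof (rule LIMSEQ_le_const2[OF tendsto_norm[OF tendsto_diff[OF lim[OF t'] lim[OF t']]]])
      have "norm (m n (sh n (t, x)) - m n (sh n (t, x'))) \<le> k * norm (x - x')" for n
      proof (rule differentiable_bound[where S = UNIV and f = "\<lambda>x. m n (sh n (t, x))" and f' = "\<lambda>x u. S n (sh n (t, x)) (0, u)"])
        fix x :: plane
        have i: "((\<lambda>x. sh n (t, x)) has_derivative (\<lambda>u. (0, u))) (at x)"
          unfolding sh_def by (auto intro!: derivative_eq_intros)
        show "((\<lambda>x. m n (sh n (t, x))) has_derivative (\<lambda>u. S n (sh n (t, x)) (0, u))) (at x within UNIV)"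
          unfolding m_def S_def
          by (rule has_derivative_compose[OF i mollify_has_derivative[OF spacetime_lebesgue dl W(1) B]])
        show "onorm (\<lambda>u. S n (sh n (t, x)) (0, u)) \<le> k"
          by (rule onorm_le) (rule Sx[OF k t'])
      qed auto
      then show "\<exists>N. \<forall>n\<ge>N. norm (m n (sh n (t, x)) - m n (sh n (t, x'))) \<le> k * norm (x - x')" by blast
    qed
  qed simp
  have "\<exists>A. (\<forall>v. norm (blinfun_apply A v) \<le> C * norm v) \<and> (\<forall>u. norm (blinfun_apply A (0, u)) \<le> K_x E * norm u)
     \<and> (\<forall>z'. 0 \<le> fst z' \<longrightarrow> norm (f z' - f z - blinfun_apply A (z' - z)) \<le> C * (norm (z' - z))\<^sup>2)"
    if z: "0 \<le> fst z" for z
  proof -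
    define F where "F n = Blinfun (S n (sh n z))" for n
    have F: "blinfun_apply (F n) v = S n (sh n z) v" for n v
      unfolding F_def using bounded_linear_Blinfun_apply[OF Sbl] by simp
    have "F n \<in> cball 0 C" for n
      using norm_blinfun_bound[of C "F n"] Sb[OF z] C0(1) by (simp add: F)
    moreover have "seq_compact (cball (0 :: (real \<times> plane) \<Rightarrow>\<^sub>L plane) C)"
      by (rule compact_imp_seq_compact) simp
    ultimately obtain A r where A: "strict_mono r" "(F \<circ> r) \<longlonglongrightarrow> A"
      using seq_compactE[of "cball 0 C" F] by blast
    have Al: "(\<lambda>n. S (r n) (sh (r n) z) v) \<longlonglongrightarrow> blinfun_apply A v" for v
      using bounded_linear.tendsto[OF blinfun.bounded_linear_left A(2), of v] by (simp add: o_def F)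
    have ml: "(\<lambda>n. m (r n) (sh (r n) z')) \<longlonglongrightarrow> f z'" if "0 \<le> fst z'" for z'
      using LIMSEQ_subseq_LIMSEQ[OF lim[OF that] A(1)] by (simp add: o_def)
    show ?thesis
    proof (intro exI[of _ A] conjI allI impI)
      show "norm (blinfun_apply A v) \<le> C * norm v" for v
        by (rule LIMSEQ_le_const2[OF tendsto_norm[OF Al]]) (use Sb[OF z] in blast)
      show "norm (blinfun_apply A (0, u)) \<le> K_x E * norm u" for u
      proof (rule Kle)
        fix k assume k: "K_x E < k"
        show "norm (blinfun_apply A (0, u)) \<le> k * norm u"
          by (rule LIMSEQ_le_const2[OF tendsto_norm[OF Al]]) (use Sx[OF k z] in blast)
      qed simp
      show "norm (f z' - f z - blinfun_apply A (z' - z)) \<le> C * (norm (z' - z))\<^sup>2" if z': "0 \<le> fst z'" for z'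
        by (rule LIMSEQ_le_const2[OF tendsto_norm[OF tendsto_diff[OF tendsto_diff[OF ml[OF z'] ml[OF z]] Al]]])
           (use St[OF z z'] in blast)
    qed
  qed
  then obtain A where A: "\<And>z. 0 \<le> fst z \<Longrightarrow> (\<forall>v. norm (blinfun_apply (A z) v) \<le> C * norm v) \<and> (\<forall>u. norm (blinfun_apply (A z) (0, u)) \<le> K_x E * norm u)
     \<and> (\<forall>z'. 0 \<le> fst z' \<longrightarrow> norm (f z' - f z - blinfun_apply (A z) (z' - z)) \<le> C * (norm (z' - z))\<^sup>2)"
    by metis
  show thesis
  proof (rule that[of C A])
    show "norm (E t x) \<le> C" if "0 \<le> t" for t x using fb[of "(t, x)"] that by (simp add: ft)
    show "norm (E t x - E t x') \<le> K_x E * norm (x - x')" if "0 \<le> t" for t x x' using fx[OF that] by (simp add: ft)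
    show "norm (E s x' - E t x) \<le> C * norm ((s, x') - (t, x))" if "0 \<le> t" "0 \<le> s" for t x s x'
      using flip[of "(s, x')" "(t, x)"] that by (simp add: ft)
    show "norm (blinfun_apply (A (t, x)) v) \<le> C * norm v" if "0 \<le> t" for t x v
      using conjunct1[OF A[of "(t, x)"]] that by (simp del: split_paired_All)
    show "norm (blinfun_apply (A (t, x)) (0, u)) \<le> K_x E * norm u" if "0 \<le> t" for t x u using A[of "(t, x)"] that by simp
    show "norm (E s x' - E t x - blinfun_apply (A (t, x)) (s - t, x' - x)) \<le> C * (norm ((s, x') - (t, x)))\<^sup>2"
      if "0 \<le> t" "0 \<le> s" for t x s x'
      using A[of "(t, x)"] that by (simp add: ft)
  qed (use K0 C0 in auto)
qed

text \<open>Uniform quadratic Taylor bounds at two points make the slopes Lipschitz: compare the three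
expansions in the triangle \<open>z\<close>, \<open>z'\<close>, \<open>z' + k\<close> with a \<open>k\<close> as long as \<open>z' - z\<close>. The set \<open>V\<close> of admissible
directions keeps \<open>z' + k\<close> inside the domain of \<open>f\<close>.\<close>
lemma slope_lipschitz_of_taylor:
  fixes A :: "'a::real_normed_vector \<Rightarrow>\<^sub>L 'b::real_normed_vector" and A' :: "'a \<Rightarrow>\<^sub>L 'b"
  assumes C: "0 \<le> C"
    and z: "norm (f z' - f z - blinfun_apply A (z' - z)) \<le> C * (norm (z' - z))\<^sup>2"
    and zk: "\<And>k. k \<in> V \<Longrightarrow> norm (f (z' + k) - f z - blinfun_apply A (z' + k - z)) \<le> C * (norm (z' + k - z))\<^sup>2"
    and z'k: "\<And>k. k \<in> V \<Longrightarrow> norm (f (z' + k) - f z' - blinfun_apply A' k) \<le> C * (norm k)\<^sup>2"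
    and V: "\<And>r k. k \<in> V \<Longrightarrow> r *\<^sub>R k \<in> V" and u: "u \<in> V"
  shows "norm (blinfun_apply A' u - blinfun_apply A u) \<le> 6 * C * norm (z' - z) * norm u"
proof (cases "u = 0")
  case False
  then have nu: "0 < norm u" by simp
  define d where "d = norm (z' - z)"
  show ?thesis
  proof (cases "d = 0")
    case True
    \<comment> \<open>Then both slopes are derivatives at the same point.\<close>
    then have zz: "z' = z" by (simp add: d_def)
    show ?thesis
    proof (rule ccontr)
      assume n: "\<not> ?thesis"
      define e where "e = norm (blinfun_apply A' u - blinfun_apply A u)"
      have e: "0 < e" using n zz by (simp add: e_def)
      \<comment> \<open>A step so short that the quadratic remainders cannot account for a difference \<open>e\<close>.\<close>
      define s where "s = e / (4 * (C + 1) * (norm u)\<^sup>2)"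
      have s: "0 < s" using e C nu by (simp add: s_def)
      have su: "s *\<^sub>R u \<in> V" by (rule V[OF u])
      have "s * e = norm (blinfun_apply A' (s *\<^sub>R u) - blinfun_apply A (s *\<^sub>R u))"
        using s by (simp add: e_def blinfun.scaleR_right flip: scaleR_diff_right)
      also have "\<dots> = norm ((f (z' + s *\<^sub>R u) - f z - blinfun_apply A (z' + s *\<^sub>R u - z)) - (f (z' + s *\<^sub>R u) - f z' - blinfun_apply A' (s *\<^sub>R u)))"
        unfolding zz by (simp add: algebra_simps)
      also have "\<dots> \<le> C * (norm (z' + s *\<^sub>R u - z))\<^sup>2 + C * (norm (s *\<^sub>R u))\<^sup>2"
        by (intro order_trans[OF norm_triangle_ineq4] add_mono zk z'k su)
      also have "\<dots> = s * (2 * C * (norm u)\<^sup>2 * s)"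
        using s zz by (simp add: power_mult_distrib power2_eq_square)
      finally have "e \<le> 2 * C * (norm u)\<^sup>2 * s" using s by simp
      also have "\<dots> = e * (C / (2 * (C + 1)))" 
      proof -
        have "C + 1 \<noteq> 0" using C by simp
        then show ?thesis using nu unfolding s_def by (simp add: divide_simps)
      qed
      also have "\<dots> < e * 1" using e C by (intro mult_strict_left_mono) (auto simp: divide_less_eq)
      finally show False by simp
    qed
  next
    case False
    then have d: "0 < d" by (simp add: d_def)
    define s where "s = d / norm u"
    have s: "0 < s" using d nu by (simp add: s_def)
    have su: "s *\<^sub>R u \<in> V" by (rule V[OF u])
    have nsu: "norm (s *\<^sub>R u) = d" using s nu d by (simp add: s_def)
    have "s * norm (blinfun_apply A' u - blinfun_apply A u) = norm (blinfun_apply A' (s *\<^sub>R u) - blinfun_apply A (s *\<^sub>R u))"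
      using s by (simp add: blinfun.scaleR_right flip: scaleR_diff_right)
    also have "blinfun_apply A' (s *\<^sub>R u) - blinfun_apply A (s *\<^sub>R u)
        = (f (z' + s *\<^sub>R u) - f z - blinfun_apply A (z' + s *\<^sub>R u - z)) + (- (f (z' + s *\<^sub>R u) - f z' - blinfun_apply A' (s *\<^sub>R u)))
          + (- (f z' - f z - blinfun_apply A (z' - z)))"
      by (simp add: blinfun.add_right blinfun.diff_right)
    also have "norm \<dots> \<le> C * (norm (z' + s *\<^sub>R u - z))\<^sup>2 + C * (norm (s *\<^sub>R u))\<^sup>2 + C * (norm (z' - z))\<^sup>2"
      by (intro norm_add3_le zk su z) (use z'k[OF su] z in \<open>simp_all add: norm_minus_commute\<close>)
    also have "\<dots> \<le> C * (2 * d)\<^sup>2 + C * d\<^sup>2 + C * d\<^sup>2"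
    proof (intro add_mono mult_left_mono power_mono)
      have "norm (z' + s *\<^sub>R u - z) \<le> norm (z' - z) + norm (s *\<^sub>R u)"
        using norm_triangle_ineq[of "z' - z" "s *\<^sub>R u"] by (simp add: algebra_simps)
      then show "norm (z' + s *\<^sub>R u - z) \<le> 2 * d" using nsu by (simp add: d_def)
      show "norm (s *\<^sub>R u) \<le> d" using nsu by simp
      show "norm (z' - z) \<le> d" by (simp add: d_def)
    qed (use C in auto)
    also have "\<dots> = s * (6 * C * d * norm u)" using nu by (simp add: s_def power2_eq_square)
    finally show ?thesis using s by (simp add: d_def)
  qed
qed (use C in simp)

section \<open>One step of the scheme in complex coordinates\<close>

lemma gamma_quadratic: "\<gamma> * (2 - \<gamma>) = 1 / 2"
proof -
  have "(1 / sqrt 2) * (1 / sqrt 2) = (1/2::real)" by simp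
  then show ?thesis unfolding \<gamma>_def by algebra
qed

lemma gamma_bounds: "1/4 < \<gamma>" "\<gamma> < 1/3"
proof -
  have s: "sqrt 2 < 3/2" by (rule real_less_lsqrt) (auto simp: power2_eq_square)
  have s': "4/3 < sqrt 2" by (rule real_less_rsqrt) (auto simp: power2_eq_square)
  show "1/4 < \<gamma>" "\<gamma> < 1/3" unfolding \<gamma>_def using s s' by (auto simp: field_simps)
qed

lemma gamma_pos: "0 < \<gamma>" using gamma_bounds by simp

text \<open>The node \<open>1 / (2 \<gamma>)\<close> of the second stage; it lies between 1 and 2.\<close>
lemma inverse_two_gamma: "1 / (2 * \<gamma>) = 2 - \<gamma>"
  using gamma_quadratic gamma_pos by (simp add: field_simps)

text \<open>The stiff part of \<open>w'\<close> is \<open>- \<i> w / \<epsilon>\<^sup>2\<close>; this is its coefficient times the step, up to sign.\<close>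
definition imu :: "real \<Rightarrow> real \<Rightarrow> complex" where
  "imu \<epsilon> h = \<i> * of_real (h / \<epsilon>\<^sup>2)"

text \<open>The stages and the result of one step, solved for the unknowns, as functions of the complex position \<open>y\<close> and
the scaled velocity \<open>w\<close>. Each implicit equation is linear in its unknown.\<close>
definition stage_w :: "(real \<Rightarrow> complex \<Rightarrow> complex) \<Rightarrow> real \<Rightarrow> real \<Rightarrow> real \<Rightarrow> complex \<Rightarrow> complex \<Rightarrow> complex" where
  "stage_w E \<epsilon> h t y w = (w + of_real (\<gamma> * h) * E t (y + \<i> * w)) / (1 + of_real \<gamma> * imu \<epsilon> h)"

definition hat_y :: "(real \<Rightarrow> complex \<Rightarrow> complex) \<Rightarrow> real \<Rightarrow> real \<Rightarrow> real \<Rightarrow> complex \<Rightarrow> complex \<Rightarrow> complex" where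
  "hat_y E \<epsilon> h t y w = y - \<i> * of_real (h / (2 * \<gamma>)) * E t (y + \<i> * stage_w E \<epsilon> h t y w)"

definition hat_w :: "(real \<Rightarrow> complex \<Rightarrow> complex) \<Rightarrow> real \<Rightarrow> real \<Rightarrow> real \<Rightarrow> complex \<Rightarrow> complex \<Rightarrow> complex" where
  "hat_w E \<epsilon> h t y w =
     w + (of_real h * E t (y + \<i> * w) - imu \<epsilon> h * stage_w E \<epsilon> h t y w) / of_real (2 * \<gamma>)"

definition next_w :: "(real \<Rightarrow> complex \<Rightarrow> complex) \<Rightarrow> real \<Rightarrow> real \<Rightarrow> real \<Rightarrow> complex \<Rightarrow> complex \<Rightarrow> complex" where
  "next_w E \<epsilon> h t y w =
     (w + of_real (1 - \<gamma>) * (of_real h * E t (y + \<i> * w) - imu \<epsilon> h * stage_w E \<epsilon> h t y w)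
        + of_real (\<gamma> * h) * E (t + h / (2 * \<gamma>)) (hat_y E \<epsilon> h t y w + \<i> * hat_w E \<epsilon> h t y w))
     / (1 + of_real \<gamma> * imu \<epsilon> h)"

definition next_y :: "(real \<Rightarrow> complex \<Rightarrow> complex) \<Rightarrow> real \<Rightarrow> real \<Rightarrow> real \<Rightarrow> complex \<Rightarrow> complex \<Rightarrow> complex" where
  "next_y E \<epsilon> h t y w =
     y - \<i> * of_real h * (of_real (1 - \<gamma>) * E t (y + \<i> * stage_w E \<epsilon> h t y w)
        + of_real \<gamma> * E (t + h / (2 * \<gamma>)) (hat_y E \<epsilon> h t y w + \<i> * next_w E \<epsilon> h t y w))"

lemma eq_divide_square:
  fixes a f q n :: complex
  assumes "a \<noteq> 0" "f * a\<^sup>2 - q * a\<^sup>2 = n"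
  shows "f - q = n / a\<^sup>2"
  using assms by (simp add: eq_divide_eq left_diff_distrib)

lemma distribute_divide_square:
  fixes a c g u m :: complex
  assumes "a \<noteq> 0"
  shows "m * (c + g * u) / a\<^sup>2 = m * (c / a + g * (u / a)) / a"
  using assms by (simp add: field_simps power2_eq_square)

context
  fixes \<epsilon> h :: real
  assumes eps: "0 < \<epsilon>" and h: "0 < h"
begin

lemma norm_imu: "norm (imu \<epsilon> h) = h / \<epsilon>\<^sup>2"
  unfolding imu_def norm_mult norm_of_real using h by simp

lemma one_le_norm_implicit: "1 \<le> norm (1 + of_real \<gamma> * imu \<epsilon> h)"
proof -
  have "Re (1 + of_real \<gamma> * imu \<epsilon> h) = 1" by (simp add: imu_def)
  then show ?thesis by (metis complex_Re_le_cmod)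
qed

lemma implicit_nonzero: "1 + of_real \<gamma> * imu \<epsilon> h \<noteq> 0"
  using one_le_norm_implicit by force

lemma norm_imu_le_implicit: "norm (of_real \<gamma> * imu \<epsilon> h) \<le> norm (1 + of_real \<gamma> * imu \<epsilon> h)"
proof -
  have "Im (1 + of_real \<gamma> * imu \<epsilon> h) = \<gamma> * (h / \<epsilon>\<^sup>2)" by (simp add: imu_def)
  then have "\<bar>\<gamma> * (h / \<epsilon>\<^sup>2)\<bar> \<le> norm (1 + of_real \<gamma> * imu \<epsilon> h)"
    by (metis abs_Im_le_cmod)
  then show ?thesis using h gamma_pos by (simp add: norm_mult norm_imu)
qed

lemma norm_divide_implicit: "norm (z / (1 + of_real \<gamma> * imu \<epsilon> h)) \<le> norm z"
  using one_le_norm_implicit by (simp add: norm_divide divide_le_eq mult_le_cancel_left1)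

text \<open>The implicit solve turns a factor \<open>h\<close> into \<open>\<epsilon>\<^sup>2\<close>, whatever the ratio of the two.\<close>
lemma stiff_divide_implicit: "norm (of_real (\<gamma> * h) * z / (1 + of_real \<gamma> * imu \<epsilon> h)) \<le> \<epsilon>\<^sup>2 * norm z"
proof -
  have "norm (of_real (\<gamma> * h)::complex) = \<epsilon>\<^sup>2 * norm (of_real \<gamma> * imu \<epsilon> h)"
    using eps h gamma_pos by (simp add: norm_mult norm_imu)
  also have "\<dots> \<le> \<epsilon>\<^sup>2 * norm (1 + of_real \<gamma> * imu \<epsilon> h)"
    by (intro mult_left_mono norm_imu_le_implicit) auto
  finally have "norm (of_real (\<gamma> * h)::complex) \<le> \<epsilon>\<^sup>2 * norm (1 + of_real \<gamma> * imu \<epsilon> h)" .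
  then have "norm (of_real (\<gamma> * h)::complex) * norm z \<le> \<epsilon>\<^sup>2 * norm (1 + of_real \<gamma> * imu \<epsilon> h) * norm z"
    by (intro mult_right_mono) auto
  then show ?thesis
    using one_le_norm_implicit by (simp add: norm_divide norm_mult divide_le_eq algebra_simps)
qed

lemma imu_divide_implicit: "norm (of_real \<gamma> * imu \<epsilon> h / (1 + of_real \<gamma> * imu \<epsilon> h)) \<le> 1"
  using norm_imu_le_implicit one_le_norm_implicit by (simp add: norm_divide divide_le_eq)

lemma inverse_implicit_near_one:
  "norm (1 / (1 + of_real \<gamma> * imu \<epsilon> h) - 1) \<le> h / \<epsilon>\<^sup>2"
proof -
  have "1 / (1 + of_real \<gamma> * imu \<epsilon> h) - 1 = - (of_real \<gamma> * imu \<epsilon> h) / (1 + of_real \<gamma> * imu \<epsilon> h)"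
    using implicit_nonzero by (simp add: field_simps)
  then have "norm (1 / (1 + of_real \<gamma> * imu \<epsilon> h) - 1) \<le> norm (- (of_real \<gamma> * imu \<epsilon> h))"
    using norm_divide_implicit by presburger
  also have "\<dots> = \<gamma> * (h / \<epsilon>\<^sup>2)" using gamma_pos by (simp add: norm_mult norm_imu)
  also have "\<dots> \<le> 1 * (h / \<epsilon>\<^sup>2)" using gamma_bounds h by (intro mult_right_mono) auto
  finally show ?thesis by simp
qed

text \<open>By \<open>next_w_increment\<close>, the increment of \<open>w\<close> over one step is \<open>h\<close> times its drift times this factor, if the field is constant.
Up to terms of order \<open>z\<^sup>2\<close> it agrees with \<open>(1 - exp (- z)) / z\<close> for \<open>z = imu \<epsilon> h\<close>, the factor of the exact flow.\<close>
definition increment_factor :: complex where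
  "increment_factor = (1 + of_real (\<gamma>\<^sup>2) * imu \<epsilon> h) / (1 + of_real \<gamma> * imu \<epsilon> h)\<^sup>2"

lemma gamma_sq: "(of_real \<gamma> :: complex)\<^sup>2 = 2 * of_real \<gamma> - 1/2"
proof -
  have "\<gamma>\<^sup>2 = 2 * \<gamma> - 1/2" using gamma_quadratic by (simp add: power2_eq_square algebra_simps)
  then have "complex_of_real (\<gamma>\<^sup>2) = of_real (2 * \<gamma> - 1/2)" by simp
  then show ?thesis by simp
qed

lemma norm_increment_factor: "norm increment_factor \<le> 1"
proof -
  let ?a = "1 + of_real \<gamma> * imu \<epsilon> h"
  have "(norm (1 + of_real (\<gamma>\<^sup>2) * imu \<epsilon> h))\<^sup>2 \<le> (norm ?a)\<^sup>2"
  proof -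
    have "\<gamma>\<^sup>2 \<le> \<gamma>" using gamma_bounds by (simp add: power2_eq_square)
    then have "(\<gamma>\<^sup>2 * (h / \<epsilon>\<^sup>2))\<^sup>2 \<le> (\<gamma> * (h / \<epsilon>\<^sup>2))\<^sup>2"
      using h by (intro power_mono mult_right_mono) auto
    then show ?thesis unfolding cmod_power2 imu_def by simp
  qed
  then have "norm (1 + of_real (\<gamma>\<^sup>2) * imu \<epsilon> h) \<le> norm ?a" by simp
  then have "norm ((1 + of_real (\<gamma>\<^sup>2) * imu \<epsilon> h) / ?a) \<le> 1"
    using one_le_norm_implicit by (simp add: norm_divide divide_le_eq)
  moreover have "increment_factor = ((1 + of_real (\<gamma>\<^sup>2) * imu \<epsilon> h) / ?a) / ?a"
    by (simp add: increment_factor_def power2_eq_square)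
  ultimately show ?thesis using norm_divide_implicit order_trans by metis
qed

lemma increment_factor_near_one: "norm (increment_factor - 1) \<le> h / \<epsilon>\<^sup>2"
proof -
  let ?m = "imu \<epsilon> h" let ?g = "complex_of_real \<gamma>" let ?a = "1 + ?g * ?m"
  have "increment_factor - 1 = (- ?m) * (1/2 + ?g * (?g * ?m)) / ?a\<^sup>2"
  proof -
    have "1 + of_real (\<gamma>\<^sup>2) * ?m - ?a\<^sup>2 = - (?m * (1/2 + ?g * (?g * ?m)))"
    proof -
      have "1 + of_real (\<gamma>\<^sup>2) * ?m - ?a\<^sup>2 + ?m * (1/2 + ?g * (?g * ?m)) = (?g\<^sup>2 - 2 * ?g + 1/2) * ?m"
        by (simp add: algebra_simps power2_eq_square)
      then show ?thesis using gamma_sq by (simp add: eq_neg_iff_add_eq_0)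
    qed
    then have "increment_factor * ?a\<^sup>2 - ?a\<^sup>2 = (- ?m) * (1/2 + ?g * (?g * ?m))"
      using implicit_nonzero by (simp add: increment_factor_def)
    then show ?thesis using implicit_nonzero by (intro eq_divide_square) auto
  qed
  also have "\<dots> = (- ?m) * (1/2 / ?a + ?g * (?g * ?m / ?a)) / ?a"
    using implicit_nonzero by (rule distribute_divide_square)
  finally have "norm (increment_factor - 1) \<le> norm (?m * (1/2 / ?a + ?g * (?g * ?m / ?a)))"
    using norm_divide_implicit by (metis norm_minus_cancel mult_minus_left)
  also have "\<dots> \<le> norm ?m * (1/2 + 1/2 * 1)"
    unfolding norm_mult
  proof (intro mult_left_mono order_trans[OF norm_triangle_ineq] add_mono)
    show "norm (1/2 / ?a) \<le> 1/2" using norm_divide_implicit[of "1/2"] by simp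
    show "norm (?g * (?g * ?m / ?a)) \<le> 1/2 * 1"
      unfolding norm_mult using imu_divide_implicit gamma_bounds
      by (intro mult_mono) (auto simp: norm_mult)
  qed auto
  finally show ?thesis by (simp add: norm_imu)
qed

lemma increment_factor_second_order:
  "norm (increment_factor - (1 - imu \<epsilon> h / 2)) \<le> (h / \<epsilon>\<^sup>2)\<^sup>2"
proof -
  let ?m = "imu \<epsilon> h" let ?g = "complex_of_real \<gamma>" let ?a = "1 + ?g * ?m"
  have "increment_factor - (1 - ?m/2) = ?m\<^sup>2 * ((?g - ?g\<^sup>2) + ?g/2 * (?g * ?m)) / ?a\<^sup>2"
  proof -
    have "1 + of_real (\<gamma>\<^sup>2) * ?m - (1 - ?m/2) * ?a\<^sup>2 = ?m\<^sup>2 * ((?g - ?g\<^sup>2) + ?g/2 * (?g * ?m))"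
    proof -
      have "1 + of_real (\<gamma>\<^sup>2) * ?m - (1 - ?m/2) * ?a\<^sup>2 - ?m\<^sup>2 * ((?g - ?g\<^sup>2) + ?g/2 * (?g * ?m))
          = (?g\<^sup>2 - 2 * ?g + 1/2) * ?m"
        by (simp add: algebra_simps power2_eq_square)
      then show ?thesis using gamma_sq by simp
    qed
    then have "increment_factor * ?a\<^sup>2 - (1 - ?m/2) * ?a\<^sup>2 = ?m\<^sup>2 * ((?g - ?g\<^sup>2) + ?g/2 * (?g * ?m))"
      using implicit_nonzero by (simp add: increment_factor_def)
    then show ?thesis using implicit_nonzero by (intro eq_divide_square) auto
  qed
  also have "\<dots> = ?m\<^sup>2 * (of_real (\<gamma> * (1 - \<gamma>)) / ?a + ?g/2 * (?g * ?m / ?a)) / ?a"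
    using distribute_divide_square[OF implicit_nonzero, of "?m\<^sup>2" "?g - ?g\<^sup>2" "?g/2" "?g * ?m"]
    by (simp add: power2_eq_square right_diff_distrib)
  finally have "norm (increment_factor - (1 - ?m/2)) \<le> norm (?m\<^sup>2 * (of_real (\<gamma> * (1 - \<gamma>)) / ?a + ?g/2 * (?g * ?m / ?a)))"
    using norm_divide_implicit by metis
  also have "\<dots> \<le> norm (?m\<^sup>2) * (1/2 + 1/2 * 1)"
    unfolding norm_mult[of "?m\<^sup>2"]
  proof (intro mult_left_mono order_trans[OF norm_triangle_ineq] add_mono)
    have "norm (of_real (\<gamma> * (1 - \<gamma>)) :: complex) \<le> 1/2"
      unfolding norm_of_real using gamma_bounds mult_mono[of \<gamma> "1/2" "1-\<gamma>" 1] by (simp add: abs_mult)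
    then show "norm (of_real (\<gamma> * (1 - \<gamma>)) / ?a) \<le> 1/2"
      using norm_divide_implicit order_trans by blast
    show "norm (?g/2 * (?g * ?m / ?a)) \<le> 1/2 * 1"
      unfolding norm_mult[of "?g/2"] using imu_divide_implicit gamma_bounds
      by (intro mult_mono) (auto simp: norm_divide)
  qed auto
  finally show ?thesis by (simp add: norm_imu norm_power)
qed

text \<open>The relation \<open>(1 - 2 \<gamma>)\<^sup>2 = 2 \<gamma>\<^sup>2\<close>, equivalent to the equation for \<open>\<gamma>\<close>, makes the squared numerator the truncation
of the squared denominator after the term of order 2.\<close>
lemma norm_stability_factor:
  "norm ((1 - of_real (1 - 2 * \<gamma>) * imu \<epsilon> h) / (1 + of_real \<gamma> * imu \<epsilon> h)\<^sup>2) \<le> 1"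
proof -
  let ?l = "h / \<epsilon>\<^sup>2"
  have g: "(1 - 2 * \<gamma>)\<^sup>2 = 2 * \<gamma>\<^sup>2" using gamma_quadratic by algebra
  have "(norm (1 - of_real (1 - 2 * \<gamma>) * imu \<epsilon> h))\<^sup>2 = 1 + (1 - 2 * \<gamma>)\<^sup>2 * ?l\<^sup>2"
    unfolding cmod_power2 imu_def by (simp add: power_mult_distrib power_divide)
  also have "\<dots> \<le> (1 + \<gamma>\<^sup>2 * ?l\<^sup>2)\<^sup>2" 
  proof -
    have "(1 + \<gamma>\<^sup>2 * ?l\<^sup>2)\<^sup>2 = 1 + 2 * \<gamma>\<^sup>2 * ?l\<^sup>2 + (\<gamma>\<^sup>2 * ?l\<^sup>2)\<^sup>2"
      by (simp only: power2_sum) simp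
    then show ?thesis unfolding g by simp
  qed
  also have "1 + \<gamma>\<^sup>2 * ?l\<^sup>2 = (norm (1 + of_real \<gamma> * imu \<epsilon> h))\<^sup>2"
    unfolding cmod_power2 imu_def by (simp add: power_mult_distrib power_divide)
  finally have "norm (1 - of_real (1 - 2 * \<gamma>) * imu \<epsilon> h) \<le> (norm (1 + of_real \<gamma> * imu \<epsilon> h))\<^sup>2"
    by (rule power2_le_imp_le) auto
  then show ?thesis using implicit_nonzero by (simp add: norm_divide norm_power divide_le_eq)
qed

lemma imu_increment:
  "of_real h * (e - \<i> * w / of_real (\<epsilon>\<^sup>2)) = of_real h * e - imu \<epsilon> h * w"
  by (simp add: imu_def algebra_simps)

lemma stage_w_increment:
  "stage_w E \<epsilon> h t y w - w =
     of_real (\<gamma> * h) * (E t (y + \<i> * w) - \<i> * w / of_real (\<epsilon>\<^sup>2)) / (1 + of_real \<gamma> * imu \<epsilon> h)"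
proof -
  have "of_real (\<gamma> * h) * (E t (y + \<i> * w) - \<i> * w / of_real (\<epsilon>\<^sup>2))
      = of_real \<gamma> * (of_real h * E t (y + \<i> * w) - imu \<epsilon> h * w)"
    unfolding imu_increment[symmetric] by simp
  then show ?thesis using implicit_nonzero by (simp add: stage_w_def field_simps)
qed

lemma stage_residual:
  "of_real h * E t (y + \<i> * w) - imu \<epsilon> h * stage_w E \<epsilon> h t y w =
     of_real h * (E t (y + \<i> * w) - \<i> * w / of_real (\<epsilon>\<^sup>2)) / (1 + of_real \<gamma> * imu \<epsilon> h)"
  unfolding imu_increment using implicit_nonzero by (simp add: stage_w_def field_simps)

lemma hat_w_increment:
  "hat_w E \<epsilon> h t y w - w =
     of_real (h / (2 * \<gamma>)) * (E t (y + \<i> * w) - \<i> * w / of_real (\<epsilon>\<^sup>2)) / (1 + of_real \<gamma> * imu \<epsilon> h)"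
  unfolding hat_w_def stage_residual by simp

lemma next_w_increment:
  "next_w E \<epsilon> h t y w - w =
     of_real h * (E t (y + \<i> * w) - \<i> * w / of_real (\<epsilon>\<^sup>2)) * increment_factor
     + of_real (\<gamma> * h) * (E (t + h / (2 * \<gamma>)) (hat_y E \<epsilon> h t y w + \<i> * hat_w E \<epsilon> h t y w)
         - E t (y + \<i> * w)) / (1 + of_real \<gamma> * imu \<epsilon> h)"
proof -
  define a where "a = 1 + of_real \<gamma> * imu \<epsilon> h"
  define e where "e = E t (y + \<i> * w)"
  define eh where "eh = E (t + h / (2 * \<gamma>)) (hat_y E \<epsilon> h t y w + \<i> * hat_w E \<epsilon> h t y w)"
  define p where "p = e - \<i> * w / of_real (\<epsilon>\<^sup>2)"
  have a: "a \<noteq> 0" using implicit_nonzero by (simp add: a_def)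
  have hp: "of_real h * p = of_real h * e - imu \<epsilon> h * w" by (simp add: p_def imu_def algebra_simps)
  have f: "increment_factor = (of_real (1 - \<gamma>) + of_real \<gamma> * a) / a\<^sup>2"
    by (simp add: increment_factor_def a_def algebra_simps power2_eq_square)
  have "next_w E \<epsilon> h t y w = (w + of_real (1 - \<gamma>) * (of_real h * p / a) + of_real (\<gamma> * h) * eh) / a"
    unfolding next_w_def stage_residual a_def e_def eh_def p_def ..
  also have "\<dots> - w = (of_real (1 - \<gamma>) * (of_real h * p / a) + of_real \<gamma> * (of_real h * e - imu \<epsilon> h * w) + of_real (\<gamma> * h) * (eh - e)) / a"
    using a by (simp add: field_simps) (simp add: a_def algebra_simps)
  also have "\<dots> = (of_real (1 - \<gamma>) * (of_real h * p / a) + of_real \<gamma> * (of_real h * p) + of_real (\<gamma> * h) * (eh - e)) / a"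
    unfolding hp ..
  also have "\<dots> = of_real h * p * increment_factor + of_real (\<gamma> * h) * (eh - e) / a"
    unfolding f using a by (simp add: field_simps power2_eq_square)
  finally show ?thesis by (simp add: a_def e_def eh_def p_def)
qed

lemma next_w_propagator:
  "next_w E \<epsilon> h t y w =
     (1 - of_real (1 - 2 * \<gamma>) * imu \<epsilon> h) / (1 + of_real \<gamma> * imu \<epsilon> h)\<^sup>2 * w
     + of_real h * (of_real (1 - \<gamma>) * E t (y + \<i> * w) / (1 + of_real \<gamma> * imu \<epsilon> h)
         + of_real \<gamma> * E (t + h / (2 * \<gamma>)) (hat_y E \<epsilon> h t y w + \<i> * hat_w E \<epsilon> h t y w))
       / (1 + of_real \<gamma> * imu \<epsilon> h)"
proof -
  define a where "a = 1 + of_real \<gamma> * imu \<epsilon> h"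
  define e where "e = E t (y + \<i> * w)"
  define eh where "eh = E (t + h / (2 * \<gamma>)) (hat_y E \<epsilon> h t y w + \<i> * hat_w E \<epsilon> h t y w)"
  have a: "a \<noteq> 0" using implicit_nonzero by (simp add: a_def)
  have r: "(1 - of_real (1 - 2 * \<gamma>) * imu \<epsilon> h) = a - of_real (1 - \<gamma>) * imu \<epsilon> h"
    by (simp add: a_def algebra_simps)
  have "of_real h * e - imu \<epsilon> h * stage_w E \<epsilon> h t y w = (of_real h * e - imu \<epsilon> h * w) / a"
    unfolding e_def stage_residual a_def by (simp add: imu_def algebra_simps)
  then have "next_w E \<epsilon> h t y w = (w + of_real (1 - \<gamma>) * ((of_real h * e - imu \<epsilon> h * w) / a) + of_real (\<gamma> * h) * eh) / a"
    unfolding next_w_def a_def e_def eh_def by simp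
  also have "\<dots> = (a - of_real (1 - \<gamma>) * imu \<epsilon> h) / a\<^sup>2 * w
     + of_real h * (of_real (1 - \<gamma>) * e / a + of_real \<gamma> * eh) / a"
    using a by (simp add: field_simps power2_eq_square)
  finally show ?thesis unfolding r[symmetric] by (simp add: a_def e_def eh_def)
qed

text \<open>For a constant field \<open>- \<i> \<epsilon>\<^sup>2 E\<close> is a fixed point of the scheme, as it is of the equation for \<open>w\<close>. The
deviation from it is therefore driven only by the variation of the field within the step.\<close>
lemma next_w_equilibrium:
  "next_w E \<epsilon> h t y w + \<i> * of_real (\<epsilon>\<^sup>2) * E t (y + \<i> * w) =
     (1 - of_real (1 - 2 * \<gamma>) * imu \<epsilon> h) / (1 + of_real \<gamma> * imu \<epsilon> h)\<^sup>2
       * (w + \<i> * of_real (\<epsilon>\<^sup>2) * E t (y + \<i> * w))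
     + of_real (\<gamma> * h) * (E (t + h / (2 * \<gamma>)) (hat_y E \<epsilon> h t y w + \<i> * hat_w E \<epsilon> h t y w)
         - E t (y + \<i> * w)) / (1 + of_real \<gamma> * imu \<epsilon> h)"
proof -
  define a where "a = 1 + of_real \<gamma> * imu \<epsilon> h"
  define e where "e = E t (y + \<i> * w)"
  define eh where "eh = E (t + h / (2 * \<gamma>)) (hat_y E \<epsilon> h t y w + \<i> * hat_w E \<epsilon> h t y w)"
  define r where "r = 1 - of_real (1 - 2 * \<gamma>) * imu \<epsilon> h"
  have a: "a \<noteq> 0" using implicit_nonzero by (simp add: a_def)
  have m: "imu \<epsilon> h * (\<i> * of_real (\<epsilon>\<^sup>2)) = - of_real h"
  proof -
    have "imu \<epsilon> h * (\<i> * of_real (\<epsilon>\<^sup>2)) = (\<i> * \<i>) * of_real (h / \<epsilon>\<^sup>2 * \<epsilon>\<^sup>2)"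
      by (simp only: imu_def of_real_mult ac_simps)
    then show ?thesis using eps by simp
  qed
  have ra: "a\<^sup>2 - r = imu \<epsilon> h * (of_real (1 - \<gamma>) + of_real \<gamma> * a)"
    unfolding a_def r_def by (simp add: algebra_simps power2_eq_square)
  have "(\<i> * of_real (\<epsilon>\<^sup>2) * e) * (a\<^sup>2 - r) = - of_real h * e * (of_real (1 - \<gamma>) + of_real \<gamma> * a)"
    unfolding ra using m by (metis (no_types, lifting) mult.assoc mult.commute mult.left_commute mult_minus_left)
  then have k: "\<i> * of_real (\<epsilon>\<^sup>2) * e - r / a\<^sup>2 * (\<i> * of_real (\<epsilon>\<^sup>2) * e)
      = - of_real h * e * (of_real (1 - \<gamma>) + of_real \<gamma> * a) / a\<^sup>2"
    using a by (simp add: field_simps)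
  have "next_w E \<epsilon> h t y w = r / a\<^sup>2 * w + of_real h * (of_real (1 - \<gamma>) * e / a + of_real \<gamma> * eh) / a"
    unfolding next_w_propagator a_def e_def eh_def r_def ..
  then have "next_w E \<epsilon> h t y w + \<i> * of_real (\<epsilon>\<^sup>2) * e
     = r / a\<^sup>2 * (w + \<i> * of_real (\<epsilon>\<^sup>2) * e) + of_real h * (of_real (1 - \<gamma>) * e / a + of_real \<gamma> * eh) / a
       + (- of_real h * e * (of_real (1 - \<gamma>) + of_real \<gamma> * a) / a\<^sup>2)"
    unfolding k[symmetric] by (simp add: algebra_simps)
  also have "\<dots> = r / a\<^sup>2 * (w + \<i> * of_real (\<epsilon>\<^sup>2) * e) + of_real (\<gamma> * h) * (eh - e) / a"
    using a by (simp add: field_simps power2_eq_square)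
  finally show ?thesis by (simp add: a_def e_def eh_def r_def)
qed

end

section \<open>Uniform stability\<close>

text \<open>The consequences of \<open>W\<^sup>2\<^sup>,\<^sup>\<infinity>\<close> regularity on which the error analysis rests. All constants are merged into \<open>L\<close>, except
the Lipschitz constant \<open>K\<close> in space, which alone may enter exponential rates.\<close>
locale smooth_field =
  fixes E Et :: "real \<Rightarrow> complex \<Rightarrow> complex"
    and D :: "real \<Rightarrow> complex \<Rightarrow> complex \<Rightarrow> complex"
    and K L :: real
  assumes K_nonneg: "0 \<le> K" and K_le_L: "K \<le> L" and one_le_L: "1 \<le> L"
    and E_bound: "0 \<le> t \<Longrightarrow> norm (E t x) \<le> L"
    and E_lipschitz: "0 \<le> t \<Longrightarrow> norm (E t x - E t x') \<le> K * norm (x - x')"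
    and E_lipschitz_time: "0 \<le> s \<Longrightarrow> 0 \<le> t \<Longrightarrow> norm (E s x - E t x) \<le> L * \<bar>s - t\<bar>"
    and Et_bound: "0 \<le> t \<Longrightarrow> norm (Et t x) \<le> L"
    and D_linear: "0 \<le> t \<Longrightarrow> linear (D t x)"
    and D_bound: "0 \<le> t \<Longrightarrow> norm (D t x u) \<le> K * norm u"
    and D_lipschitz: "0 \<le> s \<Longrightarrow> 0 \<le> t \<Longrightarrow>
       norm (D s x u - D t x' u) \<le> L * (\<bar>s - t\<bar> + norm (x - x')) * norm u"
    and taylor: "0 \<le> s \<Longrightarrow> 0 \<le> t \<Longrightarrow>
       norm (E s x' - E t x - (s - t) *\<^sub>R Et t x - D t x (x' - x)) \<le> L * ((s - t)\<^sup>2 + (norm (x' - x))\<^sup>2)"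
begin

lemma L_pos: "0 < L" using one_le_L by simp

lemma L_le_sq: "L \<le> L\<^sup>2" using one_le_L by (simp add: self_le_power)

lemma K_sq: "K * L \<le> L\<^sup>2"
  using K_le_L L_pos by (simp add: power2_eq_square)

lemma E_lipschitz_le:
  assumes "0 \<le> t" "norm (x - x') \<le> r"
  shows "norm (E t x - E t x') \<le> K * r"
  using E_lipschitz[OF assms(1), of x x'] mult_left_mono[OF assms(2) K_nonneg] by linarith

lemma E_diff_bound:
  assumes "0 \<le> s" "0 \<le> t"
  shows "norm (E s x - E t x') \<le> L * \<bar>s - t\<bar> + K * norm (x - x')"
proof -
  have "norm ((E s x - E t x) + (E t x - E t x')) \<le> L * \<bar>s - t\<bar> + K * norm (x - x')"
    using assms by (intro order_trans[OF norm_triangle_ineq] add_mono E_lipschitz E_lipschitz_time)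
  then show ?thesis by simp
qed

end

lemma norm_i_mult: "norm (\<i> * z) = norm z" by (simp add: norm_mult)

lemma norm_position_diff_le: "norm ((y + \<i> * w) - (y' + \<i> * w')) \<le> norm (y - y') + norm (w - w')"
proof -
  have "(y + \<i> * w) - (y' + \<i> * w') = (y - y') + \<i> * (w - w')" by (simp add: algebra_simps)
  then have "norm ((y + \<i> * w) - (y' + \<i> * w')) \<le> norm (y - y') + norm (\<i> * (w - w'))"
    by (simp only: norm_triangle_ineq)
  then show ?thesis by (simp only: norm_i_mult)
qed

lemma norm_weighted_stages:
  fixes z z' :: complex
  assumes "norm z \<le> p" "norm z' \<le> q"
  shows "norm (of_real (1 - \<gamma>) * z + of_real \<gamma> * z') \<le> p + q / 3"
proof -
  have "norm (of_real (1 - \<gamma>) * z + of_real \<gamma> * z') \<le> (1 - \<gamma>) * norm z + \<gamma> * norm z'"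
  proof -
    have a: "\<bar>1 - \<gamma>\<bar> = 1 - \<gamma>" "\<bar>\<gamma>\<bar> = \<gamma>" using gamma_bounds by auto
    show ?thesis using norm_triangle_ineq[of "of_real (1 - \<gamma>) * z" "of_real \<gamma> * z'"]
      by (simp only: norm_mult norm_of_real a)
  qed
  also have "\<dots> \<le> 1 * p + (1/3) * q"
    using assms gamma_bounds by (intro add_mono mult_mono) auto
  finally show ?thesis by simp
qed

text \<open>Steps need not be small compared with \<open>1 / K\<close>, so polynomial amplification factors have to be absorbed too.\<close>
lemma one_plus_exp_bound:
  fixes k c :: real assumes "0 \<le> k" "0 \<le> c"
  shows "1 + c * k * (1 + k) ^ 3 \<le> exp ((c + 3) * k)"
proof -
  have e: "(1 + k) ^ 3 \<le> exp (3 * k)"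
    using power_mono[of "1 + k" "exp k" 3] assms exp_ge_add_one_self[of k]
    by (simp add: exp_of_nat_mult[symmetric])
  have "1 + c * k * (1 + k) ^ 3 \<le> exp (3 * k) + c * k * exp (3 * k)"
    using assms e by (intro add_mono mult_left_mono) auto
  also have "\<dots> = (1 + c * k) * exp (3 * k)" by (simp add: algebra_simps)
  also have "\<dots> \<le> exp (c * k) * exp (3 * k)" by (intro mult_right_mono) auto
  finally show ?thesis by (simp add: exp_add[symmetric] algebra_simps)
qed

lemma discrete_gronwall:
  fixes d :: "nat \<Rightarrow> real"
  assumes step: "\<And>n. d (Suc n) \<le> exp b * d n + r" and b: "0 \<le> b" and r: "0 \<le> r"
  shows "d n \<le> exp (b * real n) * (d 0 + r * real n)"
proof (induction n)
  case (Suc n)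
  have e: "exp (b * real (Suc n)) = exp b * exp (b * real n)"
    by (simp add: exp_add[symmetric] algebra_simps)
  have "d (Suc n) \<le> exp b * (exp (b * real n) * (d 0 + r * real n)) + r"
    using step[of n] Suc by (smt (verit) exp_ge_zero mult_left_mono)
  also have "\<dots> = exp (b * real (Suc n)) * (d 0 + r * real n) + 1 * r"
    unfolding e by simp
  also have "\<dots> \<le> exp (b * real (Suc n)) * (d 0 + r * real n) + exp (b * real (Suc n)) * r"
    using b r by (intro add_left_mono mult_right_mono) auto
  finally show ?case by (simp add: algebra_simps)
qed simp

locale scheme = smooth_field +
  fixes \<epsilon> h :: real
  assumes eps: "0 < \<epsilon>" and h: "0 < h"
begin

lemma node_bounds: "0 \<le> h / (2 * \<gamma>)" "h / (2 * \<gamma>) \<le> 2 * h"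
proof -
  have "h / (2 * \<gamma>) = h * (2 - \<gamma>)" using inverse_two_gamma by (metis times_divide_eq_right mult.right_neutral)
  then show "0 \<le> h / (2 * \<gamma>)" "h / (2 * \<gamma>) \<le> 2 * h"
    using h gamma_bounds by (auto simp: mult.commute[of h] intro!: mult_nonneg_nonneg)
qed

text \<open>The linear part of the update of \<open>w\<close> has norm at most 1 in the form given by \<open>next_w_propagator\<close>; every
other dependence on the data passes through the field and carries a factor \<open>h K\<close>. Intermediate
quantities may still grow by powers of \<open>q = 1 + h K\<close>.\<close>
lemma step_stability:
  fixes y y' w w' :: complex
  assumes t: "0 \<le> t"
  defines "d \<equiv> norm (y - y') + norm (w - w')"
  shows "norm (next_y E \<epsilon> h t y w - next_y E \<epsilon> h t y' w')
       + norm (next_w E \<epsilon> h t y w - next_w E \<epsilon> h t y' w') \<le> exp (46 * K * h) * d"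
proof -
  define k where "k = h * K"
  define q where "q = 1 + k"
  have k: "0 \<le> k" using h K_nonneg by (simp add: k_def)
  have q: "1 \<le> q" using k by (simp add: q_def)
  have kq: "k \<le> q" by (simp add: q_def)
  have d: "0 \<le> d" by (simp add: d_def)
  have q2: "q \<le> q\<^sup>2" "1 \<le> q\<^sup>2" and q3: "q\<^sup>2 \<le> q^3" "q \<le> q^3" "1 \<le> q^3"
    using q by (auto simp: self_le_power intro: power_increasing one_le_power)
  have qd: "d \<le> q * d" "q * d \<le> q\<^sup>2 * d" "q\<^sup>2 * d \<le> q^3 * d"
    using mult_right_mono[OF q d] mult_right_mono[OF q2(1) d] mult_right_mono[OF q3(1) d] by auto
  define a where "a = 1 + of_real \<gamma> * imu \<epsilon> h"
  note a1 = norm_divide_implicit[OF eps h, folded a_def]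
  let ?c = "h / (2 * \<gamma>)"
  define e e' where "e = E t (y + \<i> * w)" and "e' = E t (y' + \<i> * w')"
  define wt wt' where "wt = stage_w E \<epsilon> h t y w" and "wt' = stage_w E \<epsilon> h t y' w'"
  define yh yh' where "yh = hat_y E \<epsilon> h t y w" and "yh' = hat_y E \<epsilon> h t y' w'"
  define wh wh' where "wh = hat_w E \<epsilon> h t y w" and "wh' = hat_w E \<epsilon> h t y' w'"
  define wn wn' where "wn = next_w E \<epsilon> h t y w" and "wn' = next_w E \<epsilon> h t y' w'"
  define e1 e1' where "e1 = E t (y + \<i> * wt)" and "e1' = E t (y' + \<i> * wt')"
  define eh eh' where "eh = E (t + ?c) (yh + \<i> * wh)" and "eh' = E (t + ?c) (yh' + \<i> * wh')"
  define e2 e2' where "e2 = E (t + ?c) (yh + \<i> * wn)" and "e2' = E (t + ?c) (yh' + \<i> * wn')"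
  have tc: "0 \<le> t + ?c" using t node_bounds by simp
  have dy: "norm (y - y') \<le> d" and dw: "norm (w - w') \<le> d" by (auto simp: d_def)
  have 1: "norm (e - e') \<le> K * d"
    unfolding e_def e'_def d_def by (intro E_lipschitz_le t norm_position_diff_le)
  have 2: "norm (wt - wt') \<le> q * d"
  proof -
    have "wt - wt' = ((w - w') + of_real (\<gamma> * h) * (e - e')) / a"
      by (simp add: wt_def wt'_def stage_w_def a_def e_def e'_def algebra_simps flip: diff_divide_distrib)
    then have "norm (wt - wt') \<le> norm (w - w') + norm (of_real (\<gamma> * h) * (e - e'))"
      using a1 norm_triangle_ineq order_trans by metis
    also have "\<dots> \<le> d + (\<gamma> * h) * (K * d)"
      unfolding norm_mult norm_of_real using 1 dw h gamma_pos by (intro add_mono mult_mono) auto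
    also have "(\<gamma> * h) * (K * d) \<le> (1 * h) * (K * d)"
      using gamma_bounds h K_nonneg d by (intro mult_right_mono) auto
    finally show ?thesis by (simp add: q_def k_def algebra_simps)
  qed
  have 3: "norm (e1 - e1') \<le> K * (2 * (q * d))"
    unfolding e1_def e1'_def using 2 dy qd
    by (intro E_lipschitz_le t order_trans[OF norm_position_diff_le]) linarith
  have 4: "norm (yh - yh') \<le> 5 * (q\<^sup>2 * d)"
  proof -
    have "yh - yh' = (y - y') - \<i> * of_real ?c * (e1 - e1')"
      by (simp add: yh_def yh'_def hat_y_def e1_def e1'_def wt_def wt'_def algebra_simps)
    then have "norm (yh - yh') \<le> norm (y - y') + norm (\<i> * of_real ?c * (e1 - e1'))"
      using norm_triangle_ineq4 by metis
    also have "\<dots> = norm (y - y') + ?c * norm (e1 - e1')"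
      using node_bounds(1) by (simp only: norm_mult norm_of_real abs_of_nonneg) simp
    also have "\<dots> \<le> d + (2 * h) * (K * (2 * (q * d)))"
      using 3 dy node_bounds h by (intro add_mono mult_mono) auto
    also have "\<dots> = d + 4 * k * (q * d)" by (simp add: k_def)
    also have "\<dots> \<le> q\<^sup>2 * d + 4 * q * (q * d)"
      using qd kq q d by (intro add_mono mult_right_mono mult_left_mono) auto
    finally show ?thesis by (simp add: power2_eq_square mult_ac)
  qed
  have 5: "norm (wh - wh') \<le> 13 * (q\<^sup>2 * d)"
  proof -
    have g: "norm (of_real (1 / (2 * \<gamma>\<^sup>2)) :: complex) \<le> 6"
    proof -
      have "1 / (2 * \<gamma>\<^sup>2) = 2 * (1 / (2 * \<gamma>))\<^sup>2"
        by (simp add: power2_eq_square)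
      also have "\<dots> = 2 * (2 - \<gamma>)\<^sup>2" unfolding inverse_two_gamma ..
      also have "\<dots> = 8 - 4 * \<gamma> - 2 * (\<gamma> * (2 - \<gamma>))" by (simp add: power2_eq_square algebra_simps)
      also have "\<dots> = 7 - 4 * \<gamma>" unfolding gamma_quadratic by simp
      finally have "1 / (2 * \<gamma>\<^sup>2) = 7 - 4 * \<gamma>" .
      then show ?thesis unfolding norm_of_real using gamma_bounds by simp
    qed
    have i: "hat_w E \<epsilon> h t y w - w = of_real (1 / (2 * \<gamma>\<^sup>2)) * (stage_w E \<epsilon> h t y w - w)" for y w
      unfolding hat_w_increment[OF eps h] stage_w_increment[OF eps h]
      using gamma_pos by (simp add: power2_eq_square)
    have "wh - wh' = (w - w') + of_real (1 / (2 * \<gamma>\<^sup>2)) * ((wt - wt') - (w - w'))"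
    proof -
      have "wh - wh' = (w - w') + ((wh - w) - (wh' - w'))" by simp
      also have "\<dots> = (w - w') + (of_real (1 / (2 * \<gamma>\<^sup>2)) * (wt - w) - of_real (1 / (2 * \<gamma>\<^sup>2)) * (wt' - w'))"
        unfolding wh_def wh'_def i wt_def wt'_def ..
      also have "g * (a - b) - g * (a' - b') = g * ((a - a') - (b - b'))" for g a b a' b' :: complex
        by (simp add: algebra_simps)
      finally show ?thesis .
    qed
    then have "norm (wh - wh') \<le> norm (w - w') + norm (of_real (1 / (2 * \<gamma>\<^sup>2)) * ((wt - wt') - (w - w')))"
      using norm_triangle_ineq by metis
    also have "\<dots> \<le> d + 6 * (q * d + d)"
    proof -
      have "norm ((wt - wt') - (w - w')) \<le> q * d + d"
        using 2 dw norm_triangle_ineq4[of "wt - wt'" "w - w'"] by linarith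
      then show ?thesis unfolding norm_mult using dw g by (intro add_mono mult_mono) auto
    qed
    also have "\<dots> \<le> 13 * (q\<^sup>2 * d)" unfolding distrib_left using qd by linarith
    finally show ?thesis .
  qed
  have 6: "norm (eh - eh') \<le> K * (18 * (q\<^sup>2 * d))"
    unfolding eh_def eh'_def using 4 5 
    by (intro E_lipschitz_le tc order_trans[OF norm_position_diff_le]) linarith
  have 7: "norm (wn - wn') \<le> norm (w - w') + 19 * k * (q\<^sup>2 * d)"
  proof -
    let ?R = "(1 - of_real (1 - 2 * \<gamma>) * imu \<epsilon> h) / a\<^sup>2"
    have "wn - wn' = ?R * (w - w') + of_real h * (of_real (1 - \<gamma>) * ((e - e') / a) + of_real \<gamma> * (eh - eh')) / a"
      unfolding wn_def wn'_def next_w_propagator[OF eps h] e_def e'_def a_def eh_def eh'_def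
        yh_def yh'_def wh_def wh'_def
      by (simp add: diff_divide_distrib add_divide_distrib algebra_simps)
    then have "norm (wn - wn') \<le> norm (?R * (w - w'))
        + norm (of_real h * (of_real (1 - \<gamma>) * ((e - e') / a) + of_real \<gamma> * (eh - eh')) / a)"
      using norm_triangle_ineq by metis
    also have "norm (?R * (w - w')) \<le> 1 * norm (w - w')"
      unfolding norm_mult using norm_stability_factor[OF eps h] by (intro mult_right_mono) (auto simp: a_def)
    also have "norm (of_real h * (of_real (1 - \<gamma>) * ((e - e') / a) + of_real \<gamma> * (eh - eh')) / a)
       \<le> norm (of_real h * (of_real (1 - \<gamma>) * ((e - e') / a) + of_real \<gamma> * (eh - eh')))"
      by (rule a1)
    also have "\<dots> \<le> h * (K * d + (K * (18 * (q\<^sup>2 * d))) / 3)"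
      unfolding norm_mult[of "of_real h"] using h 1 6 
      by (intro mult_mono norm_weighted_stages order_trans[OF a1]) auto
    also have "\<dots> = k * d + 6 * k * (q\<^sup>2 * d)" by (simp add: k_def algebra_simps)
    also have "\<dots> \<le> k * (q\<^sup>2 * d) + 18 * k * (q\<^sup>2 * d)"
      using qd k d by (intro add_mono mult_left_mono mult_right_mono) auto
    finally show ?thesis by (simp add: algebra_simps)
  qed
  have 8: "norm (e2 - e2') \<le> K * (25 * (q^3 * d))"
  proof -
    have "k * (q\<^sup>2 * d) \<le> q * (q\<^sup>2 * d)" using kq d by (intro mult_right_mono) auto
    then have "19 * k * (q\<^sup>2 * d) \<le> 19 * (q^3 * d)" by (simp add: power3_eq_cube power2_eq_square mult.assoc)
    then show ?thesis
      unfolding e2_def e2'_def using 4 7 dw qd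
      by (intro E_lipschitz_le tc order_trans[OF norm_position_diff_le]) linarith
  qed
  have 9: "norm (next_y E \<epsilon> h t y w - next_y E \<epsilon> h t y' w') \<le> norm (y - y') + 24 * k * (q^3 * d)"
  proof -
    have eq: "next_y E \<epsilon> h t y w - next_y E \<epsilon> h t y' w'
       = (y - y') - \<i> * (of_real h * (of_real (1 - \<gamma>) * (e1 - e1') + of_real \<gamma> * (e2 - e2')))"
      by (simp add: next_y_def e1_def e1'_def e2_def e2'_def yh_def yh'_def wn_def wn'_def wt_def wt'_def algebra_simps)
    have "norm (of_real (1 - \<gamma>) * (e1 - e1') + of_real \<gamma> * (e2 - e2'))
       \<le> K * (2 * (q * d)) + (K * (25 * (q^3 * d))) / 3"
      by (intro norm_weighted_stages 3 8)
    then have "norm (\<i> * (of_real h * (of_real (1 - \<gamma>) * (e1 - e1') + of_real \<gamma> * (e2 - e2'))))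
       \<le> h * (K * (2 * (q * d)) + (K * (25 * (q^3 * d))) / 3)"
      unfolding norm_mult[of "\<i>"] norm_mult[of "of_real h"] using h by (auto intro!: mult_left_mono)
    also have "\<dots> = 2 * k * (q * d) + 25/3 * k * (q^3 * d)" by (simp add: k_def algebra_simps)
    also have "\<dots> \<le> 2 * k * (q^3 * d) + 22 * k * (q^3 * d)"
      using q3 k q d by (intro add_mono mult_left_mono mult_right_mono) auto
    finally show ?thesis unfolding eq 
      by (intro order_trans[OF norm_triangle_ineq4]) (simp add: algebra_simps)
  qed
  have "norm (next_y E \<epsilon> h t y w - next_y E \<epsilon> h t y' w') + norm (wn - wn')
      \<le> norm (y - y') + norm (w - w') + 24 * k * (q^3 * d) + 19 * k * (q\<^sup>2 * d)"
    using 9 7 by linarith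
  also have "\<dots> \<le> d + 24 * k * (q^3 * d) + 19 * k * (q^3 * d)"
    unfolding d_def[symmetric] using qd k q by (intro add_mono mult_left_mono) auto
  also have "\<dots> = (1 + 43 * k * (1 + k)^3) * d" by (simp add: q_def algebra_simps)
  also have "\<dots> \<le> exp ((43 + 3) * k) * d"
    using one_plus_exp_bound[of k 43] k d by (intro mult_right_mono) auto
  finally show ?thesis by (simp add: wn_def wn'_def k_def mult_ac)
qed

end

section \<open>Exact trajectories\<close>

lemma norm_increment_le:
  fixes f :: "real \<Rightarrow> 'a::real_normed_vector"
  assumes "0 \<le> r" and "\<And>s. 0 \<le> s \<Longrightarrow> s \<le> r \<Longrightarrow> (f has_vector_derivative f' s) (at s within {0..r})"
    and "\<And>s. 0 \<le> s \<Longrightarrow> s \<le> r \<Longrightarrow> norm (f' s) \<le> B"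
  shows "norm (f r - f 0) \<le> r * B"
proof -
  have "norm (f r - f 0) \<le> B * norm (r - 0)"
  proof (rule differentiable_bound[where S = "{0..r}" and f' = "\<lambda>s h. h *\<^sub>R f' s"])
    fix s assume s: "s \<in> {0..r}"
    then show "(f has_derivative (\<lambda>h. h *\<^sub>R f' s)) (at s within {0..r})"
      using assms(2)[of s] by (simp add: has_vector_derivative_def)
    have "onorm (\<lambda>h. h *\<^sub>R f' s) \<le> norm (f' s)"
      by (rule onorm_bound) (auto simp: mult.commute)
    then show "onorm (\<lambda>h. h *\<^sub>R f' s) \<le> B" using assms(3)[of s] s by auto
  qed (use assms(1) in auto)
  then show ?thesis using assms(1) by (simp add: mult.commute)
qed

text \<open>The norm is not differentiable at 0; the proof works with \<open>sqrt (norm (q t)\<^sup>2 + \<delta>\<^sup>2)\<close> and a small \<open>\<delta>\<close>.\<close>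
lemma gronwall_norm:
  fixes q :: "real \<Rightarrow> 'a::real_inner"
  assumes der: "\<And>t. 0 \<le> t \<Longrightarrow> (q has_vector_derivative q' t) (at t within {0..})"
    and bound: "\<And>t. 0 \<le> t \<Longrightarrow> norm (q' t) \<le> K * norm (q t) + b"
    and K: "0 \<le> K" and b: "0 \<le> b" and t: "0 \<le> t"
  shows "norm (q t) \<le> exp (K * t) * (norm (q 0) + b * t)"
proof (rule field_le_epsilon)
  fix e :: real assume e: "0 < e"
  define \<delta> where "\<delta> = e * exp (- (K * t))"
  have \<delta>: "0 < \<delta>" using e by (simp add: \<delta>_def)
  define g where "g = (\<lambda>s. sqrt ((norm (q s))\<^sup>2 + \<delta>\<^sup>2))"
  define \<psi> where "\<psi> = (\<lambda>s. g s * exp (- (K * s)) - b * s)"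
  have g0: "0 < g s" for s using \<delta> by (auto simp: g_def intro: add_nonneg_pos)
  have gq: "norm (q s) \<le> g s" for s by (simp add: g_def real_le_rsqrt)
  have cont: "continuous_on {0..t} q"
    unfolding continuous_on_eq_continuous_within
  proof
    fix s assume s: "s \<in> {0..t}"
    have "continuous (at s within {0..}) q"
      by (rule has_vector_derivative_continuous[OF der]) (use s in auto)
    then show "continuous (at s within {0..t}) q" by (rule continuous_within_subset) auto
  qed
  have "\<psi> t \<le> \<psi> 0"
  proof (rule DERIV_nonpos_imp_decreasing_open[OF t])
    show "continuous_on {0..t} \<psi>"
      unfolding \<psi>_def g_def by (intro continuous_intros cont)
    fix s assume s: "0 < s" "s < t"
    have "(q has_vector_derivative q' s) (at s)"
      using der[of s] s by (simp add: at_within_interior[of s "{0..}"])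
    then have "(q has_derivative (\<lambda>h. h *\<^sub>R q' s)) (at s)" by (simp add: has_vector_derivative_def)
    then have "((\<lambda>s. inner (q s) (q s)) has_derivative (\<lambda>h. inner (q s) (h *\<^sub>R q' s) + inner (h *\<^sub>R q' s) (q s))) (at s)"
      by (rule has_derivative_inner) fact
    then have "((\<lambda>s. (norm (q s))\<^sup>2) has_real_derivative 2 * inner (q s) (q' s)) (at s)"
      by (simp add: has_field_derivative_def power2_norm_eq_inner inner_commute mult.commute[of _ 2] mult.left_commute fun_eq_iff
          flip: mult_2) (erule has_derivative_eq_rhs; simp add: fun_eq_iff)
    then have "(g has_real_derivative inner (q s) (q' s) / g s) (at s)"
    proof -
      define N where "N s = (norm (q s))\<^sup>2" for s
      assume "((\<lambda>s. (norm (q s))\<^sup>2) has_real_derivative 2 * inner (q s) (q' s)) (at s)"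
      then have N: "(N has_real_derivative 2 * inner (q s) (q' s)) (at s)" by (simp add: N_def[abs_def])
      have "0 < N s + \<delta>\<^sup>2" using \<delta> by (simp add: N_def add_nonneg_pos)
      then show ?thesis unfolding g_def N_def[symmetric]
        by (auto intro!: derivative_eq_intros N simp: field_simps)
    qed
    then have d: "(\<psi> has_real_derivative inner (q s) (q' s) / g s * exp (- (K * s)) - g s * K * exp (- (K * s)) - b) (at s)"
      unfolding \<psi>_def by (auto intro!: derivative_eq_intros)
    have "inner (q s) (q' s) \<le> norm (q s) * norm (q' s)" by (rule norm_cauchy_schwarz)
    also have "\<dots> \<le> g s * norm (q' s)" by (intro mult_right_mono gq) auto
    also have "\<dots> \<le> g s * (K * g s + b)"
      using bound[of s] s gq[of s] K g0[of s] mult_left_mono[OF gq[of s] K]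
      by (intro mult_left_mono) auto
    finally have "inner (q s) (q' s) / g s \<le> K * g s + b"
      using g0[of s] by (simp add: divide_le_eq mult.commute)
    then have "inner (q s) (q' s) / g s * exp (- (K * s)) \<le> (K * g s + b) * exp (- (K * s))"
      by (intro mult_right_mono) auto
    also have "\<dots> \<le> g s * K * exp (- (K * s)) + b * 1"
      using b K s unfolding distrib_right by (intro add_mono mult_left_mono) auto
    finally show "\<exists>y. (\<psi> has_real_derivative y) (at s) \<and> y \<le> 0" using d by fastforce
  qed
  then have "g t * exp (- (K * t)) \<le> g 0 + b * t" by (simp add: \<psi>_def)
  also have "g 0 \<le> norm (q 0) + \<delta>"
    unfolding g_def using sqrt_sum_squares_le_sum_abs[of "norm (q 0)" \<delta>] \<delta> by simp
  finally have "exp (K * t) * (g t * exp (- (K * t))) \<le> exp (K * t) * (norm (q 0) + \<delta> + b * t)"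
    by (intro mult_left_mono) auto
  then have "g t \<le> exp (K * t) * (norm (q 0) + b * t) + e"
  proof -
    have "exp (K * t) * exp (- (K * t)) = 1" by (simp flip: exp_add)
    then have e1: "exp (K * t) * (g t * exp (- (K * t))) = g t" and e2: "exp (K * t) * \<delta> = e"
      by (metis mult.assoc mult.commute mult.right_neutral, metis \<delta>_def mult.left_commute mult.right_neutral)
    assume "exp (K * t) * (g t * exp (- (K * t))) \<le> exp (K * t) * (norm (q 0) + \<delta> + b * t)"
    then have "g t \<le> exp (K * t) * (norm (q 0) + \<delta> + b * t)" unfolding e1 .
    then show ?thesis by (simp add: distrib_left e2)
  qed
  then show "norm (q t) \<le> exp (K * t) * (norm (q 0) + b * t) + e" using gq[of t] by linarith
qed

context smooth_field begin

lemma D_scaleR: "0 \<le> t \<Longrightarrow> D t x (r *\<^sub>R u) = r *\<^sub>R D t x u"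
  using D_linear linear_cmul by blast

lemma D_add: "0 \<le> t \<Longrightarrow> D t x (u + v) = D t x u + D t x v"
  using D_linear linear_add by blast

lemma D_diff: "0 \<le> t \<Longrightarrow> D t x (u - v) = D t x u - D t x v"
  using D_linear linear_diff by blast

lemma D_minus: "0 \<le> t \<Longrightarrow> D t x (- u) = - D t x u"
  using D_linear linear_neg by blast

lemma D_bound_L: "0 \<le> t \<Longrightarrow> norm (D t x u) \<le> L * norm u"
  using D_bound[of t x u] K_le_L mult_right_mono[of K L "norm u"] by simp

text \<open>The chain rule, directly from the quadratic Taylor bound.\<close>
lemma field_along_path:
  assumes t: "0 \<le> t" and x: "(x has_vector_derivative x') (at t within {0..})"
  shows "((\<lambda>s. E s (x s)) has_vector_derivative (Et t (x t) + D t (x t) x')) (at t within {0..})"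
proof -
  define R where "R s = E s (x s) - E t (x t) - (s - t) *\<^sub>R Et t (x t) - D t (x t) (x s - x t)" for s
  define G where "G s = L * ((s - t)\<^sup>2 + (norm (x s - x t))\<^sup>2)" for s
  have xd: "((\<lambda>s. x s - x t) has_derivative (\<lambda>h. h *\<^sub>R x')) (at t within {0..})"
    using x by (auto simp: has_vector_derivative_def intro!: derivative_eq_intros)
  have "((\<lambda>s. inner (x s - x t) (x s - x t)) has_derivative
      (\<lambda>h. inner (x t - x t) (h *\<^sub>R x') + inner (h *\<^sub>R x') (x t - x t))) (at t within {0..})"
    by (rule has_derivative_inner[OF xd xd])
  then have i: "((\<lambda>s. (norm (x s - x t))\<^sup>2) has_derivative (\<lambda>h. 0)) (at t within {0..})"
    by (simp add: power2_norm_eq_inner)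
  have "(G has_derivative (\<lambda>h. 0)) (at t within {0..})"
  proof -
    define N where "N s = (norm (x s - x t))\<^sup>2" for s
    have N: "(N has_derivative (\<lambda>h. 0)) (at t within {0..})" using i by (simp add: N_def[abs_def])
    show ?thesis unfolding G_def N_def[symmetric] by (auto intro!: derivative_eq_intros N)
  qed
  then have Gl: "((\<lambda>s. norm (G s - G t) / norm (s - t)) \<longlongrightarrow> 0) (at t within {0..})"
    by (simp add: has_derivative_iff_norm)
  have G0: "G t = 0" by (simp add: G_def)
  have RG: "norm (R s) \<le> norm (G s)" if "0 \<le> s" for s
    unfolding R_def G_def using taylor[OF that t, of "x s" "x t"] L_pos by simp
  have R0: "R t = 0" using D_linear[OF t] by (simp add: R_def linear_0)
  have "((\<lambda>s. norm (R s - R t) / norm (s - t)) \<longlongrightarrow> 0) (at t within {0..})"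
  proof (rule tendsto_sandwich[OF _ _ tendsto_const Gl])
    show "\<forall>\<^sub>F s in at t within {0..}. 0 \<le> norm (R s - R t) / norm (s - t)" by simp
    show "\<forall>\<^sub>F s in at t within {0..}. norm (R s - R t) / norm (s - t) \<le> norm (G s - G t) / norm (s - t)"
      unfolding eventually_at_filter using RG
      by (intro always_eventually) (auto simp: R0 G0 intro!: divide_right_mono)
  qed
  then have Rd: "(R has_derivative (\<lambda>h. 0)) (at t within {0..})"
    by (simp add: has_derivative_iff_norm)
  have bl: "bounded_linear (D t (x t))"
    using D_linear[OF t] by (simp add: linear_conv_bounded_linear)
  have "((\<lambda>s. E t (x t) + (s - t) *\<^sub>R Et t (x t) + D t (x t) (x s - x t) + R s) has_derivative
      (\<lambda>h. 0 + h *\<^sub>R Et t (x t) + D t (x t) (h *\<^sub>R x') + 0)) (at t within {0..})"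
    by (intro has_derivative_add has_derivative_const Rd bounded_linear.has_derivative[OF bl xd])
       (auto intro!: derivative_eq_intros)
  moreover have "(\<lambda>s. E t (x t) + (s - t) *\<^sub>R Et t (x t) + D t (x t) (x s - x t) + R s) = (\<lambda>s. E s (x s))"
    by (simp add: R_def)
  ultimately show ?thesis
    by (simp add: has_vector_derivative_def D_scaleR[OF t] scaleR_add_right)
qed

text \<open>The characteristic system in the variables \<open>y = x - \<i> \<epsilon> v\<close> and \<open>w = \<epsilon> v\<close>.\<close>
definition exact :: "real \<Rightarrow> (real \<Rightarrow> complex) \<Rightarrow> (real \<Rightarrow> complex) \<Rightarrow> bool" where
  "exact \<epsilon> y w \<longleftrightarrow> (\<forall>t\<ge>0.
     (y has_vector_derivative - \<i> * E t (y t + \<i> * w t)) (at t within {0..}) \<and>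
     (w has_vector_derivative E t (y t + \<i> * w t) - \<i> * w t / of_real (\<epsilon>\<^sup>2)) (at t within {0..}))"

context
  fixes \<epsilon> :: real and y w :: "real \<Rightarrow> complex"
  assumes eps: "0 < \<epsilon>" and ex: "exact \<epsilon> y w"
begin

lemma exact_y: "0 \<le> t \<Longrightarrow> (y has_vector_derivative - \<i> * E t (y t + \<i> * w t)) (at t within {0..})"
  and exact_w: "0 \<le> t \<Longrightarrow> (w has_vector_derivative E t (y t + \<i> * w t) - \<i> * w t / of_real (\<epsilon>\<^sup>2)) (at t within {0..})"
  using ex by (auto simp: exact_def)

lemma exact_x: 
  assumes "0 \<le> t"
  shows "((\<lambda>t. y t + \<i> * w t) has_vector_derivative w t / of_real (\<epsilon>\<^sup>2)) (at t within {0..})"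
proof -
  have "((\<lambda>t. y t + \<i> * w t) has_vector_derivative - \<i> * E t (y t + \<i> * w t)
     + \<i> * (E t (y t + \<i> * w t) - \<i> * w t / of_real (\<epsilon>\<^sup>2))) (at t within {0..})"
    by (intro has_vector_derivative_add exact_y exact_w assms has_vector_derivative_mult_right)
  then show ?thesis by (simp add: algebra_simps)
qed

text \<open>The distance \<open>z\<close> to the equilibrium satisfies \<open>z' = - \<i> z / \<epsilon>\<^sup>2 + \<i> \<epsilon>\<^sup>2 e'\<close>, where \<open>e\<close> is the field along the
trajectory. In the rotating frame \<open>q\<close> the first term disappears, and \<open>x' = w / \<epsilon>\<^sup>2\<close> bounds \<open>\<epsilon>\<^sup>2 e'\<close> by \<open>K\<close> times the
norm of \<open>w\<close>, up to terms of order \<open>\<epsilon>\<^sup>2\<close>.\<close>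
lemma exact_w_bound:
  assumes t: "0 \<le> t"
  shows "norm (w t) \<le> exp (K * t) * (norm (w 0) + 4 * L\<^sup>2 * \<epsilon>\<^sup>2 * (1 + t))"
proof -
  define e where "e = (\<lambda>s. E s (y s + \<i> * w s))"
  define e' where "e' = (\<lambda>s. Et s (y s + \<i> * w s) + D s (y s + \<i> * w s) (w s / of_real (\<epsilon>\<^sup>2)))"
  define z where "z = (\<lambda>s. w s + \<i> * of_real (\<epsilon>\<^sup>2) * e s)"
  define q where "q = (\<lambda>s. cis (s / \<epsilon>\<^sup>2) * z s)"
  have nq: "norm (q s) = norm (z s)" for s by (simp add: q_def norm_mult)
  have eb: "norm (e s) \<le> L" if "0 \<le> s" for s using E_bound[OF that] by (simp add: e_def)
  have zw: "norm (\<i> * of_real (\<epsilon>\<^sup>2) * e s) \<le> \<epsilon>\<^sup>2 * L" if "0 \<le> s" for s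
    using eb[OF that] by (simp add: norm_mult norm_power mult_left_mono)
  have wz: "norm (w s) \<le> norm (z s) + \<epsilon>\<^sup>2 * L" if "0 \<le> s" for s
    using zw[OF that] norm_triangle_ineq4[of "z s" "\<i> * of_real (\<epsilon>\<^sup>2) * e s"] by (simp add: z_def)
  have der: "(q has_vector_derivative cis (s / \<epsilon>\<^sup>2) * (\<i> * of_real (\<epsilon>\<^sup>2) * e' s)) (at s within {0..})"
    if s: "0 \<le> s" for s
  proof -
    have de: "(e has_vector_derivative e' s) (at s within {0..})"
      unfolding e_def e'_def by (rule field_along_path[OF s exact_x[OF s]])
    have dz: "(z has_vector_derivative (e s - \<i> * w s / of_real (\<epsilon>\<^sup>2)) + \<i> * of_real (\<epsilon>\<^sup>2) * e' s) (at s within {0..})"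
      unfolding z_def by (intro has_vector_derivative_add has_vector_derivative_mult_right de)
        (use exact_w[OF s] in \<open>simp add: e_def\<close>)
    have dc: "((\<lambda>s. cis (s / \<epsilon>\<^sup>2)) has_vector_derivative (1 / \<epsilon>\<^sup>2) *\<^sub>R (\<i> * cis (s / \<epsilon>\<^sup>2))) (at s within {0..})"
    proof -
      have "((\<lambda>s. cis (s / \<epsilon>\<^sup>2)) has_derivative (\<lambda>h. (h / \<epsilon>\<^sup>2) *\<^sub>R (\<i> * cis (s / \<epsilon>\<^sup>2)))) (at s within {0..})"
      proof (rule has_derivative_cis)
        have "((\<lambda>s. s * inverse (\<epsilon>\<^sup>2)) has_derivative (\<lambda>h. h * inverse (\<epsilon>\<^sup>2))) (at s within {0..})"
          by (intro has_derivative_mult_left has_derivative_ident)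
        then show "((\<lambda>s. s / \<epsilon>\<^sup>2) has_derivative (\<lambda>h. h / \<epsilon>\<^sup>2)) (at s within {0..})"
          by (simp add: divide_inverse)
      qed
      then show ?thesis by (simp add: has_vector_derivative_def)
    qed
    have "(q has_vector_derivative cis (s / \<epsilon>\<^sup>2) * ((e s - \<i> * w s / of_real (\<epsilon>\<^sup>2)) + \<i> * of_real (\<epsilon>\<^sup>2) * e' s)
        + ((1 / \<epsilon>\<^sup>2) *\<^sub>R (\<i> * cis (s / \<epsilon>\<^sup>2))) * z s) (at s within {0..})"
      unfolding q_def by (rule has_vector_derivative_mult[OF dc dz])
    moreover have "cis (s / \<epsilon>\<^sup>2) * ((e s - \<i> * w s / of_real (\<epsilon>\<^sup>2)) + \<i> * of_real (\<epsilon>\<^sup>2) * e' s)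
        + ((1 / \<epsilon>\<^sup>2) *\<^sub>R (\<i> * cis (s / \<epsilon>\<^sup>2))) * z s = cis (s / \<epsilon>\<^sup>2) * (\<i> * of_real (\<epsilon>\<^sup>2) * e' s)"
      using eps by (simp add: z_def scaleR_conv_of_real field_simps)
    ultimately show ?thesis by simp
  qed
  have b: "norm (cis (s / \<epsilon>\<^sup>2) * (\<i> * of_real (\<epsilon>\<^sup>2) * e' s)) \<le> K * norm (q s) + 2 * L\<^sup>2 * \<epsilon>\<^sup>2" if s: "0 \<le> s" for s
  proof -
    have "norm (e' s) \<le> L + K * norm (w s / of_real (\<epsilon>\<^sup>2))"
      unfolding e'_def by (intro order_trans[OF norm_triangle_ineq] add_mono Et_bound D_bound s)
    then have "\<epsilon>\<^sup>2 * norm (e' s) \<le> \<epsilon>\<^sup>2 * (L + K * norm (w s / of_real (\<epsilon>\<^sup>2)))"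
      by (intro mult_left_mono) auto
    also have "\<dots> = \<epsilon>\<^sup>2 * L + K * norm (w s)" using eps by (simp add: norm_divide norm_power field_simps)
    also have "\<dots> \<le> \<epsilon>\<^sup>2 * L\<^sup>2 + K * (norm (z s) + \<epsilon>\<^sup>2 * L)"
      using wz[OF s] K_nonneg L_le_sq by (intro add_mono mult_left_mono) auto
    also have "\<dots> = K * norm (q s) + \<epsilon>\<^sup>2 * L\<^sup>2 + \<epsilon>\<^sup>2 * (K * L)" by (simp add: nq algebra_simps)
    also have "\<dots> \<le> K * norm (q s) + \<epsilon>\<^sup>2 * L\<^sup>2 + \<epsilon>\<^sup>2 * L\<^sup>2"
      using K_sq K_nonneg by (intro add_mono mult_left_mono) auto
    finally show ?thesis by (simp add: norm_mult norm_power)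
  qed
  have "norm (q t) \<le> exp (K * t) * (norm (q 0) + 2 * L\<^sup>2 * \<epsilon>\<^sup>2 * t)"
    by (rule gronwall_norm[OF der b K_nonneg _ t]) auto
  then have "norm (w t) \<le> exp (K * t) * (norm (z 0) + 2 * L\<^sup>2 * \<epsilon>\<^sup>2 * t) + 1 * (\<epsilon>\<^sup>2 * L)"
    using wz[OF t] unfolding nq by linarith
  also have "\<dots> \<le> exp (K * t) * ((norm (w 0) + \<epsilon>\<^sup>2 * L) + 2 * L\<^sup>2 * \<epsilon>\<^sup>2 * t) + exp (K * t) * (\<epsilon>\<^sup>2 * L)"
  proof (intro add_mono mult_left_mono mult_right_mono)
    show "norm (z 0) \<le> norm (w 0) + \<epsilon>\<^sup>2 * L" unfolding z_def
      using zw[of 0] norm_triangle_ineq order_trans add_left_mono by (metis order_refl)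
  qed (use K_nonneg t L_pos in auto)
  also have "\<dots> = exp (K * t) * (norm (w 0) + \<epsilon>\<^sup>2 * (2 * L + 2 * L\<^sup>2 * t))" by (simp add: algebra_simps)
  also have "\<dots> \<le> exp (K * t) * (norm (w 0) + \<epsilon>\<^sup>2 * (4 * L\<^sup>2 * (1 + t)))"
  proof (intro mult_left_mono add_left_mono)
    have "2 * L + 2 * L\<^sup>2 * t \<le> 4 * L\<^sup>2 + 4 * L\<^sup>2 * t"
      using L_le_sq L_pos t by (intro add_mono mult_right_mono) auto
    then show "2 * L + 2 * L\<^sup>2 * t \<le> 4 * L\<^sup>2 * (1 + t)" by (simp add: algebra_simps)
  qed auto
  finally show ?thesis by (simp add: algebra_simps)
qed

end

end

section \<open>Boundedness of the discrete velocity\<close>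

context scheme begin

abbreviation (input) drift :: "real \<Rightarrow> complex \<Rightarrow> complex \<Rightarrow> complex" where
  "drift t y w \<equiv> E t (y + \<i> * w) - \<i> * w / of_real (\<epsilon>\<^sup>2)"

lemma norm_h_mult: "norm (of_real h * z :: complex) = h * norm z"
  using h by (simp add: norm_mult)

lemma norm_gamma_h_mult: "norm (of_real (\<gamma> * h) * z :: complex) = \<gamma> * h * norm z"
  using h gamma_pos by (simp add: norm_mult)

lemma norm_gamma_h_le: "norm (of_real (\<gamma> * h) * z :: complex) \<le> h * norm z"
proof -
  have "\<gamma> * h * norm z \<le> 1 * h * norm z" using gamma_bounds h by (intro mult_right_mono) auto
  then show ?thesis unfolding norm_gamma_h_mult by simp
qed

lemma norm_node_mult: "norm (of_real (h / (2 * \<gamma>)) * z :: complex) \<le> 2 * h * norm z"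
proof -
  have "norm (of_real (h / (2 * \<gamma>)) * z :: complex) = h / (2 * \<gamma>) * norm z"
    using node_bounds(1) by (simp only: norm_mult norm_of_real abs_of_nonneg)
  then show ?thesis using node_bounds mult_right_mono[of "h / (2 * \<gamma>)" "2 * h" "norm z"] by simp
qed

lemma divide_implicit_near:
  fixes z :: complex
  shows "norm (z / (1 + of_real \<gamma> * imu \<epsilon> h) - z) \<le> norm z * (h / \<epsilon>\<^sup>2)"
proof -
  have "z / (1 + of_real \<gamma> * imu \<epsilon> h) - z = z * (1 / (1 + of_real \<gamma> * imu \<epsilon> h) - 1)"
    by (simp add: algebra_simps)
  then show ?thesis unfolding norm_mult
    using mult_left_mono[OF inverse_implicit_near_one[OF eps h], of "norm z"] by (simp add: norm_mult)
qed

lemma stage_w_diff: "norm (stage_w E \<epsilon> h t y w - w) \<le> h * norm (drift t y w)"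
  unfolding stage_w_increment[OF eps h]
  by (rule order_trans[OF norm_divide_implicit[OF eps h] norm_gamma_h_le])

lemma stage_w_expansion:
  "norm (stage_w E \<epsilon> h t y w - w - of_real (\<gamma> * h) * drift t y w) \<le> h * norm (drift t y w) * (h / \<epsilon>\<^sup>2)"
  unfolding stage_w_increment[OF eps h] using h
  by (intro order_trans[OF divide_implicit_near] mult_right_mono norm_gamma_h_le) auto

lemma hat_w_diff: "norm (hat_w E \<epsilon> h t y w - w) \<le> 2 * h * norm (drift t y w)"
  unfolding hat_w_increment[OF eps h]
  by (rule order_trans[OF norm_divide_implicit[OF eps h] norm_node_mult])

lemma hat_w_expansion:
  "norm (hat_w E \<epsilon> h t y w - w - of_real (h / (2 * \<gamma>)) * drift t y w) \<le> 2 * h * norm (drift t y w) * (h / \<epsilon>\<^sup>2)"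
  unfolding hat_w_increment[OF eps h] using h
  by (intro order_trans[OF divide_implicit_near] mult_right_mono norm_node_mult) auto

lemma stage_w_bound:
  assumes "0 \<le> t" shows "norm (stage_w E \<epsilon> h t y w) \<le> norm w + \<epsilon>\<^sup>2 * L"
proof -
  have "stage_w E \<epsilon> h t y w = w / (1 + of_real \<gamma> * imu \<epsilon> h)
     + of_real (\<gamma> * h) * E t (y + \<i> * w) / (1 + of_real \<gamma> * imu \<epsilon> h)"
    by (simp add: stage_w_def add_divide_distrib)
  moreover have "\<epsilon>\<^sup>2 * norm (E t (y + \<i> * w)) \<le> \<epsilon>\<^sup>2 * L"
    using E_bound[OF assms] by (intro mult_left_mono) auto
  ultimately show ?thesis
    using norm_add_le[OF norm_divide_implicit[OF eps h] stiff_divide_implicit[OF eps h]]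
    by (smt (verit))
qed

lemma hat_time: "0 \<le> t \<Longrightarrow> 0 \<le> t + h / (2 * \<gamma>)"
  using node_bounds by simp

lemma hat_y_diff:
  assumes "0 \<le> t" shows "norm (hat_y E \<epsilon> h t y w - y) \<le> 2 * h * L"
proof -
  have "norm (hat_y E \<epsilon> h t y w - y) = norm (of_real (h / (2 * \<gamma>)) * E t (y + \<i> * stage_w E \<epsilon> h t y w))"
    unfolding hat_y_def mult.assoc by (simp only: diff_diff_eq2 norm_i_mult
       diff_add_cancel norm_minus_commute[of _ y] add_diff_cancel_left')
  also have "\<dots> \<le> 2 * h * norm (E t (y + \<i> * stage_w E \<epsilon> h t y w))" by (rule norm_node_mult)
  also have "\<dots> \<le> 2 * h * L" using E_bound[OF assms] h by (intro mult_left_mono) auto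
  finally show ?thesis .
qed

lemma next_y_diff:
  assumes "0 \<le> t" shows "norm (next_y E \<epsilon> h t y w - y) \<le> 2 * h * L"
proof -
  let ?S = "of_real (1 - \<gamma>) * E t (y + \<i> * stage_w E \<epsilon> h t y w)
        + of_real \<gamma> * E (t + h / (2 * \<gamma>)) (hat_y E \<epsilon> h t y w + \<i> * next_w E \<epsilon> h t y w)"
  have "norm (next_y E \<epsilon> h t y w - y) = norm (\<i> * (of_real h * ?S))"
    unfolding next_y_def mult.assoc[of "\<i>"] by (simp only: norm_minus_commute[of _ y] diff_diff_eq2 diff_add_cancel add_diff_cancel_left')
  also have "\<dots> = h * norm ?S" by (simp only: norm_i_mult norm_h_mult)
  also have "\<dots> \<le> h * (L + L / 3)"
    using h by (intro mult_left_mono norm_weighted_stages E_bound assms hat_time) auto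
  also have "\<dots> \<le> h * (2 * L)" using h L_pos by (intro mult_left_mono) auto
  finally show ?thesis by simp
qed

lemma next_w_diff:
  "norm (next_w E \<epsilon> h t y w - w) \<le> h * norm (drift t y w)
     + h * norm (E (t + h / (2 * \<gamma>)) (hat_y E \<epsilon> h t y w + \<i> * hat_w E \<epsilon> h t y w) - E t (y + \<i> * w))"
  unfolding next_w_increment[OF eps h]
proof (rule norm_add_le)
  have "norm (of_real h * drift t y w * increment_factor \<epsilon> h) \<le> norm (of_real h * drift t y w) * 1"
    unfolding norm_mult[of _ "increment_factor \<epsilon> h"]
    by (intro mult_left_mono norm_increment_factor[OF eps h]) auto
  then show "norm (of_real h * drift t y w * increment_factor \<epsilon> h) \<le> h * norm (drift t y w)"
    by (simp only: norm_h_mult mult_1_right)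
qed (rule order_trans[OF norm_divide_implicit[OF eps h] norm_gamma_h_le])

lemma stiff_drift:
  assumes "0 \<le> t" shows "\<epsilon>\<^sup>2 * norm (drift t y w) \<le> \<epsilon>\<^sup>2 * L + norm w"
proof -
  have "\<epsilon>\<^sup>2 * norm (drift t y w) = norm (of_real (\<epsilon>\<^sup>2) * drift t y w)" by (simp add: norm_mult norm_power)
  also have "of_real (\<epsilon>\<^sup>2) * drift t y w = of_real (\<epsilon>\<^sup>2) * E t (y + \<i> * w) - \<i> * w"
    using eps by (simp add: algebra_simps)
  also have "norm \<dots> \<le> norm (of_real (\<epsilon>\<^sup>2) * E t (y + \<i> * w)) + norm (\<i> * w)" by (rule norm_triangle_ineq4)
  also have "\<dots> \<le> \<epsilon>\<^sup>2 * L + norm w"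
    using E_bound[OF assms, of "y + \<i> * w"] by (simp add: norm_mult norm_power mult_left_mono)
  finally show ?thesis .
qed

text \<open>The discrete counterpart of \<open>exact_w_bound\<close>: the distance to the equilibrium is not amplified by the linear
part, and all variations of the field are multiplied by \<open>\<epsilon>\<^sup>2\<close>. Together with \<open>stiff_drift\<close> this produces
\<open>K h norm w\<close> and sources of size \<open>\<epsilon>\<^sup>2 h\<close>, for arbitrary ratios of \<open>h\<close> and \<open>\<epsilon>\<^sup>2\<close>.\<close>
lemma equilibrium_distance_step:
  fixes y w :: complex
  assumes t: "0 \<le> t"
  defines "y' \<equiv> next_y E \<epsilon> h t y w" and "w' \<equiv> next_w E \<epsilon> h t y w"
  defines "z \<equiv> w + \<i> * of_real (\<epsilon>\<^sup>2) * E t (y + \<i> * w)"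
  defines "z' \<equiv> w' + \<i> * of_real (\<epsilon>\<^sup>2) * E (t + h) (y' + \<i> * w')"
  shows "norm z' \<le> exp (3 * K * h) * norm z + 15 * L\<^sup>2 * \<epsilon>\<^sup>2 * h"
proof -
  define e where "e = E t (y + \<i> * w)"
  define e' where "e' = E (t + h) (y' + \<i> * w')"
  define yh where "yh = hat_y E \<epsilon> h t y w"
  define wh where "wh = hat_w E \<epsilon> h t y w"
  define eh where "eh = E (t + h / (2 * \<gamma>)) (yh + \<i> * wh)"
  define p where "p = drift t y w"
  have th: "0 \<le> t + h" using t h by simp
  have ee: "norm (eh - e) \<le> 2 * L"
    using norm_triangle_ineq4[of eh e] E_bound[OF t] E_bound[OF hat_time[OF t]] unfolding e_def eh_def
    by (smt (verit))
  have zw: "norm (\<i> * of_real (\<epsilon>\<^sup>2) * e) \<le> \<epsilon>\<^sup>2 * L"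
    using E_bound[OF t] by (simp add: e_def norm_mult norm_power mult_left_mono)
  have wz: "norm w \<le> norm z + \<epsilon>\<^sup>2 * L"
    using zw norm_triangle_ineq4[of z "\<i> * of_real (\<epsilon>\<^sup>2) * e"] by (simp add: z_def e_def)
  have ep: "\<epsilon>\<^sup>2 * norm p \<le> \<epsilon>\<^sup>2 * L + norm w" unfolding p_def by (rule stiff_drift[OF t])
  have dw: "\<epsilon>\<^sup>2 * norm (w' - w) \<le> h * (\<epsilon>\<^sup>2 * L + norm w) + \<epsilon>\<^sup>2 * (h * (2 * L))"
  proof -
    have "norm (w' - w) \<le> h * norm p + h * norm (eh - e)"
      unfolding w'_def p_def eh_def e_def yh_def wh_def by (rule next_w_diff)
    also have "\<dots> \<le> h * norm p + h * (2 * L)" using ee h by (intro add_left_mono mult_left_mono) auto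
    finally have "\<epsilon>\<^sup>2 * norm (w' - w) \<le> \<epsilon>\<^sup>2 * (h * norm p + h * (2 * L))" by (intro mult_left_mono) auto
    also have "\<dots> = h * (\<epsilon>\<^sup>2 * norm p) + \<epsilon>\<^sup>2 * (h * (2 * L))" by (simp add: algebra_simps)
    also have "\<dots> \<le> h * (\<epsilon>\<^sup>2 * L + norm w) + \<epsilon>\<^sup>2 * (h * (2 * L))"
      using ep h by (intro add_right_mono mult_left_mono) auto
    finally show ?thesis .
  qed
  have A: "\<epsilon>\<^sup>2 * norm (e' - e) \<le> \<epsilon>\<^sup>2 * h * L * (1 + 5 * K) + K * h * norm w"
  proof -
    have "norm (e' - e) \<le> L * \<bar>(t + h) - t\<bar> + K * norm ((y' + \<i> * w') - (y + \<i> * w))"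
      unfolding e'_def e_def by (rule E_diff_bound[OF th t])
    also have "\<dots> \<le> L * h + K * (2 * h * L + norm (w' - w))"
      using next_y_diff[OF t, of y w] norm_position_diff_le[of y' w' y w] h K_nonneg L_pos
      by (intro add_mono mult_left_mono) (auto simp: y'_def)
    finally have "\<epsilon>\<^sup>2 * norm (e' - e) \<le> \<epsilon>\<^sup>2 * (L * h + K * (2 * h * L + norm (w' - w)))"
      by (intro mult_left_mono) auto
    also have "\<dots> = \<epsilon>\<^sup>2 * L * h + K * (\<epsilon>\<^sup>2 * (2 * h * L)) + K * (\<epsilon>\<^sup>2 * norm (w' - w))"
      by (simp add: algebra_simps)
    also have "\<dots> \<le> \<epsilon>\<^sup>2 * L * h + K * (\<epsilon>\<^sup>2 * (2 * h * L)) + K * (h * (\<epsilon>\<^sup>2 * L + norm w) + \<epsilon>\<^sup>2 * (h * (2 * L)))"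
      using dw K_nonneg by (intro add_left_mono mult_left_mono) auto
    finally show ?thesis by (simp add: algebra_simps)
  qed
  have B: "\<epsilon>\<^sup>2 * norm (eh - e) \<le> \<epsilon>\<^sup>2 * h * L * (2 + 4 * K) + 2 * K * h * norm w"
  proof -
    have "norm (eh - e) \<le> L * \<bar>(t + h / (2 * \<gamma>)) - t\<bar> + K * norm ((yh + \<i> * wh) - (y + \<i> * w))"
      unfolding eh_def e_def by (rule E_diff_bound[OF hat_time[OF t] t])
    also have "\<dots> \<le> L * (2 * h) + K * (2 * h * L + 2 * h * norm p)"
      using hat_y_diff[OF t, of y w] hat_w_diff[of t y w] norm_position_diff_le[of yh wh y w] node_bounds L_pos K_nonneg
      by (intro add_mono mult_left_mono) (auto simp: yh_def wh_def p_def)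
    finally have "\<epsilon>\<^sup>2 * norm (eh - e) \<le> \<epsilon>\<^sup>2 * (L * (2 * h) + K * (2 * h * L + 2 * h * norm p))"
      by (intro mult_left_mono) auto
    also have "\<dots> = \<epsilon>\<^sup>2 * L * (2 * h) + K * (\<epsilon>\<^sup>2 * (2 * h * L)) + 2 * h * K * (\<epsilon>\<^sup>2 * norm p)"
      by (simp add: algebra_simps)
    also have "\<dots> \<le> \<epsilon>\<^sup>2 * L * (2 * h) + K * (\<epsilon>\<^sup>2 * (2 * h * L)) + 2 * h * K * (\<epsilon>\<^sup>2 * L + norm w)"
      using ep K_nonneg h by (intro add_left_mono mult_left_mono) auto
    finally show ?thesis by (simp add: algebra_simps)
  qed
  have "z' = (1 - of_real (1 - 2 * \<gamma>) * imu \<epsilon> h) / (1 + of_real \<gamma> * imu \<epsilon> h)\<^sup>2 * z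
       + of_real (\<gamma> * h) * (eh - e) / (1 + of_real \<gamma> * imu \<epsilon> h) + \<i> * (of_real (\<epsilon>\<^sup>2) * (e' - e))"
  proof -
    have "z' = (w' + \<i> * of_real (\<epsilon>\<^sup>2) * e) + \<i> * (of_real (\<epsilon>\<^sup>2) * (e' - e))"
      by (simp add: z'_def e'_def algebra_simps)
    then show ?thesis
      using next_w_equilibrium[OF eps h, of E t y w] unfolding w'_def z_def e_def eh_def yh_def wh_def by simp
  qed
  moreover have "norm ((1 - of_real (1 - 2 * \<gamma>) * imu \<epsilon> h) / (1 + of_real \<gamma> * imu \<epsilon> h)\<^sup>2 * z) \<le> norm z"
    unfolding norm_mult using mult_right_mono[OF norm_stability_factor[OF eps h], of "norm z"] by simp
  moreover have "norm (\<i> * (of_real (\<epsilon>\<^sup>2) * (e' - e))) = \<epsilon>\<^sup>2 * norm (e' - e)"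
    by (simp add: norm_mult norm_power)
  ultimately have "norm z' \<le> norm z + \<epsilon>\<^sup>2 * norm (eh - e) + \<epsilon>\<^sup>2 * norm (e' - e)"
    using norm_add3_le[OF _ stiff_divide_implicit[OF eps h]] by (metis order_refl)
  also have "\<dots> \<le> norm z + \<epsilon>\<^sup>2 * h * L * (3 + 9 * K) + 3 * K * h * norm w"
    using A B by (simp add: algebra_simps)
  also have "\<dots> \<le> norm z + \<epsilon>\<^sup>2 * h * L * (3 + 9 * K) + 3 * K * h * (norm z + \<epsilon>\<^sup>2 * L)"
    using wz K_nonneg h by (intro add_left_mono mult_left_mono) auto
  also have "\<dots> = (1 + 3 * K * h) * norm z + (\<epsilon>\<^sup>2 * h) * (3 * L + 12 * (K * L))" by (simp add: algebra_simps)
  also have "\<dots> \<le> exp (3 * K * h) * norm z + (\<epsilon>\<^sup>2 * h) * (3 * L\<^sup>2 + 12 * L\<^sup>2)"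
    using K_sq L_le_sq h exp_ge_add_one_self[of "3 * K * h"] by (intro add_mono mult_left_mono mult_right_mono) auto
  finally show ?thesis by (simp add: algebra_simps)
qed

definition scheme_seq :: "(nat \<Rightarrow> complex) \<Rightarrow> (nat \<Rightarrow> complex) \<Rightarrow> bool" where
  "scheme_seq y w \<longleftrightarrow> (\<forall>n. y (Suc n) = next_y E \<epsilon> h (real n * h) (y n) (w n)
                        \<and> w (Suc n) = next_w E \<epsilon> h (real n * h) (y n) (w n))"

lemma scheme_w_bound:
  assumes s: "scheme_seq y w"
  shows "norm (w n) \<le> exp (3 * K * (real n * h)) * (norm (w 0) + 15 * L\<^sup>2 * \<epsilon>\<^sup>2 * (1 + real n * h))"
proof -
  define z where "z n = w n + \<i> * of_real (\<epsilon>\<^sup>2) * E (real n * h) (y n + \<i> * w n)" for n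
  have zw: "norm (\<i> * of_real (\<epsilon>\<^sup>2) * E (real n * h) x) \<le> \<epsilon>\<^sup>2 * L" for n x
    using E_bound[of "real n * h" x] h by (simp add: norm_mult norm_power mult_left_mono)
  have step: "norm (z (Suc n)) \<le> exp (3 * K * h) * norm (z n) + 15 * L\<^sup>2 * \<epsilon>\<^sup>2 * h" for n
    using equilibrium_distance_step[of "real n * h" "y n" "w n"] s h
    by (simp add: z_def scheme_seq_def algebra_simps)
  have "norm (z n) \<le> exp (3 * K * h * real n) * (norm (z 0) + 15 * L\<^sup>2 * \<epsilon>\<^sup>2 * h * real n)"
    using discrete_gronwall[of "\<lambda>n. norm (z n)" "3 * K * h" "15 * L\<^sup>2 * \<epsilon>\<^sup>2 * h", OF step] K_nonneg h by simp
  moreover have "norm (w n) \<le> norm (z n) + \<epsilon>\<^sup>2 * L"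
    using zw[of n "y n + \<i> * w n"] norm_triangle_ineq4[of "z n" "\<i> * of_real (\<epsilon>\<^sup>2) * E (real n * h) (y n + \<i> * w n)"]
    by (simp add: z_def)
  ultimately have "norm (w n) \<le> exp (3 * K * h * real n) * (norm (z 0) + 15 * L\<^sup>2 * \<epsilon>\<^sup>2 * h * real n) + 1 * (\<epsilon>\<^sup>2 * L)"
    by linarith
  also have "\<dots> \<le> exp (3 * K * h * real n) * ((norm (w 0) + \<epsilon>\<^sup>2 * L) + 15 * L\<^sup>2 * \<epsilon>\<^sup>2 * h * real n)
      + exp (3 * K * h * real n) * (\<epsilon>\<^sup>2 * L)"
  proof (intro add_mono mult_left_mono mult_right_mono)
    show "norm (z 0) \<le> norm (w 0) + \<epsilon>\<^sup>2 * L" unfolding z_def by (intro norm_add_le zw order_refl)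
  qed (use K_nonneg h L_pos in auto)
  also have "\<dots> = exp (3 * K * (real n * h)) * (norm (w 0) + \<epsilon>\<^sup>2 * (2 * L + 15 * L\<^sup>2 * (real n * h)))"
    by (simp add: algebra_simps)
  also have "\<dots> \<le> exp (3 * K * (real n * h)) * (norm (w 0) + \<epsilon>\<^sup>2 * (15 * L\<^sup>2 + 15 * L\<^sup>2 * (real n * h)))"
  proof (intro mult_left_mono add_left_mono add_right_mono)
    show "2 * L \<le> 15 * L\<^sup>2" using L_le_sq L_pos by linarith
  qed auto
  finally show ?thesis by (simp add: algebra_simps)
qed

end

section \<open>Second-order convergence for fixed stiffness\<close>

lemma shifted_derivative:
  assumes "(f has_vector_derivative f') (at (t + r) within {0..})" "0 \<le> t"
  shows "((\<lambda>s. f (t + s)) has_vector_derivative f') (at r within {0..b})"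
proof -
  have "((f \<circ> (\<lambda>s. t + s)) has_vector_derivative 1 *\<^sub>R f') (at r within {0..b})"
  proof (rule vector_diff_chain_within)
    show "((\<lambda>s. t + s) has_vector_derivative 1) (at r within {0..b})"
      by (auto intro!: derivative_eq_intros)
    show "(f has_vector_derivative f') (at (t + r) within (\<lambda>s. t + s) ` {0..b})"
      using assms by (auto intro: has_vector_derivative_within_subset)
  qed
  then show ?thesis by (simp add: o_def)
qed

lemma linear_derivative: "((\<lambda>s. of_real s * c) has_vector_derivative c) (at s within X)"
  for c :: complex
  by (auto intro!: derivative_eq_intros)

lemma quadratic_derivative: "((\<lambda>s. of_real (s\<^sup>2 / 2) * c) has_vector_derivative of_real s * c) (at s within X)"
  for c :: complex
proof -
  have "((\<lambda>s::real. s\<^sup>2 / 2) has_vector_derivative s) (at s within X)"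
    by (auto intro!: derivative_eq_intros simp: has_real_derivative_iff_has_vector_derivative[symmetric])
  then have "((\<lambda>s. (s\<^sup>2 / 2) *\<^sub>R c) has_vector_derivative s *\<^sub>R c) (at s within X)"
    by (auto intro!: derivative_eq_intros simp: has_real_derivative_iff_has_vector_derivative)
  then show ?thesis by (simp add: scaleR_conv_of_real)
qed

context scheme begin

lemma D_of_real: "0 \<le> t \<Longrightarrow> D t x (of_real r * u) = of_real r * D t x u"
  using D_scaleR[of t x r u] by (simp add: scaleR_conv_of_real)

text \<open>For \<open>norm w \<le> \<epsilon> A\<close> the velocity of \<open>x\<close> is at most \<open>a\<close>, and each derivative of \<open>w\<close> costs a factor \<open>B\<close>, so that up to
powers of \<open>L\<close> the derivatives of \<open>w\<close> of order 1, 2, 3 are bounded by \<open>a\<close>, \<open>a B\<close> and \<open>S\<close>.\<close>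
context
  fixes A a B S :: real
  assumes A: "0 \<le> A"
  defines "a \<equiv> 1 + A / \<epsilon>" and "B \<equiv> 1 + 1 / \<epsilon>\<^sup>2" and "S \<equiv> a\<^sup>2 + a * B\<^sup>2"
begin

lemma weights: "1 \<le> a" "1 \<le> B" "A / \<epsilon> \<le> a" "1 / \<epsilon>\<^sup>2 \<le> B" "a\<^sup>2 \<le> S" "a * B \<le> S" "a * B\<^sup>2 \<le> S" "a\<^sup>2 + a * B \<le> S" "1 \<le> S"
proof -
  show 1: "1 \<le> a" "1 \<le> B" "A / \<epsilon> \<le> a" "1 / \<epsilon>\<^sup>2 \<le> B" using A eps by (auto simp: a_def B_def)
  have "B \<le> B\<^sup>2" using 1 by (simp add: self_le_power)
  then have 2: "a * B \<le> a * B\<^sup>2" using 1 by (intro mult_left_mono) auto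
  then show 3: "a\<^sup>2 \<le> S" "a * B \<le> S" "a * B\<^sup>2 \<le> S" "a\<^sup>2 + a * B \<le> S"
    using 1 zero_le_power2[of a] zero_le_power2[of B] mult_nonneg_nonneg[of a "B\<^sup>2"]
    unfolding S_def by linarith+
  have "1 \<le> a\<^sup>2" using 1 by (simp add: one_le_power)
  then show "1 \<le> S" using 3 by simp
qed

lemma velocity_bound:
  assumes "norm w \<le> \<epsilon> * A" shows "norm (w / of_real (\<epsilon>\<^sup>2) :: complex) \<le> a"
proof -
  have "norm (w / of_real (\<epsilon>\<^sup>2)) = norm w / \<epsilon>\<^sup>2" by (simp add: norm_divide norm_power)
  also have "\<dots> \<le> \<epsilon> * A / \<epsilon>\<^sup>2" using assms by (intro divide_right_mono) auto
  also have "\<dots> = A / \<epsilon>" by (simp add: power2_eq_square)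
  finally show ?thesis using weights by linarith
qed

lemma drift_bound:
  assumes "0 \<le> t" "norm w \<le> \<epsilon> * A" shows "norm (drift t y w) \<le> L * a"
proof -
  have "norm (\<i> * w / of_real (\<epsilon>\<^sup>2)) \<le> A / \<epsilon>"
  proof -
    have "norm (\<i> * w / of_real (\<epsilon>\<^sup>2)) = norm w / \<epsilon>\<^sup>2" by (simp add: norm_divide norm_power norm_mult)
    also have "\<dots> \<le> \<epsilon> * A / \<epsilon>\<^sup>2" using assms by (intro divide_right_mono) auto
    also have "\<dots> = A / \<epsilon>" by (simp add: power2_eq_square)
    finally show ?thesis .
  qed
  then have "norm (drift t y w) \<le> L + 1 * (A / \<epsilon>)"
    using E_bound[OF assms(1)] norm_triangle_ineq4[of "E t (y + \<i> * w)" "\<i> * w / of_real (\<epsilon>\<^sup>2)"]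
    by (smt (verit))
  also have "\<dots> \<le> L + L * (A / \<epsilon>)" using one_le_L A eps by (intro add_left_mono mult_right_mono) auto
  finally show ?thesis by (simp add: a_def algebra_simps)
qed

text \<open>The expansions are obtained by bounding the derivatives of the remainders one after the other: \<open>w\<close> and \<open>x\<close> to first
order, then the field along the trajectory to first order, then \<open>y\<close> and \<open>w\<close> to second order.\<close>
lemma exact_taylor:
  assumes ex: "exact \<epsilon> y w" and t: "0 \<le> t"
    and wA: "\<And>s. t \<le> s \<Longrightarrow> s \<le> t + h \<Longrightarrow> norm (w s) \<le> \<epsilon> * A"
  defines "x \<equiv> y t + \<i> * w t"
  defines "e \<equiv> E t x" and "p \<equiv> drift t (y t) (w t)" and "ed \<equiv> Et t x + D t x (w t / of_real (\<epsilon>\<^sup>2))"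
  shows "norm (y (t + h) - y t + \<i> * of_real h * e + \<i> * of_real (h\<^sup>2 / 2) * ed) \<le> 2 * L\<^sup>2 * h^3 * S"
    and "norm (w (t + h) - w t - of_real h * p - of_real (h\<^sup>2 / 2) * (ed - \<i> * p / of_real (\<epsilon>\<^sup>2))) \<le> 4 * L\<^sup>2 * h^3 * S"
proof -
  have LS: "0 \<le> L" "0 \<le> S" "0 \<le> a" "0 \<le> B" using weights L_pos by auto
  define er where "er r = E (t + r) (y (t + r) + \<i> * w (t + r))" for r
  define pr where "pr r = er r - \<i> * w (t + r) / of_real (\<epsilon>\<^sup>2)" for r
  have tr: "0 \<le> t + r" if "0 \<le> r" for r using t that by simp
  have dy: "((\<lambda>s. y (t + s)) has_vector_derivative - \<i> * er r) (at r within {0..b})" if "0 \<le> r" for r b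
    unfolding er_def by (rule shifted_derivative[OF exact_y[OF eps ex tr[OF that]] t])
  have dw: "((\<lambda>s. w (t + s)) has_vector_derivative pr r) (at r within {0..b})" if "0 \<le> r" for r b
    unfolding er_def pr_def by (rule shifted_derivative[OF exact_w[OF eps ex tr[OF that]] t])
  have dx: "((\<lambda>s. y (t + s) + \<i> * w (t + s)) has_vector_derivative w (t + r) / of_real (\<epsilon>\<^sup>2)) (at r within {0..b})" if "0 \<le> r" for r b
    using shifted_derivative[OF exact_x[OF eps ex tr[OF that]] t] .
  have er0: "er 0 = e" "pr 0 = p" by (auto simp: er_def pr_def e_def x_def p_def)
  have wr: "norm (w (t + r)) \<le> \<epsilon> * A" if "0 \<le> r" "r \<le> h" for r using wA[of "t + r"] that by simp
  have w1: "norm (w (t + r) - w t) \<le> r * (L * a)" if r: "0 \<le> r" "r \<le> h" for r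
  proof -
    have "norm (w (t + r) - w (t + 0)) \<le> r * (L * a)"
    proof (rule norm_increment_le[OF r(1) dw])
      fix s assume "0 \<le> s" "s \<le> r"
      then show "norm (pr s) \<le> L * a" unfolding pr_def er_def
        using r by (intro drift_bound wr tr) auto
    qed auto
    then show ?thesis by simp
  qed
  have x1: "norm (y (t + r) + \<i> * w (t + r) - x) \<le> r * a" if r: "0 \<le> r" "r \<le> h" for r
  proof -
    have "norm ((y (t + r) + \<i> * w (t + r)) - (y (t + 0) + \<i> * w (t + 0))) \<le> r * a"
    proof (rule norm_increment_le[OF r(1) dx])
      fix s assume "0 \<le> s" "s \<le> r"
      then show "norm (w (t + s) / of_real (\<epsilon>\<^sup>2)) \<le> a" using r by (intro velocity_bound wr) auto
    qed auto
    then show ?thesis by (simp add: x_def)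
  qed
  have dw_eps: "norm (v / of_real (\<epsilon>\<^sup>2) :: complex) \<le> c * B" if "norm v \<le> c" "0 \<le> c" for v c
  proof -
    have "norm (v / of_real (\<epsilon>\<^sup>2)) = norm v * (1 / \<epsilon>\<^sup>2)" by (simp add: norm_divide norm_power)
    also have "\<dots> \<le> c * B" using that weights by (intro mult_mono) auto
    finally show ?thesis .
  qed
  have x2: "norm (y (t + r) + \<i> * w (t + r) - x - r *\<^sub>R (w t / of_real (\<epsilon>\<^sup>2))) \<le> r\<^sup>2 * (L * (a * B))"
    if r: "0 \<le> r" "r \<le> h" for r
  proof -
    let ?f = "\<lambda>s. (y (t + s) + \<i> * w (t + s)) - s *\<^sub>R (w t / of_real (\<epsilon>\<^sup>2))"
    have "norm (?f r - ?f 0) \<le> r * (r * (L * a) * B)"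
    proof (rule norm_increment_le[OF r(1)])
      fix s assume s: "0 \<le> s" "s \<le> r"
      show "(?f has_vector_derivative (w (t + s) / of_real (\<epsilon>\<^sup>2) - 1 *\<^sub>R (w t / of_real (\<epsilon>\<^sup>2)))) (at s within {0..r})"
        by (intro has_vector_derivative_diff dx s) (auto intro!: derivative_eq_intros)
      have "w (t + s) / of_real (\<epsilon>\<^sup>2) - 1 *\<^sub>R (w t / of_real (\<epsilon>\<^sup>2)) = (w (t + s) - w t) / of_real (\<epsilon>\<^sup>2)"
        by (simp add: diff_divide_distrib)
      moreover have "norm (w (t + s) - w t) \<le> r * (L * a)"
        using w1[of s] s r LS mult_right_mono[of s r "L * a"] by auto
      ultimately show "norm (w (t + s) / of_real (\<epsilon>\<^sup>2) - 1 *\<^sub>R (w t / of_real (\<epsilon>\<^sup>2))) \<le> r * (L * a) * B"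
        using dw_eps LS r by simp
    qed
    moreover have "?f r - ?f 0 = y (t + r) + \<i> * w (t + r) - x - r *\<^sub>R (w t / of_real (\<epsilon>\<^sup>2))"
      by (simp add: x_def algebra_simps)
    ultimately have "norm (y (t + r) + \<i> * w (t + r) - x - r *\<^sub>R (w t / of_real (\<epsilon>\<^sup>2))) \<le> r * (r * (L * a) * B)"
      by metis
    then show ?thesis by (simp add: power2_eq_square mult_ac)
  qed
  have e2: "norm (er r - e - of_real r * ed) \<le> r\<^sup>2 * (2 * L\<^sup>2 * S)" if r: "0 \<le> r" "r \<le> h" for r
  proof -
    let ?x = "y (t + r) + \<i> * w (t + r)"
    have "er r - e - of_real r * ed = (E (t + r) ?x - E t x - ((t + r) - t) *\<^sub>R Et t x - D t x (?x - x))
       + D t x (?x - x - r *\<^sub>R (w t / of_real (\<epsilon>\<^sup>2)))"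
      by (simp add: er_def e_def ed_def D_diff[OF t] D_scaleR[OF t]) (simp add: scaleR_conv_of_real algebra_simps)
    also have "norm \<dots> \<le> L * (((t + r) - t)\<^sup>2 + (norm (?x - x))\<^sup>2) + L * (r\<^sup>2 * (L * (a * B)))"
      using LS by (intro norm_add_le taylor tr r t order_trans[OF D_bound_L] mult_left_mono x2)
    also have "\<dots> \<le> L * (r\<^sup>2 + (r * a)\<^sup>2) + L * (r\<^sup>2 * (L * (a * B)))"
      using x1[OF r] LS r by (intro add_right_mono mult_left_mono add_mono power_mono) auto
    also have "\<dots> = r\<^sup>2 * (L * (1 + a\<^sup>2) + L\<^sup>2 * (a * B))" by (simp add: power2_eq_square algebra_simps)
    also have "\<dots> \<le> r\<^sup>2 * (L\<^sup>2 * (2 * a\<^sup>2) + L\<^sup>2 * (2 * (a * B)))"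
    proof (rule mult_left_mono, rule add_mono)
      have "1 \<le> a\<^sup>2" using weights by (simp add: one_le_power)
      then have "1 + a\<^sup>2 \<le> 2 * a\<^sup>2" by simp
      then show "L * (1 + a\<^sup>2) \<le> L\<^sup>2 * (2 * a\<^sup>2)" using L_le_sq by (intro mult_mono) auto
      have "0 \<le> a * B" using LS by simp
      then have "a * B \<le> 2 * (a * B)" by linarith
      then show "L\<^sup>2 * (a * B) \<le> L\<^sup>2 * (2 * (a * B))" by (intro mult_left_mono) auto
    qed auto
    also have "\<dots> = r\<^sup>2 * (2 * L\<^sup>2 * (a\<^sup>2 + a * B))" by (simp add: algebra_simps)
    also have "\<dots> \<le> r\<^sup>2 * (2 * L\<^sup>2 * S)" using weights by (intro mult_left_mono) auto
    finally show ?thesis .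
  qed
  have e1: "norm (er r - e) \<le> r * (2 * L * a)" if r: "0 \<le> r" "r \<le> h" for r
  proof -
    have "norm (er r - e) \<le> L * \<bar>(t + r) - t\<bar> + K * norm (y (t + r) + \<i> * w (t + r) - x)"
      unfolding er_def e_def by (rule E_diff_bound[OF tr[OF r(1)] t])
    also have "\<dots> \<le> L * (r * a) + L * (r * a)"
    proof (intro add_mono mult_mono x1 r K_le_L)
      show "\<bar>(t + r) - t\<bar> \<le> r * a" using r weights mult_left_mono[of 1 a r] by simp
    qed (use LS in auto)
    finally show ?thesis by (simp add: algebra_simps)
  qed
  have w2: "norm (w (t + r) - w t - r *\<^sub>R p) \<le> r\<^sup>2 * (2 * L * (a * B))" if r: "0 \<le> r" "r \<le> h" for r
  proof -
    let ?f = "\<lambda>s. w (t + s) - s *\<^sub>R p"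
    have "norm (?f r - ?f 0) \<le> r * (r * (2 * L * (a * B)))"
    proof (rule norm_increment_le[OF r(1)])
      fix s assume s: "0 \<le> s" "s \<le> r"
      show "(?f has_vector_derivative (pr s - 1 *\<^sub>R p)) (at s within {0..r})"
        by (intro has_vector_derivative_diff dw s) (auto intro!: derivative_eq_intros)
      have sh: "s \<le> h" using s r by simp
      have "pr s - 1 *\<^sub>R p = (er s - e) + (- (\<i> * ((w (t + s) - w t) / of_real (\<epsilon>\<^sup>2))))"
        by (simp add: pr_def er0(2)[symmetric] er0(1)[symmetric] diff_divide_distrib algebra_simps)
      moreover have "norm (- (\<i> * ((w (t + s) - w t) / of_real (\<epsilon>\<^sup>2)))) \<le> s * (L * a) * (1 / \<epsilon>\<^sup>2)"
        using w1[OF s(1) sh] unfolding norm_minus_cancel norm_i_mult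
        by (simp add: norm_divide norm_power divide_right_mono)
      ultimately have "norm (pr s - 1 *\<^sub>R p) \<le> s * (2 * L * a) + s * (L * a) * (1 / \<epsilon>\<^sup>2)"
        using norm_add_le[OF e1[OF s(1) sh]] by metis
      also have "\<dots> = s * (L * a) * (2 + 1 / \<epsilon>\<^sup>2)" by (simp add: algebra_simps)
      also have "\<dots> \<le> r * (L * a) * (2 * B)"
      proof (intro mult_mono)
        have "2 + X \<le> 2 * (1 + X)" if "0 \<le> X" for X :: real using that by simp
        then show "2 + 1 / \<epsilon>\<^sup>2 \<le> 2 * B" unfolding B_def by (meson zero_le_divide_1_iff zero_le_power2)
      qed (use s LS in auto)
      finally show "norm (pr s - 1 *\<^sub>R p) \<le> r * (2 * L * (a * B))" by (simp add: mult_ac)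
    qed
    moreover have "?f r - ?f 0 = w (t + r) - w t - r *\<^sub>R p" by simp
    ultimately have "norm (w (t + r) - w t - r *\<^sub>R p) \<le> r * (r * (2 * L * (a * B)))" by metis
    then show ?thesis by (simp add: power2_eq_square mult_ac)
  qed
  show "norm (y (t + h) - y t + \<i> * of_real h * e + \<i> * of_real (h\<^sup>2 / 2) * ed) \<le> 2 * L\<^sup>2 * h^3 * S"
  proof -
    let ?f = "\<lambda>s. y (t + s) + (of_real s * (\<i> * e) + of_real (s\<^sup>2 / 2) * (\<i> * ed))"
    have "norm (?f h - ?f 0) \<le> h * (h\<^sup>2 * (2 * L\<^sup>2 * S))"
    proof (rule norm_increment_le[OF less_imp_le[OF h]])
      fix s assume s: "0 \<le> s" "s \<le> h"
      show "(?f has_vector_derivative (- \<i> * er s + (\<i> * e + of_real s * (\<i> * ed)))) (at s within {0..h})"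
        by (intro has_vector_derivative_add dy s quadratic_derivative linear_derivative)
      have "- \<i> * er s + (\<i> * e + of_real s * (\<i> * ed)) = - (\<i> * (er s - e - of_real s * ed))"
        by (simp add: algebra_simps)
      then have "norm (- \<i> * er s + (\<i> * e + of_real s * (\<i> * ed))) = norm (er s - e - of_real s * ed)"
        by (simp only: norm_minus_cancel norm_i_mult)
      also have "\<dots> \<le> s\<^sup>2 * (2 * L\<^sup>2 * S)" by (rule e2[OF s])
      also have "\<dots> \<le> h\<^sup>2 * (2 * L\<^sup>2 * S)" using s LS by (intro mult_right_mono power_mono) auto
      finally show "norm (- \<i> * er s + (\<i> * e + of_real s * (\<i> * ed))) \<le> h\<^sup>2 * (2 * L\<^sup>2 * S)" .
    qed
    then show ?thesis by (simp add: power2_eq_square power3_eq_cube algebra_simps)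
  qed
  show "norm (w (t + h) - w t - of_real h * p - of_real (h\<^sup>2 / 2) * (ed - \<i> * p / of_real (\<epsilon>\<^sup>2))) \<le> 4 * L\<^sup>2 * h^3 * S"
  proof -
    let ?q = "ed - \<i> * p / of_real (\<epsilon>\<^sup>2)"
    let ?f = "\<lambda>s. w (t + s) - (of_real s * p + of_real (s\<^sup>2 / 2) * ?q)"
    have "norm (?f h - ?f 0) \<le> h * (h\<^sup>2 * (4 * L\<^sup>2 * S))"
    proof (rule norm_increment_le[OF less_imp_le[OF h]])
      fix s assume s: "0 \<le> s" "s \<le> h"
      show "(?f has_vector_derivative (pr s - (p + of_real s * ?q))) (at s within {0..h})"
        by (intro has_vector_derivative_add has_vector_derivative_diff dw s quadratic_derivative linear_derivative)
      have "pr s - (p + of_real s * ?q) = (er s - e - of_real s * ed) + (- (\<i> * ((w (t + s) - w t - s *\<^sub>R p) / of_real (\<epsilon>\<^sup>2))))"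
        by (simp add: pr_def er0(2)[symmetric] er0(1)[symmetric] scaleR_conv_of_real divide_inverse algebra_simps)
      moreover have "norm (- (\<i> * ((w (t + s) - w t - s *\<^sub>R p) / of_real (\<epsilon>\<^sup>2)))) \<le> s\<^sup>2 * (2 * L * (a * B)) * B"
        using dw_eps[OF w2[OF s]] LS s unfolding norm_minus_cancel norm_i_mult by simp
      ultimately have "norm (pr s - (p + of_real s * ?q)) \<le> s\<^sup>2 * (2 * L\<^sup>2 * S) + s\<^sup>2 * (2 * L * (a * B)) * B"
        using norm_add_le[OF e2[OF s]] by metis
      also have "\<dots> = s\<^sup>2 * (2 * L\<^sup>2 * S + 2 * L * (a * B\<^sup>2))" by (simp add: power2_eq_square algebra_simps)
      also have "\<dots> \<le> h\<^sup>2 * (2 * L\<^sup>2 * S + 2 * L\<^sup>2 * S)"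
        using s LS weights L_le_sq by (intro mult_mono add_mono power_mono) auto
      finally show "norm (pr s - (p + of_real s * ?q)) \<le> h\<^sup>2 * (4 * L\<^sup>2 * S)" by (simp add: mult_ac)
    qed
    then show ?thesis by (simp add: power2_eq_square power3_eq_cube algebra_simps)
  qed
qed

text \<open>The same second-order polynomials as in \<open>exact_taylor\<close>. The terms in \<open>h\<^sup>2\<close> match because
\<open>\<gamma> (2 - \<gamma>) = 1 / 2\<close> for the implicit argument \<open>w\<close> of the field, because \<open>\<gamma>\<close> times the node \<open>1 / (2 \<gamma>)\<close> is
\<open>1 / 2\<close> for the explicit arguments, and because of \<open>increment_factor_second_order\<close> for the rotation.\<close>
lemma step_taylor:
  fixes y w :: complex
  assumes t: "0 \<le> t" and wA: "norm w \<le> \<epsilon> * A"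
  defines "x \<equiv> y + \<i> * w"
  defines "e \<equiv> E t x" and "p \<equiv> drift t y w" and "ed \<equiv> Et t x + D t x (w / of_real (\<epsilon>\<^sup>2))"
  shows "norm (next_y E \<epsilon> h t y w - y + \<i> * of_real h * e + \<i> * of_real (h\<^sup>2 / 2) * ed) \<le> 20 * L^3 * h^3 * S"
    and "norm (next_w E \<epsilon> h t y w - w - of_real h * p - of_real (h\<^sup>2 / 2) * (ed - \<i> * p / of_real (\<epsilon>\<^sup>2))) \<le> 30 * L^3 * h^3 * S"
proof -
  have LS: "0 \<le> L" "0 \<le> S" "0 \<le> a" "0 \<le> B" "0 \<le> h" using weights L_pos h by auto
  have L3: "L\<^sup>2 \<le> L^3" "L \<le> L^3" using one_le_L by (auto intro: power_increasing self_le_power)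
  have La: "L \<le> L * a" using mult_left_mono[of 1 a L] weights LS by simp
  define c where "c = h / (2 * \<gamma>)"
  have c: "0 \<le> c" "c \<le> 2 * h" using node_bounds by (auto simp: c_def)
  have tc: "0 \<le> t + c" using t c by simp
  have hk: "h / \<epsilon>\<^sup>2 \<le> h * B" using weights h by (simp add: divide_inverse)
  have p: "norm p \<le> L * a" unfolding p_def by (rule drift_bound[OF t wA])
  have hp: "h * norm p \<le> h * (L * a)" using p h by simp
  define wt where "wt = stage_w E \<epsilon> h t y w"
  define yh where "yh = hat_y E \<epsilon> h t y w"
  define wh where "wh = hat_w E \<epsilon> h t y w"
  define wn where "wn = next_w E \<epsilon> h t y w"
  define e1 where "e1 = E t (y + \<i> * wt)"
  define eh where "eh = E (t + c) (yh + \<i> * wh)"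
  define e2 where "e2 = E (t + c) (yh + \<i> * wn)"
  define T where "T = Et t x"
  define xv where "xv = w / of_real (\<epsilon>\<^sup>2)"
  have xv: "xv = - (\<i> * e) + \<i> * p" by (simp add: xv_def p_def e_def x_def algebra_simps)
  have ed: "ed = T + D t x xv" by (simp add: ed_def T_def xv_def)
  have nxv: "norm xv \<le> a" unfolding xv_def by (rule velocity_bound[OF wA])
  have ned: "norm ed \<le> 2 * L * a"
  proof -
    have "norm ed \<le> L * 1 + L * a" unfolding ed T_def
      by (intro norm_add_le order_trans[OF D_bound_L] mult_left_mono nxv) (use Et_bound t LS in auto)
    also have "\<dots> \<le> L * a + L * a" using weights LS by (intro add_mono mult_left_mono) auto
    finally show ?thesis by (simp add: mult_ac)
  qed
  have wt1: "norm (wt - w) \<le> h * (L * a)"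
    unfolding wt_def using stage_w_diff[of t y w] hp unfolding p_def by linarith
  have wt2: "norm (wt - w - of_real (\<gamma> * h) * p) \<le> h * (L * a) * (h * B)"
    using stage_w_expansion[of t y w] mult_mono[OF hp hk] LS unfolding wt_def p_def by force
  have e1_1: "norm (e1 - e) \<le> L * (h * (L * a))"
    unfolding e1_def e_def
    using E_lipschitz_le[OF t, of "y + \<i> * wt" x "h * (L * a)"] wt1 K_le_L LS
      norm_position_diff_le[of y wt y w] mult_right_mono[OF K_le_L, of "h * (L * a)"]
    by (simp add: x_def)
  \<comment> \<open>Remainders of the field at the three points where it is evaluated after the start.\<close>
  define r1 where "r1 = e1 - e - of_real (\<gamma> * h) * D t x (\<i> * p)"
  have r1: "norm r1 \<le> 2 * L^3 * h\<^sup>2 * S"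
  proof -
    have "y + \<i> * wt - x = \<i> * (wt - w)" by (simp add: x_def algebra_simps)
    moreover have "\<i> * (wt - w - of_real (\<gamma> * h) * p) = \<i> * (wt - w) - of_real (\<gamma> * h) * (\<i> * p)"
      by (simp add: algebra_simps)
    ultimately have "D t x (\<i> * (wt - w - of_real (\<gamma> * h) * p))
        = D t x (y + \<i> * wt - x) - of_real (\<gamma> * h) * D t x (\<i> * p)"
      by (simp only: D_diff[OF t] D_of_real[OF t])
    then have "r1 = (E t (y + \<i> * wt) - E t x - (t - t) *\<^sub>R Et t x - D t x (y + \<i> * wt - x))
        + D t x (\<i> * (wt - w - of_real (\<gamma> * h) * p))"
      unfolding r1_def e1_def e_def by simp
    also have "norm \<dots> \<le> L * ((t - t)\<^sup>2 + (norm (y + \<i> * wt - x))\<^sup>2) + L * (h * (L * a) * (h * B))"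
      using LS wt2 by (intro norm_add_le taylor t order_trans[OF D_bound_L] mult_left_mono) (simp_all add: norm_mult)
    also have "norm (y + \<i> * wt - x) = norm (wt - w)"
      using \<open>y + \<i> * wt - x = \<i> * (wt - w)\<close> norm_i_mult by metis
    also have "L * ((t - t)\<^sup>2 + (norm (wt - w))\<^sup>2) + L * (h * (L * a) * (h * B))
       \<le> L * (h * (L * a))\<^sup>2 + L * (h * (L * a) * (h * B))"
      using wt1 LS by (intro add_right_mono mult_left_mono) (auto intro!: power_mono)
    also have "\<dots> = h\<^sup>2 * (L^3 * a\<^sup>2 + L\<^sup>2 * (a * B))" by (simp add: power2_eq_square power3_eq_cube algebra_simps)
    also have "\<dots> \<le> h\<^sup>2 * (L^3 * S + L^3 * S)"
      using weights L3 LS by (intro mult_left_mono add_mono mult_mono) auto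
    finally show ?thesis by (simp add: algebra_simps)
  qed
  have yh1: "norm (yh - y) \<le> 2 * h * L" unfolding yh_def by (rule hat_y_diff[OF t])
  have yh2: "norm (yh - y + of_real c * (\<i> * e)) \<le> 2 * L\<^sup>2 * h\<^sup>2 * a"
  proof -
    have "yh - y + of_real c * (\<i> * e) = - (\<i> * (of_real c * (e1 - e)))"
      by (simp add: yh_def hat_y_def e1_def wt_def c_def algebra_simps)
    then have "norm (yh - y + of_real c * (\<i> * e)) = norm (of_real c * (e1 - e))"
      by (simp only: norm_minus_cancel norm_i_mult)
    also have "\<dots> \<le> 2 * h * norm (e1 - e)" unfolding c_def by (rule norm_node_mult)
    also have "\<dots> \<le> 2 * h * (L * (h * (L * a)))" using e1_1 LS by (intro mult_left_mono) auto
    finally show ?thesis by (simp add: power2_eq_square mult_ac)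
  qed
  have wh1: "norm (wh - w) \<le> 2 * h * (L * a)"
    unfolding wh_def using hat_w_diff[of t y w] hp unfolding p_def by linarith
  have wh2: "norm (wh - w - of_real c * p) \<le> 2 * h * (L * a) * (h * B)"
    using hat_w_expansion[of t y w] mult_mono[OF hp hk] LS unfolding wh_def p_def c_def by force
  define xh where "xh = yh + \<i> * wh"
  have xh1: "norm (xh - x) \<le> 4 * h * (L * a)"
  proof -
    have "norm (xh - x) \<le> 2 * h * L + 2 * h * (L * a)"
      using norm_position_diff_le[of yh wh y w] yh1 wh1 by (simp add: xh_def x_def)
    also have "2 * h * L \<le> 2 * h * (L * a)" using La LS by (intro mult_left_mono) auto
    finally show ?thesis by (simp add: mult_ac)
  qed
  have xh2: "norm (xh - x - of_real c * xv) \<le> h\<^sup>2 * (4 * L\<^sup>2 * (a * B))"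
  proof -
    have "xh - x - of_real c * xv = (yh - y + of_real c * (\<i> * e)) + \<i> * (wh - w - of_real c * p)"
      by (simp add: xh_def x_def xv algebra_simps)
    also have "norm \<dots> \<le> 2 * L\<^sup>2 * h\<^sup>2 * a + 2 * h * (L * a) * (h * B)"
      by (intro norm_add_le yh2) (simp only: norm_i_mult wh2)
    also have "\<dots> = h\<^sup>2 * (2 * L\<^sup>2 * (a * 1) + 2 * L * (a * B))" by (simp add: power2_eq_square algebra_simps)
    also have "\<dots> \<le> h\<^sup>2 * (2 * L\<^sup>2 * (a * B) + 2 * L\<^sup>2 * (a * B))"
      using weights L_le_sq LS by (intro mult_left_mono add_mono mult_mono) auto
    finally show ?thesis by (simp add: mult_ac)
  qed
  define rh where "rh = eh - e - of_real c * ed"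
  have rh: "norm rh \<le> h\<^sup>2 * (24 * L^3 * S)"
  proof -
    have "rh = (E (t + c) xh - E t x - ((t + c) - t) *\<^sub>R Et t x - D t x (xh - x)) + D t x (xh - x - of_real c * xv)"
      unfolding rh_def eh_def e_def ed T_def xh_def
      by (simp only: D_diff[OF t] D_of_real[OF t] scaleR_conv_of_real) (simp add: algebra_simps)
    also have "norm \<dots> \<le> L * (((t + c) - t)\<^sup>2 + (norm (xh - x))\<^sup>2) + L * (h\<^sup>2 * (4 * L\<^sup>2 * (a * B)))"
      using LS by (intro norm_add_le taylor t tc order_trans[OF D_bound_L] mult_left_mono xh2)
    also have "\<dots> \<le> L * ((2 * h)\<^sup>2 + (4 * h * (L * a))\<^sup>2) + L * (h\<^sup>2 * (4 * L\<^sup>2 * (a * B)))"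
      using c xh1 LS by (intro add_right_mono mult_left_mono add_mono power_mono) auto
    also have "\<dots> = h\<^sup>2 * (4 * (L * 1) + 16 * (L^3 * a\<^sup>2) + 4 * (L^3 * (a * B)))"
      by (simp add: power2_eq_square power3_eq_cube algebra_simps)
    also have "\<dots> \<le> h\<^sup>2 * (4 * (L^3 * S) + 16 * (L^3 * S) + 4 * (L^3 * S))"
      using weights L3 LS by (intro mult_left_mono add_mono mult_mono) auto
    finally show ?thesis by (simp add: mult_ac)
  qed
  have rh1: "norm (eh - e) \<le> 6 * L\<^sup>2 * h * a"
  proof -
    have "norm (eh - e) \<le> L * \<bar>(t + c) - t\<bar> + K * norm (xh - x)"
      unfolding eh_def e_def xh_def by (rule E_diff_bound[OF tc t])
    also have "\<dots> \<le> L * (2 * h) + L * (4 * h * (L * a))"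
      using c xh1 K_le_L LS by (intro add_mono mult_mono) auto
    also have "\<dots> = 2 * h * (L * 1) + 4 * h * (L\<^sup>2 * a)" by (simp add: power2_eq_square)
    also have "\<dots> \<le> 2 * h * (L\<^sup>2 * a) + 4 * h * (L\<^sup>2 * a)"
      using weights L_le_sq LS by (intro add_mono mult_left_mono mult_mono) auto
    finally show ?thesis by (simp add: mult_ac)
  qed
  let ?F = "increment_factor \<epsilon> h"
  have wn_eq: "wn - w = of_real h * p * ?F + of_real (\<gamma> * h) * (eh - e) / (1 + of_real \<gamma> * imu \<epsilon> h)"
    using next_w_increment[OF eps h, of E t y w]
    by (simp add: wn_def p_def eh_def e_def x_def yh_def wh_def c_def)
  have wn1: "norm (wn - w) \<le> 3 * h * (L * a)"
  proof -
    have "norm (eh - e) \<le> 2 * L * a"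
      using norm_triangle_ineq4[of eh e] E_bound[OF t, of x] E_bound[OF tc, of "yh + \<i> * wh"] weights LS
        mult_left_mono[of 1 a "2 * L"] unfolding e_def eh_def by linarith
    then have "h * norm (eh - e) \<le> h * (2 * L * a)" using LS by (intro mult_left_mono) auto
    then show ?thesis
      using next_w_diff[of t y w] hp
      by (simp add: wn_def p_def eh_def e_def x_def yh_def wh_def c_def)
  qed
  have wn2: "norm (wn - w - of_real h * p) \<le> h\<^sup>2 * (7 * L\<^sup>2 * (a * B))"
  proof -
    have "wn - w - of_real h * p = of_real h * (p * (?F - 1)) + of_real (\<gamma> * h) * (eh - e) / (1 + of_real \<gamma> * imu \<epsilon> h)"
      unfolding wn_eq by (simp add: algebra_simps)
    also have "norm \<dots> \<le> h * (L * a * (h * B)) + h * (6 * L\<^sup>2 * h * a)"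
    proof (intro norm_add_le)
      show "norm (of_real h * (p * (?F - 1))) \<le> h * (L * a * (h * B))"
        unfolding norm_h_mult norm_mult[of p] using p increment_factor_near_one[OF eps h] hk LS
        by (intro mult_left_mono mult_mono) auto
      show "norm (of_real (\<gamma> * h) * (eh - e) / (1 + of_real \<gamma> * imu \<epsilon> h)) \<le> h * (6 * L\<^sup>2 * h * a)"
        using rh1 LS
        by (intro order_trans[OF norm_divide_implicit[OF eps h]] order_trans[OF norm_gamma_h_le] mult_left_mono) auto
    qed
    also have "\<dots> = h\<^sup>2 * (L * (a * B) + 6 * L\<^sup>2 * (a * 1))" by (simp add: power2_eq_square algebra_simps)
    also have "\<dots> \<le> h\<^sup>2 * (L\<^sup>2 * (a * B) + 6 * L\<^sup>2 * (a * B))"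
      using weights L_le_sq LS by (intro mult_left_mono add_mono mult_mono) auto
    finally show ?thesis by (simp add: mult_ac)
  qed
  define r2 where "r2 = e2 - e - of_real c * T - D t x (of_real h * (\<i> * p) - of_real c * (\<i> * e))"
  have r2: "norm r2 \<le> h\<^sup>2 * (38 * L^3 * S)"
  proof -
    let ?x = "yh + \<i> * wn"
    have d1: "norm (?x - x) \<le> 5 * h * (L * a)"
    proof -
      have "2 * h * L \<le> 2 * h * (L * a)" using La LS by (intro mult_left_mono) auto
      then show ?thesis using norm_position_diff_le[of yh wn y w] yh1 wn1 by (simp add: x_def)
    qed
    have d2: "norm (?x - x - (of_real h * (\<i> * p) - of_real c * (\<i> * e))) \<le> h\<^sup>2 * (9 * L\<^sup>2 * (a * B))"
    proof -
      have "?x - x - (of_real h * (\<i> * p) - of_real c * (\<i> * e))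
          = (yh - y + of_real c * (\<i> * e)) + \<i> * (wn - w - of_real h * p)"
        by (simp add: x_def algebra_simps)
      also have "norm \<dots> \<le> 2 * L\<^sup>2 * h\<^sup>2 * a + h\<^sup>2 * (7 * L\<^sup>2 * (a * B))"
        by (intro norm_add_le yh2) (simp only: norm_i_mult wn2)
      also have "\<dots> = h\<^sup>2 * (2 * L\<^sup>2 * (a * 1) + 7 * L\<^sup>2 * (a * B))" by (simp add: power2_eq_square algebra_simps)
      also have "\<dots> \<le> h\<^sup>2 * (2 * L\<^sup>2 * (a * B) + 7 * L\<^sup>2 * (a * B))"
        using weights LS by (intro mult_left_mono add_mono) auto
      finally show ?thesis by (simp add: mult_ac)
    qed
    have "r2 = (E (t + c) ?x - E t x - ((t + c) - t) *\<^sub>R Et t x - D t x (?x - x))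
       + D t x (?x - x - (of_real h * (\<i> * p) - of_real c * (\<i> * e)))"
      unfolding r2_def e2_def e_def T_def
      by (simp only: D_diff[OF t] scaleR_conv_of_real) (simp add: algebra_simps)
    also have "norm \<dots> \<le> L * (((t + c) - t)\<^sup>2 + (norm (?x - x))\<^sup>2) + L * (h\<^sup>2 * (9 * L\<^sup>2 * (a * B)))"
      using LS by (intro norm_add_le taylor t tc order_trans[OF D_bound_L] mult_left_mono d2)
    also have "\<dots> \<le> L * ((2 * h)\<^sup>2 + (5 * h * (L * a))\<^sup>2) + L * (h\<^sup>2 * (9 * L\<^sup>2 * (a * B)))"
      using c d1 LS by (intro add_right_mono mult_left_mono add_mono power_mono) auto
    also have "\<dots> = h\<^sup>2 * (4 * (L * 1) + 25 * (L^3 * a\<^sup>2) + 9 * (L^3 * (a * B)))"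
      by (simp add: power2_eq_square power3_eq_cube algebra_simps)
    also have "\<dots> \<le> h\<^sup>2 * (4 * (L^3 * S) + 25 * (L^3 * S) + 9 * (L^3 * S))"
      using weights L3 LS by (intro mult_left_mono add_mono mult_mono) auto
    finally show ?thesis by (simp add: mult_ac)
  qed
  have gc: "of_real \<gamma> * complex_of_real c = of_real (h / 2)"
    unfolding c_def of_real_mult[symmetric] using gamma_pos by simp
  have gg: "complex_of_real \<gamma> * (2 - of_real \<gamma>) = 1 / 2"
  proof -
    have "complex_of_real (\<gamma> * (2 - \<gamma>)) = of_real (1 / 2)" unfolding gamma_quadratic ..
    then show ?thesis by simp
  qed
  show "norm (next_y E \<epsilon> h t y w - y + \<i> * of_real h * e + \<i> * of_real (h\<^sup>2 / 2) * ed) \<le> 20 * L^3 * h^3 * S"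
  proof -
    define g where "g = complex_of_real \<gamma>"
    define C where "C = complex_of_real c"
    define P where "P = D t x (\<i> * p)"
    define Q where "Q = D t x (\<i> * e)"
    have E1: "e1 = e + g * of_real h * P + r1" by (simp add: r1_def P_def g_def)
    have E2: "e2 = e + C * T + of_real h * P - C * Q + r2"
      by (simp add: r2_def P_def Q_def C_def D_diff[OF t] D_of_real[OF t])
    have ED: "ed = T + P - Q" unfolding ed xv by (simp add: D_diff[OF t] P_def Q_def)
    have "(1 - g) * e1 + g * e2 - e - of_real (h / 2) * ed
        = (1 - g) * r1 + g * r2 + (g * C - of_real (h / 2)) * (T - Q) + of_real h * (g * (2 - g) - 1 / 2) * P"
      unfolding E1 E2 ED by (simp add: field_simps)
    then have R: "(1 - g) * e1 + g * e2 - e - of_real (h / 2) * ed = (1 - g) * r1 + g * r2"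
      using gc gg by (simp add: g_def C_def)
    have "next_y E \<epsilon> h t y w - y + \<i> * of_real h * e + \<i> * of_real (h\<^sup>2 / 2) * ed
        = - (\<i> * (of_real h * ((1 - g) * e1 + g * e2 - e - of_real (h / 2) * ed)))"
      by (simp add: next_y_def e1_def e2_def wt_def yh_def wn_def c_def g_def power2_eq_square algebra_simps)
    also have "\<dots> = - (\<i> * (of_real h * ((1 - g) * r1 + g * r2)))" unfolding R ..
    finally have "norm (next_y E \<epsilon> h t y w - y + \<i> * of_real h * e + \<i> * of_real (h\<^sup>2 / 2) * ed)
        = h * norm (of_real (1 - \<gamma>) * r1 + of_real \<gamma> * r2)"
      by (simp only: norm_minus_cancel norm_i_mult norm_h_mult) (simp add: g_def)
    also have "\<dots> \<le> h * (2 * L^3 * h\<^sup>2 * S + h\<^sup>2 * (38 * L^3 * S) / 3)"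
      using LS by (intro mult_left_mono norm_weighted_stages r1 r2)
    also have "\<dots> = (2 + 38 / 3) * (L^3 * h^3 * S)" by (simp add: power2_eq_square power3_eq_cube field_simps)
    also have "\<dots> \<le> 20 * (L^3 * h^3 * S)" using LS by (intro mult_right_mono) auto
    finally show ?thesis by (simp add: mult_ac)
  qed
  show "norm (next_w E \<epsilon> h t y w - w - of_real h * p - of_real (h\<^sup>2 / 2) * (ed - \<i> * p / of_real (\<epsilon>\<^sup>2))) \<le> 30 * L^3 * h^3 * S"
  proof -
    define ai where "ai = 1 / (1 + of_real \<gamma> * imu \<epsilon> h)"
    have ai: "norm (ai * z) \<le> norm z" for z
      using norm_divide_implicit[OF eps h, of z] by (simp add: ai_def)
    have ai1: "norm (ai - 1) \<le> h * B"
      using inverse_implicit_near_one[OF eps h] hk unfolding ai_def by linarith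
    have hh: "complex_of_real (h\<^sup>2 / 2) = of_real h * of_real (h / 2)" by (simp add: power2_eq_square)
    have "norm (wn - w - of_real h * p - of_real (h\<^sup>2 / 2) * (ed - \<i> * p / of_real (\<epsilon>\<^sup>2)))
       = norm (of_real h * (p * (?F - (1 - imu \<epsilon> h / 2))) + of_real (\<gamma> * h) * (ai * rh) + of_real h * (of_real (h / 2) * (ed * (ai - 1))))"
    proof -
      have "wn - w - of_real h * p - of_real (h\<^sup>2 / 2) * (ed - \<i> * p / of_real (\<epsilon>\<^sup>2))
         = of_real h * p * ?F + of_real (\<gamma> * h) * (ai * (rh + of_real c * ed)) - of_real h * p
            - of_real (h\<^sup>2 / 2) * ed + of_real h * (p * (imu \<epsilon> h / 2))"
        unfolding wn_eq by (simp add: rh_def ai_def imu_def power2_eq_square algebra_simps)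
      also have "of_real (\<gamma> * h) * (ai * (rh + of_real c * ed))
         = of_real (\<gamma> * h) * (ai * rh) + of_real h * (of_real \<gamma> * of_real c) * (ai * ed)"
        by (simp add: algebra_simps)
      finally have eq: "wn - w - of_real h * p - of_real (h\<^sup>2 / 2) * (ed - \<i> * p / of_real (\<epsilon>\<^sup>2))
         = of_real h * p * ?F + (of_real (\<gamma> * h) * (ai * rh) + of_real h * of_real (h / 2) * (ai * ed)) - of_real h * p
            - of_real h * of_real (h / 2) * ed + of_real h * (p * (imu \<epsilon> h / 2))"
        unfolding gc hh .
      define q where "q = complex_of_real (h / 2)"
      have "wn - w - of_real h * p - of_real (h\<^sup>2 / 2) * (ed - \<i> * p / of_real (\<epsilon>\<^sup>2))
         = of_real h * (p * (?F - (1 - imu \<epsilon> h / 2))) + of_real (\<gamma> * h) * (ai * rh) + of_real h * (of_real (h / 2) * (ed * (ai - 1)))"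
        unfolding eq q_def[symmetric] by (simp add: algebra_simps)
      then show ?thesis by simp
    qed
    also have "\<dots> \<le> h * (L * a * (h * B)\<^sup>2) + h * (h\<^sup>2 * (24 * L^3 * S)) + h * (h * ((2 * L * a) * (h * B)))"
    proof (intro norm_add3_le)
      show "norm (of_real h * (p * (?F - (1 - imu \<epsilon> h / 2)))) \<le> h * (L * a * (h * B)\<^sup>2)"
        unfolding norm_h_mult norm_mult[of p]
      proof (intro mult_left_mono mult_mono p)
        have "(h / \<epsilon>\<^sup>2)\<^sup>2 \<le> (h * B)\<^sup>2" using hk h by (intro power_mono) auto
        then show "norm (?F - (1 - imu \<epsilon> h / 2)) \<le> (h * B)\<^sup>2"
          using increment_factor_second_order[OF eps h] by linarith
      qed (use LS in auto)
      show "norm (of_real (\<gamma> * h) * (ai * rh)) \<le> h * (h\<^sup>2 * (24 * L^3 * S))"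
        by (intro order_trans[OF norm_gamma_h_le] mult_left_mono order_trans[OF ai] rh) (use LS in auto)
      have "norm (of_real (h / 2) * (ed * (ai - 1))) = h / 2 * (norm ed * norm (ai - 1))"
        using h by (simp add: norm_mult)
      also have "\<dots> \<le> h * ((2 * L * a) * (h * B))"
        using ned ai1 LS by (intro mult_mono) auto
      finally show "norm (of_real h * (of_real (h / 2) * (ed * (ai - 1)))) \<le> h * (h * ((2 * L * a) * (h * B)))"
        unfolding norm_h_mult using LS by (intro mult_left_mono) auto
    qed
    also have "\<dots> = h^3 * (L * (a * B\<^sup>2) + 24 * (L^3 * S) + 2 * (L * (a * B)))"
      by (simp add: power2_eq_square power3_eq_cube algebra_simps)
    also have "\<dots> \<le> h^3 * (L^3 * S + 24 * (L^3 * S) + 2 * (L^3 * S))"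
      using weights L3 LS by (intro mult_left_mono add_mono mult_mono) auto
    also have "\<dots> = 27 * (L^3 * h^3 * S)" by simp
    also have "\<dots> \<le> 30 * (L^3 * h^3 * S)" using LS by (intro mult_right_mono) auto
    finally show ?thesis by (simp add: wn_def)
  qed
qed

lemma local_error:
  assumes ex: "exact \<epsilon> y w" and t: "0 \<le> t"
    and wA: "\<And>s. t \<le> s \<Longrightarrow> s \<le> t + h \<Longrightarrow> norm (w s) \<le> \<epsilon> * A"
  shows "norm (next_y E \<epsilon> h t (y t) (w t) - y (t + h)) + norm (next_w E \<epsilon> h t (y t) (w t) - w (t + h)) \<le> 56 * L^3 * h^3 * S"
proof -
  have d: "norm (u - v) \<le> p + q" if "norm (u - z) \<le> p" "norm (v - z) \<le> q" for u v z :: complex and p q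
    using norm_triangle_ineq4[of "u - z" "v - z"] that by simp
  define e where "e = E t (y t + \<i> * w t)"
  define p where "p = drift t (y t) (w t)"
  define ed where "ed = Et t (y t + \<i> * w t) + D t (y t + \<i> * w t) (w t / of_real (\<epsilon>\<^sup>2))"
  have wt: "norm (w t) \<le> \<epsilon> * A" using wA[of t] h by simp
  note T = exact_taylor[OF ex t wA] step_taylor[OF t wt, of "y t"]
  define yz where "yz = y t - \<i> * of_real h * e - \<i> * of_real (h\<^sup>2 / 2) * ed"
  define wz where "wz = w t + of_real h * p + of_real (h\<^sup>2 / 2) * (ed - \<i> * p / of_real (\<epsilon>\<^sup>2))"
  have "norm (next_y E \<epsilon> h t (y t) (w t) - y (t + h)) \<le> 20 * L^3 * h^3 * S + 2 * L\<^sup>2 * h^3 * S"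
    by (rule d[of _ yz]) (use T(1,3) in \<open>simp_all add: yz_def e_def ed_def algebra_simps\<close>)
  moreover have "norm (next_w E \<epsilon> h t (y t) (w t) - w (t + h)) \<le> 30 * L^3 * h^3 * S + 4 * L\<^sup>2 * h^3 * S"
    by (rule d[of _ wz]) (use T(2,4) in \<open>simp_all add: wz_def p_def ed_def algebra_simps\<close>)
  moreover have "L\<^sup>2 * (h^3 * S) \<le> L^3 * (h^3 * S)"
    using one_le_L h weights by (intro mult_right_mono power_increasing) auto
  ultimately show ?thesis by (simp add: mult.assoc)
qed

lemma classical_convergence:
  assumes ex: "exact \<epsilon> y w" and s: "scheme_seq ys ws"
    and init: "ys 0 = y 0" "ws 0 = w 0"
    and wA: "\<And>s. 0 \<le> s \<Longrightarrow> s \<le> real n * h \<Longrightarrow> norm (w s) \<le> \<epsilon> * A"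
  shows "norm (ys n - y (real n * h)) + norm (ws n - w (real n * h))
     \<le> exp (46 * K * (real n * h)) * (real n * h) * (56 * L^3 * h\<^sup>2 * S)"
proof -
  have LS: "0 \<le> L" "0 \<le> S" using weights L_pos by auto
  define d where "d k = norm (ys k - y (real k * h)) + norm (ws k - w (real k * h))" for k
  have "d k \<le> exp (46 * K * h * real k) * (56 * L^3 * h^3 * S * real k)" if "k \<le> n" for k
    using that
  proof (induction k)
    case 0
    then show ?case using init by (simp add: d_def)
  next
    case (Suc k)
    let ?t = "real k * h"
    have t: "0 \<le> ?t" using h by simp
    have t': "real (Suc k) * h = ?t + h" by (simp add: algebra_simps)
    have "real (Suc k) * h \<le> real n * h" using Suc.prems h by (intro mult_right_mono) auto
    then have w: "norm (w s) \<le> \<epsilon> * A" if "?t \<le> s" "s \<le> ?t + h" for s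
      using wA[of s] that t unfolding t' by linarith
    have st: "ys (Suc k) = next_y E \<epsilon> h ?t (ys k) (ws k)" "ws (Suc k) = next_w E \<epsilon> h ?t (ys k) (ws k)"
      using s by (auto simp: scheme_seq_def)
    have "d (Suc k) \<le> (norm (ys (Suc k) - next_y E \<epsilon> h ?t (y ?t) (w ?t)) + norm (ws (Suc k) - next_w E \<epsilon> h ?t (y ?t) (w ?t)))
        + (norm (next_y E \<epsilon> h ?t (y ?t) (w ?t) - y (?t + h)) + norm (next_w E \<epsilon> h ?t (y ?t) (w ?t) - w (?t + h)))"
      unfolding d_def t' by norm
    also have "\<dots> \<le> exp (46 * K * h) * d k + 56 * L^3 * h^3 * S"
      unfolding st by (intro add_mono local_error[OF ex t w]) (use step_stability[OF t] in \<open>auto simp: d_def\<close>)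
    also have "\<dots> \<le> exp (46 * K * h) * (exp (46 * K * h * real k) * (56 * L^3 * h^3 * S * real k)) + 1 * (56 * L^3 * h^3 * S)"
      using Suc by (intro add_mono mult_left_mono) auto
    also have "\<dots> \<le> exp (46 * K * h * real (Suc k)) * (56 * L^3 * h^3 * S * real k) + exp (46 * K * h * real (Suc k)) * (56 * L^3 * h^3 * S)"
    proof (intro add_mono mult_right_mono)
      have "exp (46 * K * h * real (Suc k)) = exp (46 * K * h) * exp (46 * K * h * real k)"
        by (simp add: exp_add[symmetric] algebra_simps)
      then show "exp (46 * K * h) * (exp (46 * K * h * real k) * (56 * L^3 * h^3 * S * real k))
          \<le> exp (46 * K * h * real (Suc k)) * (56 * L^3 * h^3 * S * real k)" by (simp only: mult.assoc)
      have "0 \<le> 46 * K * h * real (Suc k)" using K_nonneg h by simp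
      then show "1 \<le> exp (46 * K * h * real (Suc k))" by simp
    qed (use h LS in auto)
    finally show ?case by (simp add: algebra_simps)
  qed
  from this[of n] show ?thesis
    unfolding d_def by (simp add: power2_eq_square power3_eq_cube mult_ac)
qed

end

end

section \<open>Convergence in the stiff limit\<close>

context scheme begin

text \<open>What the scheme for \<open>y\<close> becomes when \<open>w\<close> is dropped: an explicit second-order Runge-Kutta method for the
guiding centre equation \<open>y' = - \<i> E t y\<close>.\<close>
definition limit_step :: "real \<Rightarrow> complex \<Rightarrow> complex" where
  "limit_step t y = y - \<i> * of_real h * (of_real (1 - \<gamma>) * E t y
     + of_real \<gamma> * E (t + h / (2 * \<gamma>)) (y - \<i> * of_real (h / (2 * \<gamma>)) * E t y))"

lemma limit_step_increment_lipschitz: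
  assumes t: "0 \<le> t"
  shows "norm (limit_step t y - limit_step t y' - (y - y')) \<le> 2 * (h * K) * (1 + h * K) * norm (y - y')"
proof -
  let ?c = "h / (2 * \<gamma>)"
  define d where "d = norm (y - y')"
  define e where "e = E t y - E t y'"
  define x where "x z = z - \<i> * of_real ?c * E t z" for z
  define f where "f = E (t + ?c) (x y) - E (t + ?c) (x y')"
  have d: "0 \<le> d" by (simp add: d_def)
  have e: "norm e \<le> K * d" unfolding e_def d_def by (rule E_lipschitz[OF t])
  have f: "norm f \<le> K * (d + 2 * h * (K * d))"
    unfolding f_def
  proof (rule E_lipschitz_le[OF hat_time[OF t]])
    have "x y - x y' = (y - y') + (- (\<i> * (of_real ?c * e)))"
      unfolding x_def e_def by (simp only: right_diff_distrib mult.assoc) simp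
    also have "norm \<dots> \<le> d + 2 * h * (K * d)"
    proof (rule norm_add_le)
      have "norm (of_real ?c * e) \<le> 2 * h * norm e" by (rule norm_node_mult)
      also have "\<dots> \<le> 2 * h * (K * d)" using e h by (intro mult_left_mono) auto
      finally show "norm (- (\<i> * (of_real ?c * e))) \<le> 2 * h * (K * d)" by (simp only: norm_minus_cancel norm_i_mult)
    qed (simp add: d_def)
    finally show "norm (x y - x y') \<le> d + 2 * h * (K * d)" .
  qed
  have "limit_step t y - limit_step t y' - (y - y') = - (\<i> * (of_real h * (of_real (1 - \<gamma>) * e + of_real \<gamma> * f)))"
    by (simp add: limit_step_def e_def f_def x_def algebra_simps)
  then have "norm (limit_step t y - limit_step t y' - (y - y')) = h * norm (of_real (1 - \<gamma>) * e + of_real \<gamma> * f)"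
    by (simp only: norm_minus_cancel norm_i_mult norm_h_mult)
  also have "\<dots> \<le> h * (K * d + K * (d + 2 * h * (K * d)) / 3)"
    using h by (intro mult_left_mono norm_weighted_stages e f) auto
  also have "\<dots> = (h * K) * d * (4 / 3 + 2 / 3 * (h * K))" by (simp add: field_simps)
  also have "\<dots> \<le> (h * K) * d * (2 + 2 * (h * K))"
    using h K_nonneg d by (intro mult_left_mono add_mono mult_right_mono) auto
  finally show ?thesis by (simp add: d_def algebra_simps)
qed

lemma limit_step_lipschitz:
  assumes t: "0 \<le> t"
  shows "norm (limit_step t y - limit_step t y') \<le> exp (2 * K * h) * norm (y - y')"
proof -
  have k: "0 \<le> 2 * (h * K)" using h K_nonneg by simp
  have "norm (limit_step t y - limit_step t y') \<le> 2 * (h * K) * (1 + h * K) * norm (y - y') + norm (y - y')"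
    using norm_add_le[OF limit_step_increment_lipschitz[OF t] order_refl, of y y' "y - y'"] by simp
  also have "\<dots> = (1 + 2 * (h * K) + (2 * (h * K))\<^sup>2 / 2) * norm (y - y')"
    by (simp add: power2_eq_square algebra_simps)
  also have "\<dots> \<le> exp (2 * (h * K)) * norm (y - y')"
    by (intro mult_right_mono exp_lower_Taylor_quadratic k) auto
  finally show ?thesis by (simp add: mult_ac)
qed

text \<open>Up to the factor \<open>\<i> h\<close>, the average of \<open>w\<close> with the weights used for \<open>y\<close> is
\<open>\<epsilon>\<^sup>2\<close> times the difference of \<open>h\<close> times an average of the field and the increment of \<open>w\<close>. This is \<open>\<i> w = \<epsilon>\<^sup>2 (E - w')\<close> for the scheme, and it holds because both components are advanced with
the same weights.\<close>
lemma implicit_average: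
  fixes y w :: complex and t :: real
  defines "wt \<equiv> stage_w E \<epsilon> h t y w" and "w' \<equiv> next_w E \<epsilon> h t y w"
  shows "\<i> * of_real h * (of_real (1 - \<gamma>) * wt + of_real \<gamma> * w')
    = of_real (\<epsilon>\<^sup>2) * (of_real h * (of_real (1 - \<gamma>) * E t (y + \<i> * w)
        + of_real \<gamma> * E (t + h / (2 * \<gamma>)) (hat_y E \<epsilon> h t y w + \<i> * hat_w E \<epsilon> h t y w)) - (w' - w))"
proof -
  define e where "e = E t (y + \<i> * w)"
  define eh where "eh = E (t + h / (2 * \<gamma>)) (hat_y E \<epsilon> h t y w + \<i> * hat_w E \<epsilon> h t y w)"
  have "w' = (w + of_real (1 - \<gamma>) * (of_real h * e - imu \<epsilon> h * wt) + of_real (\<gamma> * h) * eh) / (1 + of_real \<gamma> * imu \<epsilon> h)"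
    by (simp add: w'_def next_w_def e_def eh_def wt_def)
  then have "w' * (1 + of_real \<gamma> * imu \<epsilon> h) = w + of_real (1 - \<gamma>) * (of_real h * e - imu \<epsilon> h * wt) + of_real (\<gamma> * h) * eh"
    using implicit_nonzero[OF eps h] by (simp add: eq_divide_eq)
  then have "imu \<epsilon> h * (of_real (1 - \<gamma>) * wt + of_real \<gamma> * w')
      = of_real h * (of_real (1 - \<gamma>) * e + of_real \<gamma> * eh) - (w' - w)"
    by (simp add: algebra_simps)
  moreover have "\<i> * of_real h = of_real (\<epsilon>\<^sup>2) * imu \<epsilon> h" using eps by (simp add: imu_def)
  ultimately show ?thesis unfolding e_def eh_def by (metis mult.assoc)
qed

text \<open>\<open>W\<close> bounds \<open>w\<close> and its first stage, and \<open>X\<close> collects the quadratic errors.\<close>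
context
  fixes A W X :: real
  assumes A: "0 \<le> A" and eps1: "\<epsilon> \<le> 1"
  defines "W \<equiv> \<epsilon> * (A + L)" and "X \<equiv> h\<^sup>2 + W\<^sup>2"
begin

lemma averaging_weights: "0 \<le> W" "\<epsilon> * A \<le> W" "\<epsilon> * A + \<epsilon>\<^sup>2 * L \<le> W" "W\<^sup>2 \<le> X" "h\<^sup>2 \<le> X" "h * W \<le> X"
  "0 \<le> X" "\<epsilon>\<^sup>2 * W \<le> X + \<epsilon>\<^sup>2" "\<epsilon>\<^sup>2 * (h * W) \<le> X"
proof -
  show 1: "0 \<le> W" "\<epsilon> * A \<le> W" using A eps L_pos by (auto simp: W_def)
  have e2: "\<epsilon>\<^sup>2 \<le> \<epsilon>" "\<epsilon>\<^sup>2 \<le> 1" using eps eps1 by (auto simp: power2_eq_square mult_le_one)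
  show "\<epsilon> * A + \<epsilon>\<^sup>2 * L \<le> W"
    using e2 L_pos mult_right_mono[of "\<epsilon>\<^sup>2" \<epsilon> L] by (simp add: W_def distrib_left)
  show 2: "W\<^sup>2 \<le> X" "h\<^sup>2 \<le> X" "0 \<le> X" by (auto simp: X_def)
  have "2 * (h * W) \<le> h\<^sup>2 + W\<^sup>2" using sum_squares_bound[of h W] by (simp add: mult.assoc)
  moreover have hW: "0 \<le> h * W" using h 1 by simp
  ultimately show 3: "h * W \<le> X" by (simp add: X_def)
  have "\<epsilon>\<^sup>2 * W \<le> \<epsilon> * W" using e2 1 by (intro mult_right_mono) auto
  also have "2 * (\<epsilon> * W) \<le> \<epsilon>\<^sup>2 + W\<^sup>2" using sum_squares_bound[of \<epsilon> W] by (simp add: mult.assoc)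
  then have "\<epsilon> * W \<le> \<epsilon>\<^sup>2 + W\<^sup>2" using eps 1 mult_nonneg_nonneg[of \<epsilon> W] by linarith
  also have "\<dots> \<le> X + \<epsilon>\<^sup>2" using 2 by simp
  finally show "\<epsilon>\<^sup>2 * W \<le> X + \<epsilon>\<^sup>2" .
  have "\<epsilon>\<^sup>2 * (h * W) \<le> 1 * (h * W)" using e2 hW by (intro mult_right_mono) auto
  then show "\<epsilon>\<^sup>2 * (h * W) \<le> X" using 3 by simp
qed

text \<open>The field at \<open>y + \<i> w\<close> is linearised around \<open>y\<close>; the linear terms of the two evaluations are first moved to
the same base point and then combined by \<open>implicit_average\<close>.\<close>
lemma scheme_averaging:
  fixes y w :: complex
  assumes t: "0 \<le> t"
  defines "w' \<equiv> next_w E \<epsilon> h t y w"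
  assumes w: "norm w \<le> \<epsilon> * A" "norm w' \<le> \<epsilon> * A"
  shows "norm (next_y E \<epsilon> h t y w - limit_step t y - \<i> * of_real (\<epsilon>\<^sup>2) * D t y (w' - w)) \<le> 14 * L^3 * h * (X + \<epsilon>\<^sup>2)"
proof -
  define c where "c = h / (2 * \<gamma>)"
  have c: "0 \<le> c" "c \<le> 2 * h" using node_bounds by (auto simp: c_def)
  have tc: "0 \<le> t + c" using t c by simp
  define wt where "wt = stage_w E \<epsilon> h t y w"
  define yh where "yh = hat_y E \<epsilon> h t y w"
  define yh0 where "yh0 = y - \<i> * of_real c * E t y"
  define e where "e = E t (y + \<i> * w)"
  define eh where "eh = E (t + c) (yh + \<i> * hat_w E \<epsilon> h t y w)"
  have L: "0 \<le> L" using L_pos by simp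
  have L23: "L\<^sup>2 \<le> L^3" "L \<le> L\<^sup>2" using one_le_L by (auto intro: power_increasing self_le_power)
  have wt: "norm wt \<le> W"
    using stage_w_bound[OF t, of y w] w(1) averaging_weights(3) unfolding wt_def by linarith
  have w': "norm w' \<le> W" using w(2) averaging_weights(2) by linarith
  define rA where "rA = E t (y + \<i> * wt) - E t y - D t y (\<i> * wt)"
  define rB where "rB = E (t + c) (yh + \<i> * w') - E (t + c) yh0 - D t y (\<i> * w')"
  have taylor0: "norm (E s (z + \<i> * u) - E s z - D s z (\<i> * u)) \<le> L * W\<^sup>2" if "0 \<le> s" "norm u \<le> W" for s z u
  proof -
    have "norm (E s (z + \<i> * u) - E s z - D s z (\<i> * u)) \<le> L * (norm u)\<^sup>2"
      using taylor[OF that(1) that(1), of "z + \<i> * u" z] by (simp add: norm_mult)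
    also have "\<dots> \<le> L * W\<^sup>2" using that L by (intro mult_left_mono power_mono) auto
    finally show ?thesis .
  qed
  have rA: "norm rA \<le> L\<^sup>2 * X"
  proof -
    have "norm rA \<le> L * W\<^sup>2" unfolding rA_def by (rule taylor0[OF t wt])
    also have "\<dots> \<le> L\<^sup>2 * X" using averaging_weights L23 L by (intro mult_mono) auto
    finally show ?thesis .
  qed
  have yh0: "norm (yh - yh0) \<le> 2 * h * (L * W)"
  proof -
    have "yh - yh0 = - (\<i> * (of_real c * (E t (y + \<i> * wt) - E t y)))"
      by (simp add: yh_def yh0_def hat_y_def wt_def c_def algebra_simps)
    then have "norm (yh - yh0) = norm (of_real c * (E t (y + \<i> * wt) - E t y))"
      by (simp only: norm_minus_cancel norm_i_mult)
    also have "\<dots> \<le> 2 * h * norm (E t (y + \<i> * wt) - E t y)" unfolding c_def by (rule norm_node_mult)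
    also have "\<dots> \<le> 2 * h * (K * W)"
      using h wt by (intro mult_left_mono E_lipschitz_le t) (auto simp: norm_mult)
    also have "\<dots> \<le> 2 * h * (L * W)" using h K_le_L averaging_weights by (intro mult_left_mono mult_right_mono) auto
    finally show ?thesis .
  qed
  have rB: "norm rB \<le> L\<^sup>2 * (7 * X)"
  proof -
    have "rB = (E (t + c) (yh + \<i> * w') - E (t + c) yh - D (t + c) yh (\<i> * w'))
        + (E (t + c) yh - E (t + c) yh0) + (D (t + c) yh (\<i> * w') - D t y (\<i> * w'))"
      by (simp add: rB_def)
    also have "norm \<dots> \<le> L * W\<^sup>2 + L * (2 * h * (L * W)) + L * (2 * h + 2 * h * L) * W"
    proof (intro norm_add3_le taylor0 tc w')
      show "norm (E (t + c) yh - E (t + c) yh0) \<le> L * (2 * h * (L * W))"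
        by (rule order_trans[OF E_lipschitz_le[OF tc yh0] mult_right_mono[OF K_le_L]]) (use h L averaging_weights in auto)
      have "norm (D (t + c) yh (\<i> * w') - D t y (\<i> * w')) \<le> L * (\<bar>(t + c) - t\<bar> + norm (yh - y)) * norm (\<i> * w')"
        by (rule D_lipschitz[OF tc t])
      also have "\<dots> \<le> L * (2 * h + 2 * h * L) * W"
        using c hat_y_diff[OF t, of y w] w' L h unfolding norm_i_mult yh_def[symmetric]
        by (intro mult_mono add_mono) auto
      finally show "norm (D (t + c) yh (\<i> * w') - D t y (\<i> * w')) \<le> L * (2 * h + 2 * h * L) * W" .
    qed
    also have "\<dots> = L * W\<^sup>2 + 4 * (L\<^sup>2 * (h * W)) + 2 * (L * (h * W))"
      by (simp add: power2_eq_square algebra_simps)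
    also have "\<dots> \<le> L\<^sup>2 * X + 4 * (L\<^sup>2 * X) + 2 * (L\<^sup>2 * X)"
      using averaging_weights L23 L h by (intro add_mono mult_left_mono mult_mono) auto
    finally show ?thesis by (simp add: mult_ac)
  qed
  define G where "G = of_real (1 - \<gamma>) * wt + of_real \<gamma> * w'"
  define M where "M = of_real (1 - \<gamma>) * e + of_real \<gamma> * eh"
  have M: "norm M \<le> 2 * L"
    using norm_weighted_stages[of e L eh L] E_bound[OF t] E_bound[OF tc] L by (simp add: M_def e_def eh_def)
  have hG: "\<i> * of_real h * G = of_real (\<epsilon>\<^sup>2) * (of_real h * M - (w' - w))"
    unfolding G_def M_def e_def eh_def wt_def w'_def yh_def c_def by (rule implicit_average)
  have DG: "of_real h * (of_real (1 - \<gamma>) * D t y (\<i> * wt) + of_real \<gamma> * D t y (\<i> * w'))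
       = of_real (\<epsilon>\<^sup>2) * (of_real h * D t y M - D t y (w' - w))"
  proof -
    have "of_real h * (of_real (1 - \<gamma>) * D t y (\<i> * wt) + of_real \<gamma> * D t y (\<i> * w')) = D t y (of_real h * (of_real (1 - \<gamma>) * (\<i> * wt) + of_real \<gamma> * (\<i> * w')))"
      by (simp only: D_of_real[OF t] D_add[OF t])
    also have "of_real h * (of_real (1 - \<gamma>) * (\<i> * wt) + of_real \<gamma> * (\<i> * w')) = \<i> * of_real h * G"
      by (simp add: G_def algebra_simps)
    also have "D t y (\<i> * of_real h * G) = of_real (\<epsilon>\<^sup>2) * (of_real h * D t y M - D t y (w' - w))"
      unfolding hG by (simp only: D_of_real[OF t] D_diff[OF t])
    finally show ?thesis .
  qed
  have "next_y E \<epsilon> h t y w - limit_step t y - \<i> * of_real (\<epsilon>\<^sup>2) * D t y (w' - w)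
     = - (\<i> * (of_real h * (of_real (1 - \<gamma>) * rA + of_real \<gamma> * rB) + of_real h * (of_real (\<epsilon>\<^sup>2) * D t y M)))"
  proof -
    have "next_y E \<epsilon> h t y w - limit_step t y
        = - (\<i> * (of_real h * (of_real (1 - \<gamma>) * rA + of_real \<gamma> * rB)
           + of_real h * (of_real (1 - \<gamma>) * D t y (\<i> * wt) + of_real \<gamma> * D t y (\<i> * w'))))"
      by (simp add: next_y_def limit_step_def rA_def rB_def wt_def yh_def yh0_def w'_def c_def algebra_simps)
    then show ?thesis unfolding DG by (simp add: algebra_simps)
  qed
  then have "norm (next_y E \<epsilon> h t y w - limit_step t y - \<i> * of_real (\<epsilon>\<^sup>2) * D t y (w' - w))
     = norm (of_real h * (of_real (1 - \<gamma>) * rA + of_real \<gamma> * rB) + of_real h * (of_real (\<epsilon>\<^sup>2) * D t y M))"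
    by (simp only: norm_minus_cancel norm_i_mult)
  also have "\<dots> \<le> h * (L\<^sup>2 * X + L\<^sup>2 * (7 * X) / 3) + h * (\<epsilon>\<^sup>2 * (L * (2 * L)))"
  proof (intro norm_add_le)
    show "norm (of_real h * (of_real (1 - \<gamma>) * rA + of_real \<gamma> * rB)) \<le> h * (L\<^sup>2 * X + L\<^sup>2 * (7 * X) / 3)"
      unfolding norm_h_mult using h by (intro mult_left_mono norm_weighted_stages rA rB) auto
    have "norm (D t y M) \<le> L * (2 * L)"
      using D_bound_L[OF t] mult_left_mono[OF M L] order_trans by blast
    then show "norm (of_real h * (of_real (\<epsilon>\<^sup>2) * D t y M)) \<le> h * (\<epsilon>\<^sup>2 * (L * (2 * L)))"
      unfolding norm_h_mult using h by (intro mult_left_mono) (auto simp: norm_mult norm_power intro!: mult_left_mono)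
  qed
  also have "\<dots> = L\<^sup>2 * (h * (10 / 3 * X + 2 * \<epsilon>\<^sup>2))" by (simp add: power2_eq_square field_simps)
  also have "\<dots> \<le> L^3 * (h * (14 * X + 14 * \<epsilon>\<^sup>2))"
    using h averaging_weights L23 L by (intro mult_mono add_mono mult_left_mono mult_right_mono) auto
  finally show ?thesis by (simp add: algebra_simps)
qed

text \<open>The same expansion for the exact solution. In the derivative of the remainder the term \<open>D t y (\<i> w)\<close> cancels against
the one produced by \<open>\<epsilon>\<^sup>2 w'\<close>, the slope being frozen at the start of the step.\<close>
lemma exact_averaging:
  assumes ex: "exact \<epsilon> y w" and t: "0 \<le> t"
    and wA: "\<And>s. t \<le> s \<Longrightarrow> s \<le> t + h \<Longrightarrow> norm (w s) \<le> \<epsilon> * A"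
  shows "norm (y (t + h) - limit_step t (y t) - \<i> * of_real (\<epsilon>\<^sup>2) * D t (y t) (w (t + h) - w t)) \<le> 14 * L^3 * h * (X + \<epsilon>\<^sup>2)"
    and "norm (y (t + h) - y t) \<le> h * L"
proof -
  define c where "c = h / (2 * \<gamma>)"
  have c: "0 \<le> c" "c \<le> 2 * h" using node_bounds by (auto simp: c_def)
  have tc: "0 \<le> t + c" using t c by simp
  have L: "0 \<le> L" using L_pos by simp
  have L23: "L\<^sup>2 \<le> L^3" "L \<le> L\<^sup>2" "L \<le> L^3" using one_le_L by (auto intro: power_increasing self_le_power)
  define u where "u = y t"
  define e0 where "e0 = E t u"
  define T where "T = Et t u"
  define Q where "Q = D t u (\<i> * e0)"
  define er where "er r = E (t + r) (y (t + r) + \<i> * w (t + r))" for r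
  define pr where "pr r = er r - \<i> * w (t + r) / of_real (\<epsilon>\<^sup>2)" for r
  have tr: "0 \<le> t + r" if "0 \<le> r" for r using t that by simp
  have dy: "((\<lambda>s. y (t + s)) has_vector_derivative - \<i> * er r) (at r within {0..b})" if "0 \<le> r" for r b
    unfolding er_def by (rule shifted_derivative[OF exact_y[OF eps ex tr[OF that]] t])
  have dw: "((\<lambda>s. w (t + s)) has_vector_derivative pr r) (at r within {0..b})" if "0 \<le> r" for r b
    unfolding er_def pr_def by (rule shifted_derivative[OF exact_w[OF eps ex tr[OF that]] t])
  have wr: "norm (w (t + r)) \<le> W" if "0 \<le> r" "r \<le> h" for r
    using wA[of "t + r"] that averaging_weights(2) by simp
  have erL: "norm (er r) \<le> L" if "0 \<le> r" for r unfolding er_def by (rule E_bound[OF tr[OF that]])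
  have y1: "norm (y (t + r) - u) \<le> h * L" if r: "0 \<le> r" "r \<le> h" for r
  proof -
    have "norm (y (t + r) - y (t + 0)) \<le> r * L"
      by (rule norm_increment_le[OF r(1) dy]) (auto simp only: mult_minus_left norm_minus_cancel norm_i_mult erL)
    also have "\<dots> \<le> h * L" using r L by (intro mult_right_mono)
    finally show ?thesis by (simp add: u_def)
  qed
  show "norm (y (t + h) - y t) \<le> h * L" using y1[of h] h by (simp add: u_def)
  have x1: "norm (y (t + r) + \<i> * w (t + r) - u) \<le> h * L + W" if r: "0 \<le> r" "r \<le> h" for r
  proof -
    have "y (t + r) + \<i> * w (t + r) - u = (y (t + r) - u) + \<i> * w (t + r)" by simp
    also have "norm \<dots> \<le> h * L + W" by (intro norm_add_le y1 r) (simp only: norm_i_mult wr r)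
    finally show ?thesis .
  qed
  have e1: "norm (er r - e0) \<le> 2 * L\<^sup>2 * h + L * W" if r: "0 \<le> r" "r \<le> h" for r
  proof -
    have "norm (er r - e0) \<le> L * \<bar>(t + r) - t\<bar> + K * norm (y (t + r) + \<i> * w (t + r) - u)"
      unfolding er_def e0_def by (rule E_diff_bound[OF tr[OF r(1)] t])
    also have "\<dots> \<le> L\<^sup>2 * h + L * (h * L + W)"
      using r L23 L K_le_L x1[OF r] by (intro add_mono mult_mono) auto
    finally show ?thesis by (simp add: power2_eq_square algebra_simps)
  qed
  have y2: "norm (y (t + r) - u + of_real r * (\<i> * e0)) \<le> 3 * L\<^sup>2 * X" if r: "0 \<le> r" "r \<le> h" for r
  proof -
    let ?f = "\<lambda>s. y (t + s) + of_real s * (\<i> * e0)"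
    have "norm (?f r - ?f 0) \<le> r * (2 * L\<^sup>2 * h + L * W)"
    proof (rule norm_increment_le[OF r(1)])
      fix s assume s: "0 \<le> s" "s \<le> r"
      show "(?f has_vector_derivative (- \<i> * er s + \<i> * e0)) (at s within {0..r})"
        by (intro has_vector_derivative_add dy s linear_derivative)
      have "- \<i> * er s + \<i> * e0 = - (\<i> * (er s - e0))" by (simp add: algebra_simps)
      then have "norm (- \<i> * er s + \<i> * e0) = norm (er s - e0)" by (simp only: norm_minus_cancel norm_i_mult)
      then show "norm (- \<i> * er s + \<i> * e0) \<le> 2 * L\<^sup>2 * h + L * W" using e1[of s] s r by simp
    qed
    also have "\<dots> \<le> h * (2 * L\<^sup>2 * h + L * W)" using r h L averaging_weights by (intro mult_right_mono) auto
    also have "\<dots> = 2 * L\<^sup>2 * h\<^sup>2 + L * (h * W)" by (simp add: power2_eq_square algebra_simps)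
    also have "\<dots> \<le> 2 * L\<^sup>2 * X + L\<^sup>2 * X"
      using averaging_weights L23 L h by (intro add_mono mult_mono) auto
    finally show ?thesis by (simp add: u_def algebra_simps)
  qed
  define rem where "rem r = er r - e0 - of_real r * T - D t u (y (t + r) + \<i> * w (t + r) - u)" for r
  have rem: "norm (rem r) \<le> 3 * L^3 * X" if r: "0 \<le> r" "r \<le> h" for r
  proof -
    have "norm (rem r) \<le> L * (((t + r) - t)\<^sup>2 + (norm (y (t + r) + \<i> * w (t + r) - u))\<^sup>2)"
      using taylor[OF tr[OF r(1)] t, of "y (t + r) + \<i> * w (t + r)" u]
      by (simp add: rem_def er_def e0_def T_def scaleR_conv_of_real)
    also have "\<dots> \<le> L * (h\<^sup>2 + (h * L + W)\<^sup>2)"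
      using r x1[OF r] L by (intro mult_left_mono add_mono power_mono) auto
    also have "(h * L + W)\<^sup>2 \<le> 2 * (h * L)\<^sup>2 + 2 * W\<^sup>2"
      using sum_squares_bound[of "h * L" W] by (simp add: power2_sum)
    then have "L * (h\<^sup>2 + (h * L + W)\<^sup>2) \<le> L * (h\<^sup>2 + (2 * (h * L)\<^sup>2 + 2 * W\<^sup>2))"
      using L by (intro mult_left_mono add_left_mono) auto
    also have "\<dots> = L * h\<^sup>2 + 2 * (L^3 * h\<^sup>2) + 2 * (L * W\<^sup>2)" by (simp add: power2_eq_square power3_eq_cube algebra_simps)
    also have "\<dots> \<le> L^3 * h\<^sup>2 + 2 * (L^3 * h\<^sup>2) + 3 * (L^3 * W\<^sup>2)"
    proof (intro add_mono)
      have "L * W\<^sup>2 \<le> L^3 * W\<^sup>2" using L23 by (intro mult_right_mono) auto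
      moreover have "0 \<le> L^3 * W\<^sup>2" using L by simp
      ultimately show "2 * (L * W\<^sup>2) \<le> 3 * (L^3 * W\<^sup>2)" by linarith
    qed (use L23 in \<open>auto intro: mult_right_mono\<close>)
    finally show ?thesis by (simp add: X_def algebra_simps)
  qed
  let ?D = "D t u"
  have Dbl: "bounded_linear ?D" using D_linear[OF t] by (simp add: linear_conv_bounded_linear)
  have main: "norm (y (t + h) - u + of_real h * (\<i> * e0) + of_real (h\<^sup>2 / 2) * (\<i> * (T - Q))
      - \<i> * of_real (\<epsilon>\<^sup>2) * ?D (w (t + h) - w t)) \<le> h * (6 * L^3 * (X + \<epsilon>\<^sup>2))"
  proof -
    let ?f = "\<lambda>s. (y (t + s) + of_real s * (\<i> * e0) + of_real (s\<^sup>2 / 2) * (\<i> * (T - Q)))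
      - \<i> * of_real (\<epsilon>\<^sup>2) * ?D (w (t + s))"
    have "norm (?f h - ?f 0) \<le> h * (6 * L^3 * (X + \<epsilon>\<^sup>2))"
    proof (rule norm_increment_le[OF less_imp_le[OF h]])
      fix s assume s: "0 \<le> s" "s \<le> h"
      let ?f' = "- \<i> * er s + \<i> * e0 + of_real s * (\<i> * (T - Q)) - \<i> * of_real (\<epsilon>\<^sup>2) * ?D (pr s)"
      show "(?f has_vector_derivative ?f') (at s within {0..h})"
        by (intro has_vector_derivative_diff has_vector_derivative_add has_vector_derivative_mult_right
             bounded_linear.has_vector_derivative[OF Dbl] dy dw s linear_derivative quadratic_derivative)
      have p: "of_real (\<epsilon>\<^sup>2) * ?D (pr s) = of_real (\<epsilon>\<^sup>2) * ?D (er s) - ?D (\<i> * w (t + s))"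
      proof -
        have "of_real (\<epsilon>\<^sup>2) * pr s = of_real (\<epsilon>\<^sup>2) * er s - \<i> * w (t + s)"
          using eps by (simp add: pr_def algebra_simps)
        then show ?thesis by (simp only: D_of_real[OF t, symmetric] D_diff[OF t, symmetric])
      qed
      have q: "?D (y (t + s) + \<i> * w (t + s) - u) = ?D (y (t + s) - u + of_real s * (\<i> * e0)) - of_real s * Q + ?D (\<i> * w (t + s))"
        by (simp only: Q_def D_add[OF t] D_diff[OF t] D_of_real[OF t]) simp
      have "?f' = - (\<i> * (rem s + ?D (y (t + s) - u + of_real s * (\<i> * e0)) + of_real (\<epsilon>\<^sup>2) * ?D (er s)))"
        unfolding mult.assoc[of \<i>] p rem_def q by (simp add: algebra_simps)
      then have "norm ?f' = norm (rem s + ?D (y (t + s) - u + of_real s * (\<i> * e0)) + of_real (\<epsilon>\<^sup>2) * ?D (er s))"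
        by (simp only: norm_minus_cancel norm_i_mult)
      also have "\<dots> \<le> 3 * L^3 * X + L * (3 * L\<^sup>2 * X) + \<epsilon>\<^sup>2 * (L * L)"
      proof (intro norm_add3_le rem s)
        show "norm (?D (y (t + s) - u + of_real s * (\<i> * e0))) \<le> L * (3 * L\<^sup>2 * X)"
          by (intro order_trans[OF D_bound_L] mult_left_mono y2 t s L)
        have "norm (?D (er s)) \<le> L * L" by (intro order_trans[OF D_bound_L] mult_left_mono erL t s L)
        then show "norm (of_real (\<epsilon>\<^sup>2) * ?D (er s)) \<le> \<epsilon>\<^sup>2 * (L * L)"
          by (auto simp: norm_mult norm_power intro!: mult_left_mono)
      qed
      also have "\<dots> = 6 * (L^3 * X) + L\<^sup>2 * \<epsilon>\<^sup>2" by (simp add: power2_eq_square power3_eq_cube algebra_simps)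
      also have "\<dots> \<le> 6 * (L^3 * X) + 6 * (L^3 * \<epsilon>\<^sup>2)"
      proof -
        have "L\<^sup>2 * \<epsilon>\<^sup>2 \<le> L^3 * \<epsilon>\<^sup>2" using L23 by (intro mult_right_mono) auto
        moreover have "0 \<le> L^3 * \<epsilon>\<^sup>2" using L by simp
        ultimately show ?thesis by linarith
      qed
      finally show "norm ?f' \<le> 6 * L^3 * (X + \<epsilon>\<^sup>2)" by (simp add: algebra_simps)
    qed
    moreover have "?f h - ?f 0 = y (t + h) - u + of_real h * (\<i> * e0) + of_real (h\<^sup>2 / 2) * (\<i> * (T - Q))
      - \<i> * of_real (\<epsilon>\<^sup>2) * ?D (w (t + h) - w t)"
      unfolding D_diff[OF t] by (simp add: u_def algebra_simps)
    ultimately show ?thesis by metis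
  qed
  have lim: "norm (limit_step t u - u + of_real h * (\<i> * e0) + of_real (h\<^sup>2 / 2) * (\<i> * (T - Q))) \<le> h * (8 * L^3 * X)"
  proof -
    define s where "s = E (t + c) (u - \<i> * of_real c * e0) - e0 - of_real c * T + of_real c * Q"
    have "s = E (t + c) (u - \<i> * of_real c * e0) - E t u - ((t + c) - t) *\<^sub>R Et t u - D t u ((u - \<i> * of_real c * e0) - u)"
    proof -
      have "(u - \<i> * of_real c * e0) - u = - (of_real c * (\<i> * e0))" by simp
      then show ?thesis
        by (simp only: D_minus[OF t] D_of_real[OF t]) (simp add: s_def e0_def T_def Q_def scaleR_conv_of_real)
    qed
    then have "norm s \<le> L * (((t + c) - t)\<^sup>2 + (norm ((u - \<i> * of_real c * e0) - u))\<^sup>2)"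
      using taylor[OF tc t, of "u - \<i> * of_real c * e0" u] by simp
    also have "\<dots> \<le> L * ((2 * h)\<^sup>2 + (2 * h * L)\<^sup>2)"
    proof (intro mult_left_mono add_mono power_mono)
      have "norm ((u - \<i> * of_real c * e0) - u) = norm (of_real c * e0)"
        using c by (simp add: norm_mult)
      also have "\<dots> \<le> 2 * h * norm e0" unfolding c_def by (rule norm_node_mult)
      also have "\<dots> \<le> 2 * h * L" using h E_bound[OF t] by (intro mult_left_mono) (auto simp: e0_def)
      finally show "norm ((u - \<i> * of_real c * e0) - u) \<le> 2 * h * L" .
    qed (use c L in auto)
    also have "\<dots> = 4 * (L * h\<^sup>2) + 4 * (L^3 * h\<^sup>2)" by (simp add: power2_eq_square power3_eq_cube algebra_simps)
    also have "\<dots> \<le> 4 * (L^3 * X) + 4 * (L^3 * X)"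
      using averaging_weights L23 L by (intro add_mono mult_mono mult_left_mono) auto
    finally have s: "norm s \<le> 8 * L^3 * X" by (simp add: mult_ac)
    have gc: "of_real \<gamma> * complex_of_real c = of_real (h / 2)"
      unfolding c_def of_real_mult[symmetric] using gamma_pos by simp
    have hh: "complex_of_real (h\<^sup>2 / 2) = of_real h * of_real (h / 2)" by (simp add: power2_eq_square)
    have "limit_step t u - u + of_real h * (\<i> * e0) + of_real (h\<^sup>2 / 2) * (\<i> * (T - Q)) = - (\<i> * (of_real (\<gamma> * h) * s))"
      unfolding hh gc[symmetric] by (simp add: limit_step_def s_def c_def e0_def algebra_simps)
    then have "norm (limit_step t u - u + of_real h * (\<i> * e0) + of_real (h\<^sup>2 / 2) * (\<i> * (T - Q))) = norm (of_real (\<gamma> * h) * s)"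
      by (simp only: norm_minus_cancel norm_i_mult)
    also have "\<dots> \<le> h * (8 * L^3 * X)" using s h by (intro order_trans[OF norm_gamma_h_le] mult_left_mono) auto
    finally show ?thesis .
  qed
  have d: "norm (a - b - d) \<le> p + q" if "norm (a - z - d) \<le> p" "norm (b - z) \<le> q" for a b z d :: complex and p q
    using norm_triangle_ineq4[of "a - z - d" "b - z"] that by (simp add: algebra_simps)
  have "norm (y (t + h) - limit_step t u - \<i> * of_real (\<epsilon>\<^sup>2) * ?D (w (t + h) - w t)) \<le> h * (6 * L^3 * (X + \<epsilon>\<^sup>2)) + h * (8 * L^3 * X)"
    by (rule d[of _ "u - of_real h * (\<i> * e0) - of_real (h\<^sup>2 / 2) * (\<i> * (T - Q))"])
       (use main lim in \<open>simp_all add: algebra_simps\<close>)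
  also have "h * (8 * L^3 * X) \<le> h * (8 * L^3 * (X + \<epsilon>\<^sup>2))" using h L by (intro mult_left_mono) auto
  finally show "norm (y (t + h) - limit_step t (y t) - \<i> * of_real (\<epsilon>\<^sup>2) * D t (y t) (w (t + h) - w t)) \<le> 14 * L^3 * h * (X + \<epsilon>\<^sup>2)"
    by (simp add: u_def algebra_simps)
qed

text \<open>Summation by parts: subtracting the corrector \<open>\<i> \<epsilon>\<^sup>2 D t u w\<close> removes the increment of \<open>w\<close> and leaves the
variation of the slope over one step, which is of order \<open>h\<close>.\<close>
lemma corrected_step:
  fixes u u' w w' :: complex
  assumes t: "0 \<le> t" and du: "norm (u' - u) \<le> 2 * h * L" and w: "norm w \<le> W" "norm w' \<le> W"
    and step: "norm (u' - limit_step t u - \<i> * of_real (\<epsilon>\<^sup>2) * D t u (w' - w)) \<le> 14 * L^3 * h * (X + \<epsilon>\<^sup>2)"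
  shows "norm ((u' - \<i> * of_real (\<epsilon>\<^sup>2) * D (t + h) u' w') - limit_step t (u - \<i> * of_real (\<epsilon>\<^sup>2) * D t u w))
     \<le> 21 * L^3 * h * (X + \<epsilon>\<^sup>2)"
proof -
  have L: "0 \<le> L" using L_pos by simp
  have L23: "L\<^sup>2 \<le> L^3" "L \<le> L\<^sup>2" "L \<le> L^3" using one_le_L by (auto intro: power_increasing self_le_power)
  define k where "k = \<i> * complex_of_real (\<epsilon>\<^sup>2)"
  have nk: "norm (k * z) = \<epsilon>\<^sup>2 * norm z" for z by (simp add: k_def norm_mult norm_power)
  define z where "z = u - k * D t u w"
  have th: "0 \<le> t + h" using t h by simp
  have hK: "h * K \<le> h * L" using h K_le_L by (intro mult_left_mono) auto
  have uz: "norm (u - z) \<le> \<epsilon>\<^sup>2 * (L * W)"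
    unfolding z_def using D_bound_L[OF t, of u w] mult_left_mono[OF w(1) L]
    by (auto simp: nk intro!: mult_left_mono)
  have 1: "norm (limit_step t u - limit_step t z - (u - z)) \<le> 4 * (L^3 * h * (X + \<epsilon>\<^sup>2))"
  proof -
    have "norm (limit_step t u - limit_step t z - (u - z)) \<le> 2 * (h * K) * (1 + h * K) * norm (u - z)"
      by (rule limit_step_increment_lipschitz[OF t])
    also have "\<dots> \<le> 2 * (h * L) * (1 + h * L) * (\<epsilon>\<^sup>2 * (L * W))"
      using hK uz h L K_nonneg by (intro mult_mono add_mono) auto
    also have "\<dots> = 2 * h * (L\<^sup>2 * (\<epsilon>\<^sup>2 * W) + L^3 * (\<epsilon>\<^sup>2 * (h * W)))"
      by (simp add: power2_eq_square power3_eq_cube algebra_simps)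
    also have "\<dots> \<le> 2 * h * (L^3 * (X + \<epsilon>\<^sup>2) + L^3 * (X + \<epsilon>\<^sup>2))"
    proof (intro mult_left_mono add_mono mult_mono)
      show "\<epsilon>\<^sup>2 * (h * W) \<le> X + \<epsilon>\<^sup>2" using averaging_weights(9) by (simp add: add_increasing2)
    qed (use h L L23 averaging_weights in auto)
    finally show ?thesis by (simp add: algebra_simps)
  qed
  have 2: "norm (k * (D t u w' - D (t + h) u' w')) \<le> 3 * (L^3 * h * (X + \<epsilon>\<^sup>2))"
  proof -
    have "norm (D t u w' - D (t + h) u' w') \<le> L * (\<bar>t - (t + h)\<bar> + norm (u - u')) * norm w'"
      by (rule D_lipschitz[OF t th])
    also have "\<dots> \<le> L * (h + 2 * h * L) * W"
      using du w h L by (intro mult_mono add_mono) (auto simp: norm_minus_commute)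
    finally have "norm (k * (D t u w' - D (t + h) u' w')) \<le> \<epsilon>\<^sup>2 * (L * (h + 2 * h * L) * W)"
      unfolding nk by (intro mult_left_mono) auto
    also have "\<dots> = h * (L * (\<epsilon>\<^sup>2 * W) + 2 * (L\<^sup>2 * (\<epsilon>\<^sup>2 * W)))" by (simp add: power2_eq_square algebra_simps)
    also have "\<dots> \<le> h * (L^3 * (X + \<epsilon>\<^sup>2) + 2 * (L^3 * (X + \<epsilon>\<^sup>2)))"
      using averaging_weights L23 h L by (intro mult_left_mono add_mono mult_mono) auto
    finally show ?thesis by (simp add: algebra_simps)
  qed
  have "(u' - k * D (t + h) u' w') - limit_step t z
     = (u' - limit_step t u - k * D t u (w' - w)) + (limit_step t u - limit_step t z - (u - z)) + k * (D t u w' - D (t + h) u' w')"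
    unfolding D_diff[OF t] by (simp add: z_def algebra_simps)
  also have "norm \<dots> \<le> 14 * L^3 * h * (X + \<epsilon>\<^sup>2) + 4 * (L^3 * h * (X + \<epsilon>\<^sup>2)) + 3 * (L^3 * h * (X + \<epsilon>\<^sup>2))"
    using step by (intro norm_add3_le 1 2) (simp add: k_def)
  also have "\<dots> = 21 * L^3 * h * (X + \<epsilon>\<^sup>2)" by simp
  finally show ?thesis unfolding z_def k_def .
qed

lemma asymptotic_convergence:
  assumes ex: "exact \<epsilon> y w" and s: "scheme_seq ys ws"
    and init: "ys 0 = y 0" "ws 0 = w 0"
    and wA: "\<And>s. 0 \<le> s \<Longrightarrow> s \<le> real n * h \<Longrightarrow> norm (w s) \<le> \<epsilon> * A"
    and wsA: "\<And>k. k \<le> n \<Longrightarrow> norm (ws k) \<le> \<epsilon> * A"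
  shows "norm (ys n - y (real n * h))
     \<le> exp (2 * K * (real n * h)) * (1 + real n * h) * (42 * L^3 * (X + \<epsilon>\<^sup>2))"
proof -
  have L: "0 \<le> L" using L_pos by simp
  have L23: "L \<le> L^3" using one_le_L by (auto intro: power_increasing self_le_power)
  let ?corr = "\<lambda>t u w. u - \<i> * of_real (\<epsilon>\<^sup>2) * D t u w"
  define zs where "zs k = ?corr (real k * h) (ys k) (ws k)" for k
  define ze where "ze k = ?corr (real k * h) (y (real k * h)) (w (real k * h))" for k
  let ?B = "42 * L^3 * h * (X + \<epsilon>\<^sup>2)"
  have B: "0 \<le> ?B" using L h averaging_weights by simp
  have "norm (zs k - ze k) \<le> exp (2 * K * h * real k) * (?B * real k)" if "k \<le> n" for k
    using that
  proof (induction k)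
    case 0
    then show ?case using init by (simp add: zs_def ze_def)
  next
    case (Suc k)
    let ?t = "real k * h"
    have t: "0 \<le> ?t" using h by simp
    have t': "real (Suc k) * h = ?t + h" by (simp add: algebra_simps)
    have "real (Suc k) * h \<le> real n * h" using Suc.prems h by (intro mult_right_mono) auto
    then have w: "norm (w s) \<le> \<epsilon> * A" if "?t \<le> s" "s \<le> ?t + h" for s
      using wA[of s] that t unfolding t' by linarith
    have st: "ys (Suc k) = next_y E \<epsilon> h ?t (ys k) (ws k)" "ws (Suc k) = next_w E \<epsilon> h ?t (ys k) (ws k)"
      using s by (auto simp: scheme_seq_def)
    have wW: "norm z \<le> W" if "norm z \<le> \<epsilon> * A" for z :: complex using that averaging_weights(2) by linarith
    have ws: "norm (ws k) \<le> \<epsilon> * A" "norm (ws (Suc k)) \<le> \<epsilon> * A" using wsA Suc.prems by auto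
    have 1: "norm (zs (Suc k) - limit_step ?t (zs k)) \<le> 21 * L^3 * h * (X + \<epsilon>\<^sup>2)"
      unfolding zs_def t'
    proof (rule corrected_step[OF t])
      show "norm (ys (Suc k) - ys k) \<le> 2 * h * L" unfolding st by (rule next_y_diff[OF t])
      show "norm (ys (Suc k) - limit_step ?t (ys k) - \<i> * of_real (\<epsilon>\<^sup>2) * D ?t (ys k) (ws (Suc k) - ws k)) \<le> 14 * L^3 * h * (X + \<epsilon>\<^sup>2)"
        using scheme_averaging[OF t ws(1), of "ys k"] ws(2) unfolding st by simp
    qed (use ws wW in auto)
    have 2: "norm (ze (Suc k) - limit_step ?t (ze k)) \<le> 21 * L^3 * h * (X + \<epsilon>\<^sup>2)"
      unfolding ze_def t'
    proof (rule corrected_step[OF t])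
      show "norm (y (?t + h) - y ?t) \<le> 2 * h * L"
        using exact_averaging(2)[OF ex t w] h L mult_nonneg_nonneg[of h L] by linarith
      show "norm (y (?t + h) - limit_step ?t (y ?t) - \<i> * of_real (\<epsilon>\<^sup>2) * D ?t (y ?t) (w (?t + h) - w ?t)) \<le> 14 * L^3 * h * (X + \<epsilon>\<^sup>2)"
        by (rule exact_averaging(1)[OF ex t w])
    qed (use w wW h in auto)
    have "norm (zs (Suc k) - ze (Suc k)) \<le> norm (zs (Suc k) - limit_step ?t (zs k)) + norm (limit_step ?t (zs k) - limit_step ?t (ze k))
        + norm (ze (Suc k) - limit_step ?t (ze k))"
      by norm
    also have "\<dots> \<le> 21 * L^3 * h * (X + \<epsilon>\<^sup>2) + exp (2 * K * h) * norm (zs k - ze k) + 21 * L^3 * h * (X + \<epsilon>\<^sup>2)"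
      by (intro add_mono 1 2 limit_step_lipschitz[OF t])
    also have "\<dots> = exp (2 * K * h) * norm (zs k - ze k) + 1 * ?B" by simp
    also have "\<dots> \<le> exp (2 * K * h) * (exp (2 * K * h * real k) * (?B * real k)) + exp (2 * K * h * real (Suc k)) * ?B"
    proof (intro add_mono mult_left_mono mult_right_mono B)
      have "0 \<le> 2 * K * h * real (Suc k)" using K_nonneg h by simp
      then show "1 \<le> exp (2 * K * h * real (Suc k))" by simp
    qed (use Suc in auto)
    also have "exp (2 * K * h) * (exp (2 * K * h * real k) * (?B * real k)) = exp (2 * K * h * real (Suc k)) * (?B * real k)"
      by (simp add: distrib_left exp_add)
    finally show ?case by (simp add: algebra_simps)
  qed
  then have z: "norm (zs n - ze n) \<le> exp (2 * K * (real n * h)) * (?B * real n)" by (simp add: mult_ac)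
  have tn: "0 \<le> real n * h" using h by simp
  have corr: "norm (\<i> * of_real (\<epsilon>\<^sup>2) * D (real n * h) u v) \<le> L^3 * (X + \<epsilon>\<^sup>2)" if "norm v \<le> \<epsilon> * A" for u v
  proof -
    have "norm (\<i> * of_real (\<epsilon>\<^sup>2) * D (real n * h) u v) = \<epsilon>\<^sup>2 * norm (D (real n * h) u v)" by (simp add: norm_mult norm_power)
    also have "\<dots> \<le> \<epsilon>\<^sup>2 * (L * W)"
      using that averaging_weights(2) L by (intro mult_left_mono order_trans[OF D_bound_L[OF tn]]) auto
    also have "\<dots> = L * (\<epsilon>\<^sup>2 * W)" by simp
    also have "\<dots> \<le> L^3 * (X + \<epsilon>\<^sup>2)" using averaging_weights L23 L by (intro mult_mono) auto
    finally show ?thesis .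
  qed
  have "ys n - y (real n * h) = (zs n - ze n) + \<i> * of_real (\<epsilon>\<^sup>2) * D (real n * h) (ys n) (ws n)
     + - (\<i> * of_real (\<epsilon>\<^sup>2) * D (real n * h) (y (real n * h)) (w (real n * h)))"
    by (simp add: zs_def ze_def)
  also have "norm \<dots> \<le> exp (2 * K * (real n * h)) * (?B * real n) + L^3 * (X + \<epsilon>\<^sup>2) + L^3 * (X + \<epsilon>\<^sup>2)"
    using wA[of "real n * h"] wsA[of n] tn by (intro norm_add3_le z corr) (auto simp only: norm_minus_cancel intro!: corr)
  also have "\<dots> = exp (2 * K * (real n * h)) * (?B * real n) + 1 * (2 * (L^3 * (X + \<epsilon>\<^sup>2)))" by simp
  also have "\<dots> \<le> exp (2 * K * (real n * h)) * (?B * real n) + exp (2 * K * (real n * h)) * (42 * (L^3 * (X + \<epsilon>\<^sup>2)))"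
    using K_nonneg tn L averaging_weights by (intro add_left_mono mult_mono) auto
  finally show ?thesis by (simp add: algebra_simps)
qed

end

end

section \<open>Combination of the two error estimates\<close>

text \<open>For \<open>\<epsilon> \<ge> 1\<close> the left-hand side does not decay, and it is the factor \<open>1 + \<epsilon>\<^sup>2 + A\<^sup>2\<close> that makes up for the decay of
\<open>(1 + \<epsilon>^3) / \<epsilon>^5\<close>. In terms of \<open>e = 1 / \<epsilon>\<close> all terms are compared with \<open>e\<^sup>2\<close> or \<open>e^5\<close> using \<open>\<epsilon> e = 1\<close>.\<close>
lemma classical_weight_bound:
  fixes \<epsilon> A :: real
  assumes eps: "0 < \<epsilon>" and A: "0 \<le> A"
  shows "(1 + A / \<epsilon>)\<^sup>2 + (1 + A / \<epsilon>) * (1 + 1 / \<epsilon>\<^sup>2)\<^sup>2 \<le> 5 * (1 + \<epsilon>\<^sup>2 + A\<^sup>2) * (1 / \<epsilon>^5 * (1 + \<epsilon>^3))"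
proof -
  define e where "e = 1 / \<epsilon>"
  have e: "0 \<le> e" and ee: "\<epsilon> * e = 1" using eps by (auto simp: e_def)
  have ee2: "\<epsilon>\<^sup>2 * e\<^sup>2 = 1" using ee by (metis power_mult_distrib power_one)
  have R: "1 / \<epsilon>^5 * (1 + \<epsilon>^3) = e^5 + e\<^sup>2"
  proof -
    have "e^5 * \<epsilon>^3 = e\<^sup>2 * (\<epsilon> * e)^3" by (simp only: power_mult_distrib) (simp add: power_numeral_reduce)
    then show ?thesis using ee by (simp add: e_def power_divide distrib_left)
  qed
  have 1: "(1 + A * e)\<^sup>2 \<le> 2 * ((\<epsilon>\<^sup>2 + A\<^sup>2) * e\<^sup>2)"
  proof -
    have "(1 + A * e)\<^sup>2 \<le> 2 * 1 + 2 * (A * e)\<^sup>2"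
      using sum_squares_bound[of 1 "A * e"] by (simp add: power2_sum)
    then show ?thesis using ee2 by (simp add: power_mult_distrib distrib_right)
  qed
  have 2: "(1 + e\<^sup>2)\<^sup>2 \<le> 2 + 2 * e^4"
    using sum_squares_bound[of 1 "e\<^sup>2"] by (simp add: power2_sum)
  have 3: "2 * e^4 \<le> (1 + \<epsilon>\<^sup>2) * e^5"
  proof -
    have "\<epsilon>\<^sup>2 * e^5 = (\<epsilon>\<^sup>2 * e\<^sup>2) * e^3" by (simp add: power_numeral_reduce)
    then have "(1 + \<epsilon>\<^sup>2) * e^5 - 2 * e^4 = e^5 + e^3 - 2 * e^4" using ee2 by (simp add: distrib_right)
    also have "\<dots> = e^3 * (1 - e)\<^sup>2" by (simp add: power2_eq_square power_numeral_reduce algebra_simps)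
    finally show ?thesis using e by (smt (verit) zero_le_power2 zero_le_power mult_nonneg_nonneg)
  qed
  have 4: "2 * (A * e) \<le> (\<epsilon>\<^sup>2 + A\<^sup>2) * e\<^sup>2"
    using sum_squares_bound[of 1 "A * e"] ee2 by (simp add: power_mult_distrib distrib_right)
  have 5: "2 * (A * e^5) \<le> (1 + A\<^sup>2) * e^5"
    using mult_right_mono[OF sum_squares_bound[of 1 A], of "e^5"] e by (simp add: mult_ac)
  have "(1 + A * e) * (1 + e\<^sup>2)\<^sup>2 \<le> (1 + A * e) * (2 + 2 * e^4)"
    using 2 A e by (intro mult_left_mono) auto
  also have "\<dots> = 2 + 2 * e^4 + 2 * (A * e) + 2 * (A * e^5)"
    by (simp add: power_numeral_reduce algebra_simps)
  also have "\<dots> \<le> 2 * (\<epsilon>\<^sup>2 * e\<^sup>2) + (1 + \<epsilon>\<^sup>2) * e^5 + (\<epsilon>\<^sup>2 + A\<^sup>2) * e\<^sup>2 + (1 + A\<^sup>2) * e^5"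
    using 3 4 5 ee2 by simp
  finally have "(1 + A * e)\<^sup>2 + (1 + A * e) * (1 + e\<^sup>2)\<^sup>2
      \<le> 2 * ((\<epsilon>\<^sup>2 + A\<^sup>2) * e\<^sup>2) + (2 * (\<epsilon>\<^sup>2 * e\<^sup>2) + (1 + \<epsilon>\<^sup>2) * e^5 + (\<epsilon>\<^sup>2 + A\<^sup>2) * e\<^sup>2 + (1 + A\<^sup>2) * e^5)"
    using 1 by linarith
  also have "\<dots> = (5 * \<epsilon>\<^sup>2 + 3 * A\<^sup>2) * e\<^sup>2 + (2 + \<epsilon>\<^sup>2 + A\<^sup>2) * e^5" by (simp add: algebra_simps)
  also have "\<dots> \<le> (5 * (1 + \<epsilon>\<^sup>2 + A\<^sup>2)) * e\<^sup>2 + (5 * (1 + \<epsilon>\<^sup>2 + A\<^sup>2)) * e^5"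
    using e by (intro add_mono mult_right_mono) auto
  also have "\<dots> = 5 * (1 + \<epsilon>\<^sup>2 + A\<^sup>2) * (e^5 + e\<^sup>2)" by (simp add: algebra_simps)
  finally show ?thesis unfolding R by (simp add: e_def power_divide)
qed

context scheme begin

text \<open>The bound \<open>A\<close> on the velocity contributes \<open>exp (6 K T) (1 + T)\<^sup>2 (1 + \<epsilon>\<^sup>2 + V\<^sup>2)\<close> through its square, and the
accumulation of local errors one more factor \<open>1 + T\<close>; the rate 52 is 46 + 6.\<close>
lemma error_bounds:
  fixes n :: nat and V :: real
  assumes ex: "exact \<epsilon> y w" and s: "scheme_seq ys ws"
    and init: "ys 0 = y 0" "ws 0 = w 0" and V: "norm (w 0) = \<epsilon> * V"
  defines "T \<equiv> real n * h"
  defines "F \<equiv> exp (52 * K * T) * (1 + T)^3 * (1 + \<epsilon>\<^sup>2 + V\<^sup>2)"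
  shows "norm (ys n - y T) \<le> 600000 * L^9 * F * min (h\<^sup>2 / \<epsilon>^5 * (1 + \<epsilon>^3)) (\<epsilon>\<^sup>2 + h\<^sup>2)" (is ?Y)
    and "norm ((ys n + \<i> * ws n) - (y T + \<i> * w T)) \<le> 600000 * L^9 * F * min (h\<^sup>2 / \<epsilon>^5 * (1 + \<epsilon>^3)) (\<epsilon> + h\<^sup>2)" (is ?X)
proof -
  have T: "0 \<le> T" using h by (simp add: T_def)
  have L: "0 \<le> L" using L_pos by simp
  have V0: "0 \<le> V" using V eps by (metis norm_ge_zero zero_le_mult_iff less_le_not_le)
  define A where "A = 15 * L\<^sup>2 * exp (3 * K * T) * (1 + T) * (V + \<epsilon>)"
  have A: "0 \<le> A" using T V0 eps by (simp add: A_def)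
  define Q where "Q = 450 * L^4 * exp (6 * K * T) * (1 + T)\<^sup>2"
  define M where "M = 1 + \<epsilon>\<^sup>2 + V\<^sup>2"
  have M: "1 \<le> M" by (simp add: M_def)
  have L2: "1 \<le> L\<^sup>2" "1 \<le> L^4" using one_le_L by (auto intro: one_le_power)
  have eT: "1 \<le> exp (6 * K * T)" "1 \<le> exp (3 * K * T)" using K_nonneg T by auto
  have Q: "1 \<le> Q"
  proof -
    have "1 * 1 * 1 * 1 \<le> 450 * L^4 * exp (6 * K * T) * (1 + T)\<^sup>2"
      using L2 eT T by (intro mult_mono) auto
    then show ?thesis by (simp add: Q_def)
  qed
  have AQ: "1 + \<epsilon>\<^sup>2 + A\<^sup>2 \<le> 2 * (Q * M)"
  proof -
    have "A\<^sup>2 = 225 * L^4 * exp (6 * K * T) * (1 + T)\<^sup>2 * (V + \<epsilon>)\<^sup>2"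
      by (simp add: A_def power_mult_distrib exp_double[symmetric])
    also have "\<dots> \<le> 225 * L^4 * exp (6 * K * T) * (1 + T)\<^sup>2 * (2 * (V\<^sup>2 + \<epsilon>\<^sup>2))"
    proof (intro mult_left_mono)
      show "(V + \<epsilon>)\<^sup>2 \<le> 2 * (V\<^sup>2 + \<epsilon>\<^sup>2)" using sum_squares_bound[of V \<epsilon>] by (simp add: power2_sum)
    qed (use L in auto)
    also have "\<dots> = Q * (V\<^sup>2 + \<epsilon>\<^sup>2)" by (simp add: Q_def)
    also have "\<dots> \<le> Q * M" using Q by (intro mult_left_mono) (auto simp: M_def)
    finally have "A\<^sup>2 \<le> Q * M" .
    moreover have "1 * (1 + \<epsilon>\<^sup>2) \<le> Q * M" using Q by (intro mult_mono) (auto simp: M_def)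
    ultimately show ?thesis by simp
  qed
  have AA: "exp c * (\<epsilon> * V + b * L\<^sup>2 * \<epsilon>\<^sup>2 * (1 + r)) \<le> \<epsilon> * A"
    if "c \<le> 3 * K * T" "b \<le> 15" "0 \<le> b" "0 \<le> r" "r \<le> T" for b c r
  proof -
    have "\<epsilon> * V + b * L\<^sup>2 * \<epsilon>\<^sup>2 * (1 + r) \<le> \<epsilon> * V * (15 * L\<^sup>2 * (1 + T)) + 15 * L\<^sup>2 * \<epsilon>\<^sup>2 * (1 + T)"
    proof (intro add_mono)
      have "1 * 1 * 1 \<le> 15 * L\<^sup>2 * (1 + T)" using L2 T by (intro mult_mono) auto
      then show "\<epsilon> * V \<le> \<epsilon> * V * (15 * L\<^sup>2 * (1 + T))"
        using mult_left_mono[of 1 "15 * L\<^sup>2 * (1 + T)" "\<epsilon> * V"] V0 eps by simp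
      show "b * L\<^sup>2 * \<epsilon>\<^sup>2 * (1 + r) \<le> 15 * L\<^sup>2 * \<epsilon>\<^sup>2 * (1 + T)"
        using that T by (intro mult_mono) auto
    qed
    also have "\<dots> = \<epsilon> * (15 * L\<^sup>2 * (1 + T) * (V + \<epsilon>))" by (simp add: power2_eq_square algebra_simps)
    finally have "exp c * (\<epsilon> * V + b * L\<^sup>2 * \<epsilon>\<^sup>2 * (1 + r)) \<le> exp (3 * K * T) * (\<epsilon> * (15 * L\<^sup>2 * (1 + T) * (V + \<epsilon>)))"
      using that V0 eps by (intro mult_mono) auto
    then show ?thesis by (simp add: A_def mult_ac)
  qed
  have wA: "norm (w r) \<le> \<epsilon> * A" if r: "0 \<le> r" "r \<le> T" for r
  proof -
    have "K * r \<le> K * T" "K * T \<le> 3 * K * T" using r K_nonneg T by (auto intro: mult_left_mono)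
    then show ?thesis
      using exact_w_bound[OF eps ex r(1)] AA[of "K * r" 4 r] r unfolding V by linarith
  qed
  have wsA: "norm (ws k) \<le> \<epsilon> * A" if k: "k \<le> n" for k
  proof -
    have r: "0 \<le> real k * h" "real k * h \<le> T" using k h by (auto simp: T_def)
    then have "3 * K * (real k * h) \<le> 3 * K * T" using K_nonneg by (intro mult_left_mono) auto
    then show ?thesis
      using scheme_w_bound[OF s, of k] AA[of "3 * K * (real k * h)" 15 "real k * h"] r
      unfolding init(2) V by linarith
  qed
  define errY where "errY = norm (ys n - y T)"
  define errW where "errW = norm (ws n - w T)"
  have err0: "0 \<le> errY" "0 \<le> errW" by (auto simp: errY_def errW_def)
  have QF: "exp (c * K * T) * (1 + T) * (Q * M) \<le> 450 * L^4 * F" if "c \<le> 46" for c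
  proof -
    have "exp (c * K * T) * (1 + T) * (Q * M) = 450 * L^4 * (exp ((c + 6) * K * T) * (1 + T)^3 * M)"
    proof -
      have "exp ((c + 6) * K * T) = exp (c * K * T) * exp (6 * K * T)"
        by (simp add: exp_add[symmetric] algebra_simps)
      then show ?thesis by (simp add: Q_def power2_eq_square power3_eq_cube)
    qed
    also have "\<dots> \<le> 450 * L^4 * (exp (52 * K * T) * (1 + T)^3 * M)"
      using that K_nonneg T L M by (intro mult_left_mono mult_right_mono) (auto intro!: mult_right_mono)
    finally show ?thesis by (simp add: F_def M_def)
  qed
  have F0: "0 \<le> F" using T M by (simp add: F_def M_def)
  have L9: "L^4 * L^3 \<le> L^9" "L^4 * L^5 \<le> L^9" "L^4 \<le> L^9"
    using one_le_L by (auto simp: power_add[symmetric] intro!: power_increasing)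
  define k1 where "k1 = h\<^sup>2 / \<epsilon>^5 * (1 + \<epsilon>^3)"
  have k1: "0 \<le> k1" using eps by (simp add: k1_def)
  have cl: "errY + errW \<le> 252000 * L^9 * F * k1"
  proof -
    have "errY + errW \<le> exp (46 * K * T) * T * (56 * L^3 * h\<^sup>2 * ((1 + A / \<epsilon>)\<^sup>2 + (1 + A / \<epsilon>) * (1 + 1 / \<epsilon>\<^sup>2)\<^sup>2))"
      using classical_convergence[OF A ex s init, of n] wA unfolding errY_def errW_def T_def by simp
    also have "\<dots> \<le> exp (46 * K * T) * (1 + T) * (56 * L^3 * h\<^sup>2 * (5 * (2 * (Q * M)) * (1 / \<epsilon>^5 * (1 + \<epsilon>^3))))"
    proof (intro mult_mono mult_left_mono order_trans[OF classical_weight_bound[OF eps A]] mult_right_mono AQ)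
    qed (use T L eps A Q M in auto)
    also have "\<dots> = (exp (46 * K * T) * (1 + T) * (Q * M)) * (560 * L^3 * k1)"
      by (simp add: k1_def)
    also have "\<dots> \<le> (450 * L^4 * F) * (560 * L^3 * k1)"
      using QF[of 46] L k1 by (intro mult_right_mono) auto
    also have "\<dots> = 252000 * (L^4 * L^3) * (F * k1)" by simp
    also have "\<dots> \<le> 252000 * L^9 * (F * k1)" using L9 F0 k1 by (intro mult_right_mono mult_left_mono) auto
    finally show ?thesis by (simp add: mult_ac)
  qed
  have apY: "errY \<le> 113400 * 2 * L^9 * F * (\<epsilon>\<^sup>2 + h\<^sup>2)" if e1: "\<epsilon> \<le> 1"
  proof -
    have "errY \<le> exp (2 * K * T) * (1 + T) * (42 * L^3 * (h\<^sup>2 + (\<epsilon> * (A + L))\<^sup>2 + \<epsilon>\<^sup>2))"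
      using asymptotic_convergence[OF A e1 ex s init, of n] wA wsA unfolding errY_def T_def by simp
    also have "\<dots> \<le> exp (2 * K * T) * (1 + T) * (42 * L^3 * (3 * L\<^sup>2 * (2 * (Q * M)) * (\<epsilon>\<^sup>2 + h\<^sup>2)))"
    proof (intro mult_left_mono)
      have "(A + L)\<^sup>2 + 1 \<le> 2 * A\<^sup>2 + 2 * L\<^sup>2 + 1" using sum_squares_bound[of A L] by (simp add: power2_sum)
      also have "\<dots> \<le> 2 * (L\<^sup>2 * A\<^sup>2) + 2 * L\<^sup>2 + L\<^sup>2"
        using L2 mult_right_mono[OF L2(1), of "A\<^sup>2"] by simp
      also have "\<dots> \<le> 3 * L\<^sup>2 * (1 + \<epsilon>\<^sup>2 + A\<^sup>2)"
      proof -
        have "0 \<le> L\<^sup>2 * A\<^sup>2" "0 \<le> L\<^sup>2 * \<epsilon>\<^sup>2" by auto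
        then show ?thesis by (simp add: distrib_left)
      qed
      also have "\<dots> \<le> 3 * L\<^sup>2 * (2 * (Q * M))" using AQ by (intro mult_left_mono) auto
      finally have *: "(A + L)\<^sup>2 + 1 \<le> 3 * L\<^sup>2 * (2 * (Q * M))" .
      moreover have "0 \<le> (A + L)\<^sup>2" by simp
      ultimately have **: "1 \<le> 3 * L\<^sup>2 * (2 * (Q * M))" by linarith
      have "h\<^sup>2 + (\<epsilon> * (A + L))\<^sup>2 + \<epsilon>\<^sup>2 = 1 * h\<^sup>2 + ((A + L)\<^sup>2 + 1) * \<epsilon>\<^sup>2"
        by (simp add: power_mult_distrib distrib_right)
      also have "\<dots> \<le> 3 * L\<^sup>2 * (2 * (Q * M)) * h\<^sup>2 + 3 * L\<^sup>2 * (2 * (Q * M)) * \<epsilon>\<^sup>2"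
        by (intro add_mono mult_right_mono * **) auto
      finally show "h\<^sup>2 + (\<epsilon> * (A + L))\<^sup>2 + \<epsilon>\<^sup>2 \<le> 3 * L\<^sup>2 * (2 * (Q * M)) * (\<epsilon>\<^sup>2 + h\<^sup>2)"
        by (simp add: distrib_left)
    qed (use T L in auto)
    also have "\<dots> = (exp (2 * K * T) * (1 + T) * (Q * M)) * (252 * (L^3 * L\<^sup>2) * (\<epsilon>\<^sup>2 + h\<^sup>2))" by simp
    also have "\<dots> \<le> (450 * L^4 * F) * (252 * (L^3 * L\<^sup>2) * (\<epsilon>\<^sup>2 + h\<^sup>2))"
      using QF[of 2] L by (intro mult_right_mono) auto
    also have "\<dots> = 113400 * (L^4 * L^5) * (F * (\<epsilon>\<^sup>2 + h\<^sup>2))" by (simp add: power_numeral_reduce)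
    also have "\<dots> \<le> 113400 * 2 * L^9 * (F * (\<epsilon>\<^sup>2 + h\<^sup>2))"
      using L9 F0 L by (intro mult_right_mono mult_mono) auto
    finally show ?thesis by (simp add: mult_ac)
  qed
  have apX: "errY + errW \<le> 300000 * L^9 * F * (\<epsilon> + h\<^sup>2)" if e1: "\<epsilon> \<le> 1"
  proof -
    have "errW \<le> 2 * (\<epsilon> * A)"
      unfolding errW_def using wA[of T] wsA[of n] T norm_triangle_ineq4[of "ws n" "w T"] by simp
    also have "\<dots> = \<epsilon> * (2 * A)" by simp
    also have "\<dots> \<le> \<epsilon> * (1 + \<epsilon>\<^sup>2 + A\<^sup>2)"
    proof (intro mult_left_mono)
      have "2 * A \<le> 1 + A\<^sup>2" using sum_squares_bound[of 1 A] by simp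
      then show "2 * A \<le> 1 + \<epsilon>\<^sup>2 + A\<^sup>2" using zero_le_power2[of \<epsilon>] by linarith
    qed (use eps in auto)
    also have "\<dots> \<le> \<epsilon> * (2 * (Q * M))" using AQ eps by (intro mult_left_mono) auto
    also have "\<dots> \<le> \<epsilon> * (2 * (exp (0 * K * T) * (1 + T) * (Q * M)))"
    proof -
      have "0 \<le> Q * M" using Q M by simp
      then have "Q * M \<le> (1 + T) * (Q * M)" using mult_right_mono[of 1 "1 + T" "Q * M"] T by simp
      then show ?thesis using eps by (intro mult_left_mono) auto
    qed
    also have "\<dots> \<le> \<epsilon> * (2 * (450 * L^4 * F))" using QF[of 0] eps by (intro mult_left_mono) auto
    also have "\<dots> = 900 * L^4 * (F * \<epsilon>)" by simp
    also have "\<dots> \<le> 900 * L^9 * (F * (\<epsilon> + h\<^sup>2))" using L9 F0 L eps by (intro mult_mono) auto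
    also have "\<dots> = 900 * (L^9 * F * (\<epsilon> + h\<^sup>2))" by simp
    finally have W: "errW \<le> 900 * (L^9 * F * (\<epsilon> + h\<^sup>2))" .
    have "\<epsilon>\<^sup>2 \<le> \<epsilon>" using e1 eps by (simp add: power2_eq_square mult_le_one)
    then have "L^9 * F * (\<epsilon>\<^sup>2 + h\<^sup>2) \<le> L^9 * F * (\<epsilon> + h\<^sup>2)" using L F0 by (intro mult_left_mono) auto
    moreover have "errY \<le> 226800 * (L^9 * F * (\<epsilon>\<^sup>2 + h\<^sup>2))" using apY[OF e1] by (simp add: mult.assoc)
    moreover have "0 \<le> L^9 * F * (\<epsilon> + h\<^sup>2)" using L F0 eps by simp
    ultimately have "errY + errW \<le> 300000 * (L^9 * F * (\<epsilon> + h\<^sup>2))" using W by linarith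
    then show ?thesis by (simp add: mult.assoc)
  qed
  have k1h: "k1 \<le> 2 * h\<^sup>2" if "1 \<le> \<epsilon>"
  proof -
    have "1 + \<epsilon>^3 \<le> \<epsilon>^5 + \<epsilon>^5" using that by (intro add_mono one_le_power power_increasing) auto
    then have "(1 + \<epsilon>^3) / \<epsilon>^5 \<le> 2" using eps by (simp add: divide_le_eq)
    then have "h\<^sup>2 * ((1 + \<epsilon>^3) / \<epsilon>^5) \<le> h\<^sup>2 * 2" by (intro mult_left_mono) auto
    then show ?thesis by (simp add: k1_def mult_ac)
  qed
  have LF: "0 \<le> L^9 * F" using L F0 by simp
  have comb: "e \<le> 600000 * L^9 * F * min k1 k2"
    if "e \<le> errY + errW" "0 \<le> k2" "h\<^sup>2 \<le> k2" "\<epsilon> \<le> 1 \<Longrightarrow> e \<le> 300000 * (L^9 * F) * k2" for e k2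
  proof -
    have e1: "e \<le> 252000 * (L^9 * F) * k1" using cl that(1) by (simp add: mult_ac)
    have "e \<le> 600000 * (L^9 * F) * k2"
    proof (cases "\<epsilon> \<le> 1")
      case True
      have "300000 * (L^9 * F) * k2 \<le> 600000 * (L^9 * F) * k2" using LF that(2) by (intro mult_right_mono) auto
      then show ?thesis using that(4)[OF True] by linarith
    next
      case False
      have "252000 * (L^9 * F) * k1 \<le> 252000 * (L^9 * F) * (2 * k2)"
        using k1h False that(3) LF by (intro mult_left_mono) auto
      also have "\<dots> \<le> 600000 * (L^9 * F) * k2" using mult_nonneg_nonneg[OF LF that(2)] by (simp add: mult_ac)
      finally show ?thesis using e1 by linarith
    qed
    moreover have "e \<le> 600000 * (L^9 * F) * k1"
      using e1 mult_right_mono[of "252000 * (L^9 * F)" "600000 * (L^9 * F)" k1] LF k1 by linarith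
    ultimately have "e \<le> 600000 * (L^9 * F) * min k1 k2" by (simp add: min_def)
    then show ?thesis by (simp add: mult.assoc)
  qed
  show ?Y
    unfolding errY_def[symmetric] k1_def[symmetric]
  proof (rule comb)
    assume "\<epsilon> \<le> 1"
    then have "errY \<le> 226800 * (L^9 * F * (\<epsilon>\<^sup>2 + h\<^sup>2))" using apY by (simp add: mult.assoc)
    also have "\<dots> \<le> 300000 * (L^9 * F * (\<epsilon>\<^sup>2 + h\<^sup>2))" using LF by (intro mult_right_mono) auto
    finally show "errY \<le> 300000 * (L^9 * F) * (\<epsilon>\<^sup>2 + h\<^sup>2)" by (simp only: mult.assoc)
  qed (use err0 in auto)
  show ?X
    unfolding k1_def[symmetric]
  proof (rule comb)
    show X: "norm ((ys n + \<i> * ws n) - (y T + \<i> * w T)) \<le> errY + errW"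
      unfolding errY_def errW_def by (rule norm_position_diff_le)
    show "norm ((ys n + \<i> * ws n) - (y T + \<i> * w T)) \<le> 300000 * (L^9 * F) * (\<epsilon> + h\<^sup>2)" if "\<epsilon> \<le> 1"
      using apX[OF that] X by (simp only: mult.assoc)
  qed (use eps in auto)
qed

end

section \<open>From complex coordinates to the plane\<close>

definition to_complex :: "plane \<Rightarrow> complex" where
  "to_complex a = Complex (a $ 1) (a $ 2)"

definition of_complex :: "complex \<Rightarrow> plane" where
  "of_complex z = vector [Re z, Im z]"

lemma of_to_complex [simp]: "of_complex (to_complex a) = a"
  by (simp add: of_complex_def to_complex_def vec_eq_iff forall_2 vector_2)

lemma to_of_complex [simp]: "to_complex (of_complex z) = z"
  by (simp add: of_complex_def to_complex_def vector_2)

lemma to_complex_eq_iff: "to_complex a = to_complex b \<longleftrightarrow> a = b"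
  by (metis of_to_complex)

lemma to_complex_add: "to_complex (a + b) = to_complex a + to_complex b"
  and to_complex_diff: "to_complex (a - b) = to_complex a - to_complex b"
  and to_complex_minus: "to_complex (- a) = - to_complex a"
  and to_complex_scaleR: "to_complex (r *\<^sub>R a) = of_real r * to_complex a"
  and to_complex_perp: "to_complex (perp a) = \<i> * to_complex a"
  by (simp_all add: to_complex_def complex_eq_iff perp_def vector_2)

lemma of_complex_diff: "of_complex (a - b) = of_complex a - of_complex b"
  by (metis of_to_complex to_of_complex to_complex_diff)

lemma to_complex_linear: "linear to_complex"
proof
  show "to_complex (a + b) = to_complex a + to_complex b" for a b by (rule to_complex_add)
  show "to_complex (r *\<^sub>R a) = r *\<^sub>R to_complex a" for r a
    unfolding to_complex_scaleR by (simp add: scaleR_conv_of_real)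
qed

lemma of_complex_linear: "linear of_complex"
proof
  show "of_complex (a + b) = of_complex a + of_complex b" for a b
    by (metis of_to_complex to_of_complex to_complex_add)
  show "of_complex (r *\<^sub>R a) = r *\<^sub>R of_complex a" for r a
    by (metis of_to_complex to_of_complex linear_cmul[OF to_complex_linear])
qed

lemma norm_to_complex: "norm (to_complex a) = norm a"
  by (simp add: to_complex_def norm_complex_def norm_vec_def L2_set_def UNIV_2)

lemma norm_of_complex: "norm (of_complex z) = norm z"
  by (metis norm_to_complex to_of_complex)

definition complex_field :: "field \<Rightarrow> real \<Rightarrow> complex \<Rightarrow> complex" where
  "complex_field E t z = to_complex (E t (of_complex z))"

text \<open>The space-time slope \<open>A\<close> of the field splits into its derivative in time and its spatial differential.\<close>
lemma smooth_complex_field: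
  assumes E: "field_W_infinity 2 E"
  obtains Et D L where "smooth_field (complex_field E) Et D (K_x E) L"
proof (rule field_regularity[OF E])
  fix C :: real and A :: "real \<times> plane \<Rightarrow> (real \<times> plane) \<Rightarrow>\<^sub>L plane"
  assume K: "0 \<le> K_x E" and C: "0 \<le> C"
    and b: "\<And>t x. 0 \<le> t \<Longrightarrow> norm (E t x) \<le> C"
    and lx: "\<And>t x x'. 0 \<le> t \<Longrightarrow> norm (E t x - E t x') \<le> K_x E * norm (x - x')"
    and lz: "\<And>t x s x'. 0 \<le> t \<Longrightarrow> 0 \<le> s \<Longrightarrow> norm (E s x' - E t x) \<le> C * norm ((s, x') - (t, x))"
    and Ab: "\<And>t x v. 0 \<le> t \<Longrightarrow> norm (blinfun_apply (A (t, x)) v) \<le> C * norm v"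
    and Ax: "\<And>t x u. 0 \<le> t \<Longrightarrow> norm (blinfun_apply (A (t, x)) (0, u)) \<le> K_x E * norm u"
    and At: "\<And>t x s x'. 0 \<le> t \<Longrightarrow> 0 \<le> s \<Longrightarrow>
       norm (E s x' - E t x - blinfun_apply (A (t, x)) (s - t, x' - x)) \<le> C * (norm ((s, x') - (t, x)))\<^sup>2"
  define L where "L = 1 + K_x E + 6 * C"
  have L: "1 \<le> L" "K_x E \<le> L" "C \<le> L" "6 * C \<le> L" using K C by (auto simp: L_def)
  define Et where "Et t z = to_complex (blinfun_apply (A (t, of_complex z)) (1, 0))" for t z
  define D where "D t z u = to_complex (blinfun_apply (A (t, of_complex z)) (0, of_complex u))" for t z u
  let ?E = "complex_field E"
  have "smooth_field ?E Et D (K_x E) L"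
  proof (rule smooth_field.intro)
    show "norm (?E t x) \<le> L" if "0 \<le> t" for t x
      using b[OF that, of "of_complex x"] L by (simp add: complex_field_def norm_to_complex)
    show "norm (?E t x - ?E t x') \<le> K_x E * norm (x - x')" if "0 \<le> t" for t x x'
      using lx[OF that, of "of_complex x" "of_complex x'"]
      by (simp add: complex_field_def norm_to_complex norm_of_complex flip: to_complex_diff of_complex_diff)
    show "norm (?E s x - ?E t x) \<le> L * \<bar>s - t\<bar>" if "0 \<le> s" "0 \<le> t" for s t x
    proof -
      have "norm (?E s x - ?E t x) \<le> C * \<bar>s - t\<bar>"
        using lz[OF that(2,1), of "of_complex x" "of_complex x"]
        by (simp add: complex_field_def norm_to_complex norm_Pair flip: to_complex_diff)
      also have "\<dots> \<le> L * \<bar>s - t\<bar>" using L by (intro mult_right_mono) auto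
      finally show ?thesis .
    qed
    show "norm (Et t x) \<le> L" if "0 \<le> t" for t x
      using Ab[OF that, of "of_complex x" "(1, 0)"] L by (simp add: Et_def norm_to_complex norm_Pair)
    show "linear (D t x)" if "0 \<le> t" for t x
    proof -
      have "linear (\<lambda>u. (0 :: real, of_complex u))"
        by (rule linearI) (simp_all add: linear_add[OF of_complex_linear] linear_cmul[OF of_complex_linear])
      moreover have "linear (blinfun_apply (A (t, of_complex x)))"
        by (simp add: bounded_linear.linear blinfun.bounded_linear_right)
      ultimately show ?thesis
        unfolding D_def using linear_compose[OF linear_compose to_complex_linear] by (fastforce simp: o_def)
    qed
    show "norm (D t x u) \<le> K_x E * norm u" if "0 \<le> t" for t x u
      using Ax[OF that, of "of_complex x" "of_complex u"] by (simp add: D_def norm_to_complex norm_of_complex)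
    show "norm (D s x u - D t x' u) \<le> L * (\<bar>s - t\<bar> + norm (x - x')) * norm u" if st: "0 \<le> s" "0 \<le> t" for s t x x' u
    proof -
      let ?z' = "(s, of_complex x)" and ?z = "(t, of_complex x')" and ?u = "(0 :: real, of_complex u)"
      have "norm (blinfun_apply (A ?z') ?u - blinfun_apply (A ?z) ?u) \<le> 6 * C * norm (?z' - ?z) * norm ?u"
      proof (rule slope_lipschitz_of_taylor[where f = "\<lambda>(t, x). E t x" and V = "{k. fst k = 0}", OF C])
        show "norm ((case ?z' of (t, x) \<Rightarrow> E t x) - (case ?z of (t, x) \<Rightarrow> E t x) - blinfun_apply (A ?z) (?z' - ?z)) \<le> C * (norm (?z' - ?z))\<^sup>2"
          using At[OF st(2,1)] by simp
        fix k :: "real \<times> plane" assume k: "k \<in> {k. fst k = 0}"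
        then obtain k' where k': "k = (0, k')" by (cases k) auto
        show "norm ((case ?z' + k of (t, x) \<Rightarrow> E t x) - (case ?z of (t, x) \<Rightarrow> E t x) - blinfun_apply (A ?z) (?z' + k - ?z)) \<le> C * (norm (?z' + k - ?z))\<^sup>2"
          using At[OF st(2,1), of "of_complex x + k'" "of_complex x'"] by (simp add: k')
        show "norm ((case ?z' + k of (t, x) \<Rightarrow> E t x) - (case ?z' of (t, x) \<Rightarrow> E t x) - blinfun_apply (A ?z') k) \<le> C * (norm k)\<^sup>2"
          using At[OF st(1,1), of "of_complex x + k'" "of_complex x"] by (simp add: k')
      qed auto
      also have "norm ?u = norm u" by (simp add: norm_Pair norm_of_complex)
      also have "6 * C * norm (?z' - ?z) * norm u \<le> L * (\<bar>s - t\<bar> + norm (x - x')) * norm u"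
      proof (intro mult_right_mono mult_mono)
        have "norm (s - t, of_complex x - of_complex x') \<le> norm (s - t) + norm (of_complex x - of_complex x')"
          by (rule norm_Pair_le)
        then show "norm (?z' - ?z) \<le> \<bar>s - t\<bar> + norm (x - x')"
          by (simp add: norm_of_complex flip: of_complex_diff)
      qed (use L C in auto)
      finally show ?thesis by (simp add: D_def norm_to_complex flip: to_complex_diff)
    qed
    show "norm (?E s x' - ?E t x - (s - t) *\<^sub>R Et t x - D t x (x' - x)) \<le> L * ((s - t)\<^sup>2 + (norm (x' - x))\<^sup>2)"
      if st: "0 \<le> s" "0 \<le> t" for s t x x'
    proof -
      let ?A = "blinfun_apply (A (t, of_complex x))"
      have "(s - t, of_complex x' - of_complex x) = (s - t) *\<^sub>R (1, 0) + (0, of_complex (x' - x))"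
        by (simp add: of_complex_diff)
      then have "?A (s - t, of_complex x' - of_complex x) = (s - t) *\<^sub>R ?A (1, 0) + ?A (0, of_complex (x' - x))"
        by (simp only: blinfun.add_right blinfun.scaleR_right)
      then have "?E s x' - ?E t x - (s - t) *\<^sub>R Et t x - D t x (x' - x)
         = to_complex (E s (of_complex x') - E t (of_complex x) - ?A (s - t, of_complex x' - of_complex x))"
        by (simp add: complex_field_def Et_def D_def to_complex_diff to_complex_add linear_cmul[OF to_complex_linear])
      then have "norm (?E s x' - ?E t x - (s - t) *\<^sub>R Et t x - D t x (x' - x))
         \<le> C * (norm ((s, of_complex x') - (t, of_complex x)))\<^sup>2"
        using At[OF st(2,1)] by (simp only: norm_to_complex)
      also have "(norm ((s, of_complex x') - (t, of_complex x)))\<^sup>2 = (s - t)\<^sup>2 + (norm (x' - x))\<^sup>2"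
        by (simp add: norm_Pair norm_of_complex flip: of_complex_diff)
      also have "C * ((s - t)\<^sup>2 + (norm (x' - x))\<^sup>2) \<le> L * ((s - t)\<^sup>2 + (norm (x' - x))\<^sup>2)"
        using L by (intro mult_right_mono) auto
      finally show ?thesis .
    qed
  qed (use K L in auto)
  then show thesis by (rule that)
qed

text \<open>Multiplying the velocity equations by the time increments turns them into equations for \<open>w = \<epsilon> v\<close>, each of
which determines one unknown from the previous ones.\<close>
lemma scheme_step_iff:
  assumes eps: "0 < \<epsilon>" and h: "0 < h"
  shows "scheme_step E \<epsilon> h t (y, v) (y', v') \<longleftrightarrow>
     to_complex y' = next_y (complex_field E) \<epsilon> h t (to_complex y) (of_real \<epsilon> * to_complex v) \<and>
     of_real \<epsilon> * to_complex v' = next_w (complex_field E) \<epsilon> h t (to_complex y) (of_real \<epsilon> * to_complex v)"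
    (is "?L \<longleftrightarrow> ?R")
proof -
  let ?E = "complex_field E"
  let ?th = "t + h / (2 * \<gamma>)"
  define Y W where "Y = to_complex y" and "W = of_real \<epsilon> * to_complex v"
  have g: "0 < \<gamma>" by (rule gamma_pos)
  have cE: "to_complex (E s (a + perp (\<epsilon> *\<^sub>R b))) = ?E s (to_complex a + \<i> * (of_real \<epsilon> * to_complex b))" for s a b
  proof -
    have "a + perp (\<epsilon> *\<^sub>R b) = of_complex (to_complex a + \<i> * (of_real \<epsilon> * to_complex b))"
      by (simp flip: to_complex_eq_iff add: to_complex_add to_complex_perp to_complex_scaleR)
    then show ?thesis by (simp add: complex_field_def)
  qed
  have quot: "\<epsilon> *\<^sub>R ((a - b) /\<^sub>R c) = d \<longleftrightarrow> of_real \<epsilon> * to_complex a - of_real \<epsilon> * to_complex b = of_real c * to_complex d"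
    if "0 < c" for a b d :: plane and c
    unfolding to_complex_eq_iff[symmetric] using that
    by (simp add: to_complex_scaleR to_complex_diff field_simps)
  have quot1: "(a - b) /\<^sub>R c = d \<longleftrightarrow> to_complex a - to_complex b = of_real c * to_complex d"
    if "0 < c" for a b d :: plane and c
    unfolding to_complex_eq_iff[symmetric] using that
    by (simp add: to_complex_scaleR to_complex_diff field_simps)
  have Fv: "to_complex (F_v E \<epsilon> s a (\<epsilon> *\<^sub>R b) (\<epsilon> *\<^sub>R c)) = ?E s (to_complex a + \<i> * (of_real \<epsilon> * to_complex b)) - \<i> * (of_real \<epsilon> * to_complex c) / of_real (\<epsilon>\<^sup>2)" for s a b c
    unfolding F_v_def to_complex_diff cE
    by (simp add: to_complex_scaleR to_complex_perp divide_inverse mult_ac)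
  have Fy: "to_complex (F_y E s a (\<epsilon> *\<^sub>R b)) = - (\<i> * ?E s (to_complex a + \<i> * (of_real \<epsilon> * to_complex b)))" for s a b
    unfolding F_y_def to_complex_minus to_complex_perp cE ..
  have mu: "of_real h * (\<i> * w / of_real (\<epsilon>\<^sup>2)) = imu \<epsilon> h * w" for w :: complex by (simp add: imu_def)
  have nz: "1 + of_real \<gamma> * imu \<epsilon> h \<noteq> 0" by (rule implicit_nonzero[OF eps h])
  define e where "e = ?E t (Y + \<i> * W)"
  have S1: "of_real \<epsilon> * to_complex a - W = of_real (\<gamma> * h) * (e - \<i> * (of_real \<epsilon> * to_complex a) / of_real (\<epsilon>\<^sup>2))
     \<longleftrightarrow> of_real \<epsilon> * to_complex a = stage_w ?E \<epsilon> h t Y W" for a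
  proof -
    have "of_real (\<gamma> * h) * (e - \<i> * (of_real \<epsilon> * to_complex a) / of_real (\<epsilon>\<^sup>2))
       = of_real (\<gamma> * h) * e - of_real \<gamma> * (of_real h * (\<i> * (of_real \<epsilon> * to_complex a) / of_real (\<epsilon>\<^sup>2)))"
      by (simp add: algebra_simps)
    also have "\<dots> = of_real (\<gamma> * h) * e - of_real \<gamma> * (imu \<epsilon> h * (of_real \<epsilon> * to_complex a))" unfolding mu ..
    finally show ?thesis using nz by (simp add: stage_w_def e_def[symmetric] eq_divide_eq) (auto simp: algebra_simps)
  qed
  define wt where "wt = stage_w ?E \<epsilon> h t Y W"
  define yh where "yh = hat_y ?E \<epsilon> h t Y W"
  define wh where "wh = hat_w ?E \<epsilon> h t Y W"
  define r where "r = e - \<i> * wt / of_real (\<epsilon>\<^sup>2)"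
  have hr: "of_real h * r = of_real h * e - imu \<epsilon> h * wt"
    unfolding r_def right_diff_distrib mu ..
  have S2: "a - Y = of_real (h / (2 * \<gamma>)) * (- (\<i> * ?E t (Y + \<i> * wt))) \<longleftrightarrow> a = yh" for a
    by (simp add: yh_def hat_y_def wt_def algebra_simps)
  have S3: "a - W = of_real (h / (2 * \<gamma>)) * r \<longleftrightarrow> a = wh" for a
  proof -
    have "wh = W + of_real (h / (2 * \<gamma>)) * r"
      unfolding wh_def hat_w_def wt_def[symmetric] e_def[symmetric] hr[symmetric] by simp
    then show ?thesis by (auto simp: algebra_simps)
  qed
  define eh where "eh = ?E ?th (yh + \<i> * wh)"
  have S4: "a - W = of_real h * (of_real (1 - \<gamma>) * r + of_real \<gamma> * (eh - \<i> * a / of_real (\<epsilon>\<^sup>2)))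
      \<longleftrightarrow> a = next_w ?E \<epsilon> h t Y W" for a
  proof -
    have "of_real h * (of_real (1 - \<gamma>) * r + of_real \<gamma> * (eh - \<i> * a / of_real (\<epsilon>\<^sup>2)))
       = of_real (1 - \<gamma>) * (of_real h * r) + of_real (\<gamma> * h) * eh - of_real \<gamma> * (of_real h * (\<i> * a / of_real (\<epsilon>\<^sup>2)))"
      by (simp add: algebra_simps)
    also have "\<dots> = of_real (1 - \<gamma>) * (of_real h * e - imu \<epsilon> h * wt) + of_real (\<gamma> * h) * eh - of_real \<gamma> * (imu \<epsilon> h * a)"
      unfolding mu hr ..
    finally show ?thesis
      unfolding next_w_def wt_def[symmetric] e_def[symmetric] yh_def[symmetric] wh_def[symmetric] eh_def[symmetric]
      using nz by (simp add: eq_divide_eq) (auto simp: algebra_simps)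
  qed
  define wn where "wn = next_w ?E \<epsilon> h t Y W"
  have S5: "a - Y = of_real h * (of_real (1 - \<gamma>) * (- (\<i> * ?E t (Y + \<i> * wt))) + of_real \<gamma> * (- (\<i> * ?E ?th (yh + \<i> * wn))))
      \<longleftrightarrow> a = next_y ?E \<epsilon> h t Y W" for a
    by (simp add: next_y_def wt_def yh_def wn_def algebra_simps)
  have L_iff: "?L \<longleftrightarrow> (\<exists>vt yy vh. of_real \<epsilon> * to_complex vt = wt \<and> to_complex yy = yh \<and> of_real \<epsilon> * to_complex vh = wh
     \<and> to_complex y' = next_y ?E \<epsilon> h t Y W \<and> of_real \<epsilon> * to_complex v' = wn)"
  proof -
    have c: "0 < \<gamma> * h" "0 < h / (2 * \<gamma>)" using g h by auto
    have "?L \<longleftrightarrow> (\<exists>vt yy vh.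
        of_real \<epsilon> * to_complex vt - W = of_real (\<gamma> * h) * (e - \<i> * (of_real \<epsilon> * to_complex vt) / of_real (\<epsilon>\<^sup>2)) \<and>
        to_complex yy - Y = of_real (h / (2 * \<gamma>)) * (- (\<i> * ?E t (Y + \<i> * (of_real \<epsilon> * to_complex vt)))) \<and>
        of_real \<epsilon> * to_complex vh - W = of_real (h / (2 * \<gamma>)) * (e - \<i> * (of_real \<epsilon> * to_complex vt) / of_real (\<epsilon>\<^sup>2)) \<and>
        to_complex y' - Y = of_real h * (of_real (1 - \<gamma>) * (- (\<i> * ?E t (Y + \<i> * (of_real \<epsilon> * to_complex vt))))
           + of_real \<gamma> * (- (\<i> * ?E ?th (to_complex yy + \<i> * (of_real \<epsilon> * to_complex v'))))) \<and>
        of_real \<epsilon> * to_complex v' - W = of_real h * (of_real (1 - \<gamma>) * (e - \<i> * (of_real \<epsilon> * to_complex vt) / of_real (\<epsilon>\<^sup>2))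
           + of_real \<gamma> * (?E ?th (to_complex yy + \<i> * (of_real \<epsilon> * to_complex vh)) - \<i> * (of_real \<epsilon> * to_complex v') / of_real (\<epsilon>\<^sup>2))))"
      unfolding scheme_step_def prod.case Let_def quot[OF c(1)] quot[OF c(2)] quot[OF h] quot1[OF c(2)] quot1[OF h]
        to_complex_add to_complex_scaleR Fv Fy Y_def[symmetric] W_def[symmetric] e_def[symmetric] ..
    also have "\<dots> \<longleftrightarrow> (\<exists>vt yy vh. of_real \<epsilon> * to_complex vt = wt \<and> to_complex yy = yh \<and> of_real \<epsilon> * to_complex vh = wh
       \<and> to_complex y' = next_y ?E \<epsilon> h t Y W \<and> of_real \<epsilon> * to_complex v' = wn)"
    proof (intro ex_cong1)
      fix vt yy vh
      show "(of_real \<epsilon> * to_complex vt - W = of_real (\<gamma> * h) * (e - \<i> * (of_real \<epsilon> * to_complex vt) / of_real (\<epsilon>\<^sup>2)) \<and>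
        to_complex yy - Y = of_real (h / (2 * \<gamma>)) * (- (\<i> * ?E t (Y + \<i> * (of_real \<epsilon> * to_complex vt)))) \<and>
        of_real \<epsilon> * to_complex vh - W = of_real (h / (2 * \<gamma>)) * (e - \<i> * (of_real \<epsilon> * to_complex vt) / of_real (\<epsilon>\<^sup>2)) \<and>
        to_complex y' - Y = of_real h * (of_real (1 - \<gamma>) * (- (\<i> * ?E t (Y + \<i> * (of_real \<epsilon> * to_complex vt))))
           + of_real \<gamma> * (- (\<i> * ?E ?th (to_complex yy + \<i> * (of_real \<epsilon> * to_complex v'))))) \<and>
        of_real \<epsilon> * to_complex v' - W = of_real h * (of_real (1 - \<gamma>) * (e - \<i> * (of_real \<epsilon> * to_complex vt) / of_real (\<epsilon>\<^sup>2))
           + of_real \<gamma> * (?E ?th (to_complex yy + \<i> * (of_real \<epsilon> * to_complex vh)) - \<i> * (of_real \<epsilon> * to_complex v') / of_real (\<epsilon>\<^sup>2))))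
       = (of_real \<epsilon> * to_complex vt = wt \<and> to_complex yy = yh \<and> of_real \<epsilon> * to_complex vh = wh
         \<and> to_complex y' = next_y ?E \<epsilon> h t Y W \<and> of_real \<epsilon> * to_complex v' = wn)" (is "?P1 \<and> ?P2 \<and> ?P3 \<and> ?P4 \<and> ?P5 \<longleftrightarrow> ?Q1 \<and> ?Q2 \<and> ?Q3 \<and> ?Q4 \<and> ?Q5")
      proof -
        have q1: "?P1 \<longleftrightarrow> ?Q1" unfolding S1 wt_def ..
        have q2: "?P2 \<longleftrightarrow> ?Q2" if ?Q1 unfolding that S2 ..
        have q3: "?P3 \<longleftrightarrow> ?Q3" if ?Q1 unfolding that r_def[symmetric] S3 ..
        have q5: "?P5 \<longleftrightarrow> ?Q5" if ?Q1 ?Q2 ?Q3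
          unfolding that r_def[symmetric] eh_def[symmetric] S4 wn_def ..
        have q4: "?P4 \<longleftrightarrow> ?Q4" if ?Q1 ?Q2 ?Q5 unfolding that S5 ..
        show ?thesis using q1 q2 q3 q4 q5 by blast
      qed
    qed
    finally show ?thesis .
  qed
  also have "\<dots> \<longleftrightarrow> to_complex y' = next_y ?E \<epsilon> h t Y W \<and> of_real \<epsilon> * to_complex v' = wn" (is "?X \<longleftrightarrow> ?Z")
  proof
    assume ?Z
    moreover have "of_real \<epsilon> * to_complex (of_complex (z / of_real \<epsilon>)) = z" for z using eps by simp
    moreover have "to_complex (of_complex yh) = yh" by simp
    ultimately show ?X by blast
  qed blast
  finally show ?thesis unfolding Y_def W_def wn_def .
qed

lemma unique_step_sequence:
  assumes "\<And>(n::nat) p. \<exists>!p'. R n p p'"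
  shows "\<exists>!u. u 0 = p0 \<and> (\<forall>n. R n (u n) (u (Suc n)))"
proof -
  define F where "F n p = (THE p'. R n p p')" for n p
  have F: "R n p p' \<longleftrightarrow> p' = F n p" for n p p'
    unfolding F_def using theI'[OF assms[of n p]] assms[of n p] by blast
  show ?thesis
    unfolding F
  proof (rule ex1I)
    show "rec_nat p0 F 0 = p0 \<and> (\<forall>n. rec_nat p0 F (Suc n) = F n (rec_nat p0 F n))" by simp
    fix u assume "u 0 = p0 \<and> (\<forall>n. u (Suc n) = F n (u n))"
    then have "u n = rec_nat p0 F n" for n by (induction n) auto
    then show "u = rec_nat p0 F" by auto
  qed
qed

lemma scheme_step_unique:
  assumes eps: "0 < \<epsilon>" and h: "0 < h"
  shows "\<exists>!p'. scheme_step E \<epsilon> h t p p'"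
proof -
  obtain y v where p: "p = (y, v)" by (cases p)
  let ?y = "next_y (complex_field E) \<epsilon> h t (to_complex y) (of_real \<epsilon> * to_complex v)"
  let ?w = "next_w (complex_field E) \<epsilon> h t (to_complex y) (of_real \<epsilon> * to_complex v)"
  have "scheme_step E \<epsilon> h t p (y', v') \<longleftrightarrow> y' = of_complex ?y \<and> v' = of_complex (?w / of_real \<epsilon>)" for y' v'
    unfolding p scheme_step_iff[OF eps h]
    using eps by (auto simp: to_complex_eq_iff[symmetric] eq_divide_eq mult.commute)
  then show ?thesis by (intro ex1I[of _ "(of_complex ?y, of_complex (?w / of_real \<epsilon>))"]) auto
qed

lemma scheme_solution_unique:
  assumes "0 < \<epsilon>" "0 < h"
  shows "\<exists>!u. scheme_solution E \<epsilon> h x0 v0 u"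
  unfolding scheme_solution_def by (rule unique_step_sequence) (rule scheme_step_unique[OF assms])

lemma characteristic_error_bounds:
  assumes E: "field_W_infinity 2 E"
  shows "\<exists>C. \<forall>n h \<epsilon> x0 v0 u x v. 0 < h \<and> 0 < \<epsilon> \<and> scheme_solution E \<epsilon> h x0 v0 u \<and> characteristic_solution E \<epsilon> x0 v0 x v \<longrightarrow>
     norm (fst (u n) - (x (real n * h) - \<epsilon> *\<^sub>R perp (v (real n * h))))
       \<le> C * (exp (52 * K_x E * (real n * h)) * (1 + real n * h)^3 * (1 + \<epsilon>\<^sup>2 + (norm v0)\<^sup>2))
          * min (h\<^sup>2 / \<epsilon>^5 * (1 + \<epsilon>^3)) (\<epsilon>\<^sup>2 + h\<^sup>2) \<and>
     norm (fst (u n) + \<epsilon> *\<^sub>R perp (snd (u n)) - x (real n * h))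
       \<le> C * (exp (52 * K_x E * (real n * h)) * (1 + real n * h)^3 * (1 + \<epsilon>\<^sup>2 + (norm v0)\<^sup>2))
          * min (h\<^sup>2 / \<epsilon>^5 * (1 + \<epsilon>^3)) (\<epsilon> + h\<^sup>2)"
proof -
  obtain Et D L where S: "smooth_field (complex_field E) Et D (K_x E) L"
    using smooth_complex_field[OF E] by blast
  show ?thesis
  proof (intro exI[of _ "600000 * L^9"] allI impI, elim conjE)
    fix n :: nat and h \<epsilon> :: real and x0 v0 :: plane and u and x v :: "real \<Rightarrow> plane"
    assume h: "0 < h" and eps: "0 < \<epsilon>" and u: "scheme_solution E \<epsilon> h x0 v0 u"
      and xv: "characteristic_solution E \<epsilon> x0 v0 x v"
    interpret scheme "complex_field E" Et D "K_x E" L \<epsilon> h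
      using S h eps by (simp add: scheme_def scheme_axioms_def)
    define y where "y t = to_complex (x t - \<epsilon> *\<^sub>R perp (v t))" for t
    define w where "w t = of_real \<epsilon> * to_complex (v t)" for t
    define ys where "ys n = to_complex (fst (u n))" for n
    define ws where "ws n = of_real \<epsilon> * to_complex (snd (u n))" for n
    have yw: "y t + \<i> * w t = to_complex (x t)" for t
      by (simp add: y_def w_def to_complex_diff to_complex_scaleR to_complex_perp)
    have bl: "bounded_linear to_complex" using to_complex_linear by (simp add: linear_conv_bounded_linear)
    have ex: "exact \<epsilon> y w"
      unfolding exact_def
    proof (intro allI impI)
      fix t :: real assume t: "0 \<le> t"
      obtain x' v' where d: "(x has_vector_derivative x') (at t within {0..})" "(v has_vector_derivative v') (at t within {0..})"
        and eq: "\<epsilon> *\<^sub>R x' = v t" "\<epsilon> *\<^sub>R v' = E t (x t) - perp (v t) /\<^sub>R \<epsilon>"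
        using xv t unfolding characteristic_solution_def by blast
      have e: "complex_field E t (y t + \<i> * w t) = to_complex (E t (x t))" by (simp add: yw complex_field_def)
      have x': "of_real \<epsilon> * to_complex x' = to_complex (v t)" using eq(1) by (metis to_complex_scaleR)
      have v': "of_real \<epsilon> * to_complex v' = to_complex (E t (x t)) - \<i> * to_complex (v t) / of_real \<epsilon>"
        using arg_cong[OF eq(2), of to_complex]
        by (simp add: to_complex_scaleR to_complex_diff to_complex_perp divide_inverse mult.commute)
      have dw: "(w has_vector_derivative of_real \<epsilon> * to_complex v') (at t within {0..})"
        unfolding w_def by (intro has_vector_derivative_mult_right bounded_linear.has_vector_derivative[OF bl d(2)])
      have dx: "((\<lambda>t. to_complex (x t)) has_vector_derivative to_complex x') (at t within {0..})"
        by (rule bounded_linear.has_vector_derivative[OF bl d(1)])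
      have "((\<lambda>t. to_complex (x t) - \<i> * w t) has_vector_derivative to_complex x' - \<i> * (of_real \<epsilon> * to_complex v')) (at t within {0..})"
        by (intro has_vector_derivative_diff has_vector_derivative_mult_right dx dw)
      moreover have "(\<lambda>t. to_complex (x t) - \<i> * w t) = y" by (simp add: fun_eq_iff flip: yw)
      moreover have "to_complex x' - \<i> * (of_real \<epsilon> * to_complex v') = - \<i> * complex_field E t (y t + \<i> * w t)"
        unfolding e v' x'[symmetric] using eps by (simp add: algebra_simps)
      ultimately show "(y has_vector_derivative - \<i> * complex_field E t (y t + \<i> * w t)) (at t within {0..})
         \<and> (w has_vector_derivative complex_field E t (y t + \<i> * w t) - \<i> * w t / of_real (\<epsilon>\<^sup>2)) (at t within {0..})"
        using dw unfolding e v' using eps by (simp add: w_def power2_eq_square)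
    qed
    have s: "scheme_seq ys ws"
      unfolding scheme_seq_def
    proof
      fix n
      have "scheme_step E \<epsilon> h (real n * h) (fst (u n), snd (u n)) (fst (u (Suc n)), snd (u (Suc n)))"
        using u by (simp add: scheme_solution_def)
      then show "ys (Suc n) = next_y (complex_field E) \<epsilon> h (real n * h) (ys n) (ws n) \<and> ws (Suc n) = next_w (complex_field E) \<epsilon> h (real n * h) (ys n) (ws n)"
        unfolding scheme_step_iff[OF eps h] ys_def ws_def .
    qed
    have init: "ys 0 = y 0" "ws 0 = w 0"
      using u xv by (auto simp: scheme_solution_def characteristic_solution_def ys_def ws_def y_def w_def)
    have V: "norm (w 0) = \<epsilon> * norm v0"
      using xv eps by (simp add: w_def characteristic_solution_def norm_mult norm_to_complex)
    let ?t = "real n * h"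
    have "fst (u n) - (x ?t - \<epsilon> *\<^sub>R perp (v ?t)) = of_complex (ys n - y ?t)"
      by (simp flip: to_complex_eq_iff add: to_complex_diff ys_def y_def)
    then have Y: "norm (fst (u n) - (x ?t - \<epsilon> *\<^sub>R perp (v ?t))) = norm (ys n - y ?t)" by (simp only: norm_of_complex)
    have "fst (u n) + \<epsilon> *\<^sub>R perp (snd (u n)) - x ?t = of_complex ((ys n + \<i> * ws n) - (y ?t + \<i> * w ?t))"
      unfolding yw by (simp flip: to_complex_eq_iff add: to_complex_diff to_complex_add to_complex_scaleR to_complex_perp ys_def ws_def)
    then have X: "norm (fst (u n) + \<epsilon> *\<^sub>R perp (snd (u n)) - x ?t) = norm ((ys n + \<i> * ws n) - (y ?t + \<i> * w ?t))"
      by (simp only: norm_of_complex)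
    show "norm (fst (u n) - (x ?t - \<epsilon> *\<^sub>R perp (v ?t)))
       \<le> 600000 * L^9 * (exp (52 * K_x E * ?t) * (1 + ?t)^3 * (1 + \<epsilon>\<^sup>2 + (norm v0)\<^sup>2))
          * min (h\<^sup>2 / \<epsilon>^5 * (1 + \<epsilon>^3)) (\<epsilon>\<^sup>2 + h\<^sup>2) \<and>
     norm (fst (u n) + \<epsilon> *\<^sub>R perp (snd (u n)) - x ?t)
       \<le> 600000 * L^9 * (exp (52 * K_x E * ?t) * (1 + ?t)^3 * (1 + \<epsilon>\<^sup>2 + (norm v0)\<^sup>2))
          * min (h\<^sup>2 / \<epsilon>^5 * (1 + \<epsilon>^3)) (\<epsilon> + h\<^sup>2)"
      unfolding X Y using error_bounds[OF ex s init V, of n] by blast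
  qed
qed

theorem theorem5p1:
  shows "(\<forall>E \<epsilon> \<Delta>t x0 v0. 0 < \<epsilon> \<and> 0 < \<Delta>t \<longrightarrow> (\<exists>!u. scheme_solution E \<epsilon> \<Delta>t x0 v0 u))
    \<and> (\<exists>C0::real. \<forall>E. field_W_infinity 2 E \<longrightarrow> (\<exists>C::real. \<forall>(n::nat) \<Delta>t \<epsilon> x0 v0 u x v.
          0 < \<Delta>t \<and> 0 < \<epsilon> \<and> scheme_solution E \<epsilon> \<Delta>t x0 v0 u \<and> characteristic_solution E \<epsilon> x0 v0 x v \<longrightarrow>
          (let t\<^sub>n = real n * \<Delta>t; x\<^sub>n = fst (u n) + \<epsilon> *\<^sub>R perp (snd (u n)) in
           norm (x\<^sub>n - x t\<^sub>n)
             \<le> C * exp (C0 * K_x E * t\<^sub>n) * (1 + t\<^sub>n) ^ 3 * (1 + \<epsilon>\<^sup>2 + (norm v0)\<^sup>2)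
                 * min (\<Delta>t\<^sup>2 / \<epsilon> ^ 5 * (1 + \<epsilon> ^ 3)) (\<epsilon> + \<Delta>t\<^sup>2))))
    \<and> (\<exists>C0::real. \<forall>E. field_W_infinity 2 E \<longrightarrow> (\<exists>C::real. \<forall>(n::nat) \<Delta>t \<epsilon> x0 v0 u x v.
          0 < \<Delta>t \<and> 0 < \<epsilon> \<and> scheme_solution E \<epsilon> \<Delta>t x0 v0 u \<and> characteristic_solution E \<epsilon> x0 v0 x v \<longrightarrow>
          (let t\<^sub>n = real n * \<Delta>t; y\<^sub>n = fst (u n); y = (\<lambda>t. x t - \<epsilon> *\<^sub>R perp (v t)) in
           norm (y\<^sub>n - y t\<^sub>n)
             \<le> C * exp (C0 * K_x E * t\<^sub>n) * (1 + t\<^sub>n) ^ 4 * (1 + \<epsilon>\<^sup>2 + (norm v0)\<^sup>2)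
                 * min (\<Delta>t\<^sup>2 / \<epsilon> ^ 5 * (1 + \<epsilon> ^ 3)) (\<epsilon>\<^sup>2 + \<Delta>t\<^sup>2))))"
proof (intro conjI, goal_cases)
  case 1
  show ?case using scheme_solution_unique by blast
next
  case 2
  show ?case
  proof (rule exI[of _ 52], intro allI impI, goal_cases)
    case (1 E)
    show ?case using characteristic_error_bounds[OF 1] unfolding Let_def mult.assoc by blast
  qed
next
  case 3
  show ?case
  proof (rule exI[of _ 52], intro allI impI, goal_cases)
    case (1 E)
    obtain C where C: "\<And>n h \<epsilon> x0 v0 u x v. 0 < h \<and> 0 < \<epsilon> \<and> scheme_solution E \<epsilon> h x0 v0 u \<and> characteristic_solution E \<epsilon> x0 v0 x v \<Longrightarrow>
       norm (fst (u n) - (x (real n * h) - \<epsilon> *\<^sub>R perp (v (real n * h))))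
       \<le> C * (exp (52 * K_x E * (real n * h)) * (1 + real n * h)^3 * (1 + \<epsilon>\<^sup>2 + (norm v0)\<^sup>2))
          * min (h\<^sup>2 / \<epsilon>^5 * (1 + \<epsilon>^3)) (\<epsilon>\<^sup>2 + h\<^sup>2)"
      using characteristic_error_bounds[OF 1] by blast
    show ?case
      unfolding Let_def
    proof (rule exI[of _ "\<bar>C\<bar>"], intro allI impI)
      fix n :: nat and h \<epsilon> :: real and x0 v0 u x v
      assume a: "0 < h \<and> 0 < \<epsilon> \<and> scheme_solution E \<epsilon> h x0 v0 u \<and> characteristic_solution E \<epsilon> x0 v0 x v"
      let ?t = "real n * h" and ?m = "min (h\<^sup>2 / \<epsilon>^5 * (1 + \<epsilon>^3)) (\<epsilon>\<^sup>2 + h\<^sup>2)"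
      have t: "0 \<le> ?t" and m: "0 \<le> ?m" using a by auto
      have p: "(1 + ?t)^3 \<le> (1 + ?t)^4" using t by (intro power_increasing) auto
      have "norm (fst (u n) - (x ?t - \<epsilon> *\<^sub>R perp (v ?t)))
        \<le> C * (exp (52 * K_x E * ?t) * (1 + ?t)^3 * (1 + \<epsilon>\<^sup>2 + (norm v0)\<^sup>2)) * ?m" by (rule C[OF a])
      also have "\<dots> \<le> \<bar>C\<bar> * (exp (52 * K_x E * ?t) * (1 + ?t)^4 * (1 + \<epsilon>\<^sup>2 + (norm v0)\<^sup>2)) * ?m"
        using t m p by (intro mult_right_mono mult_mono) auto
      finally show "norm (fst (u n) - (x ?t - \<epsilon> *\<^sub>R perp (v ?t)))
        \<le> \<bar>C\<bar> * exp (52 * K_x E * ?t) * (1 + ?t)^4 * (1 + \<epsilon>\<^sup>2 + (norm v0)\<^sup>2) * ?m" by (simp only: mult.assoc)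
    qed
  qed
qed

end
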